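(* Let $\Lambda$ be a finite set and let $A=(A_{xy})_{x,y\in\Lambda}$ be a real symmetric, positive definite matrix with $A_{xy}\le 0$ for all $x\neq y$ and spectral radius $\|A\|\le 1$. For every $\beta\ge 0$ and every $h\in\mathbb{R}^\Lambda$, the log-Sobolev constant $\gamma_{\beta,h}$ of the Ising model $\mu_{\beta,h}$ (defined in the context) satisfies \[ \frac{1}{\gamma_{\beta,h}} \le \frac12 + \int_0^\beta e^{2\int_0^t \chi_s\,ds}\,dt , \] where $\chi_s$ is the zero-field susceptibility at inverse temperature $s$.
   Context: $(\cdot,\cdot)$ is the standard inner product on $\mathbb{R}^\Lambda$. For $\beta\ge 0$ and $h\in\mathbb{R}^\Lambda$, the ferromagnetic Ising model $\mu_{\beta,h}$ is the probability measure on $\{\pm1\}^\Lambda$ with $\mu_{\beta,h}(\sigma)\propto e^{-\frac{\beta}{2}(\sigma,A\sigma)}e^{(h,\sigma)}$; write $\mathbb{E}_{\mu_{\beta,h}}$ for its expectation. For $x\in\Lambda$ and $\sigma\in\{\pm1\}^\Lambda$, $\sigma^x$ denotes the configuration obtained from $\sigma$ by flipping the sign of $\sigma_x$. The Dirichlet form is $D_{\mu_{\beta,h}}(F)=\frac12\sum_{x\in\Lambda}\mathbb{E}_{\mu_{\beta,h}}\big[(F(\sigma)-F(\sigma^x))^2\big]$. The entropy of $F\ge 0$ is $\mathrm{Ent}_{\mu_{\beta,h}}(F)=\mathbb{E}_{\mu_{\beta,h}}\Phi(F)-\Phi(\mathbb{E}_{\mu_{\beta,h}}F)$ with $\Phi(x)=x\log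 x$. The log-Sobolev constant $\gamma_{\beta,h}$ is the largest constant such that $\mathrm{Ent}_{\mu_{\beta,h}}(F)\le \frac{2}{\gamma_{\beta,h}}D_{\mu_{\beta,h}}(\sqrt F)$ for all nonnegative $F:\{\pm1\}^\Lambda\to\mathbb{R}$. The zero-field susceptibility at inverse temperature $s\ge0$ is $\chi_s=\sup_{x\in\Lambda}\sum_{y\in\Lambda}\mathbb{E}_{\mu_{s,0}}(\sigma_x\sigma_y)$. *)

theory Defs
  imports "HOL-Analysis.Analysis"
begin

definition spins :: "(real^'n::finite) set" where
  "spins = {\<sigma>. \<forall>x. \<sigma>$x = 1 \<or> \<sigma>$x = -1}"

definition flip :: "'n::finite \<Rightarrow> real^'n \<Rightarrow> real^'n" where
  "flip x \<sigma> = (\<chi> y. if y = x then - \<sigma>$y else \<sigma>$y)"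

definition ising_weight :: "real^'n^'n \<Rightarrow> real \<Rightarrow> real^'n \<Rightarrow> real^'n::finite \<Rightarrow> real" where
  "ising_weight A \<beta> h \<sigma> = exp (- (\<beta> / 2) * (\<sigma> \<bullet> (A *v \<sigma>))) * exp (h \<bullet> \<sigma>)"

definition ising_Z :: "real^'n^'n \<Rightarrow> real \<Rightarrow> real^'n::finite \<Rightarrow> real" where
  "ising_Z A \<beta> h = (\<Sum>\<sigma>\<in>spins. ising_weight A \<beta> h \<sigma>)"

definition ising_E :: "real^'n^'n \<Rightarrow> real \<Rightarrow> real^'n::finite \<Rightarrow> (real^'n \<Rightarrow> real) \<Rightarrow> real" where
  "ising_E A \<beta> h F = (\<Sum>\<sigma>\<in>spins. F \<sigma> * ising_weight A \<beta> h \<sigma>) / ising_Z A \<beta> h"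

definition dirichlet :: "real^'n^'n \<Rightarrow> real \<Rightarrow> real^'n::finite \<Rightarrow> (real^'n \<Rightarrow> real) \<Rightarrow> real" where
  "dirichlet A \<beta> h F = (1/2) * (\<Sum>x\<in>UNIV. ising_E A \<beta> h (\<lambda>\<sigma>. (F \<sigma> - F (flip x \<sigma>))^2))"

definition Phi :: "real \<Rightarrow> real" where
  "Phi t = t * ln t"   (* note ln 0 = 0 in Isabelle, so Phi 0 = 0 *)

definition entropy :: "real^'n^'n \<Rightarrow> real \<Rightarrow> real^'n::finite \<Rightarrow> (real^'n \<Rightarrow> real) \<Rightarrow> real" where
  "entropy A \<beta> h F = ising_E A \<beta> h (\<lambda>\<sigma>. Phi (F \<sigma>)) - Phi (ising_E A \<beta> h F)"

definition log_sobolev_const :: "real^'n^'n \<Rightarrow> real \<Rightarrow> real^'n::finite \<Rightarrow> real" where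
  "log_sobolev_const A \<beta> h =
     Sup {\<gamma>. \<gamma> > 0 \<and> (\<forall>F. (\<forall>\<sigma>. F \<sigma> \<ge> 0) \<longrightarrow>
              entropy A \<beta> h F \<le> 2 / \<gamma> * dirichlet A \<beta> h (\<lambda>\<sigma>. sqrt (F \<sigma>)))}"

definition susceptibility :: "real^'n^'n::finite \<Rightarrow> real \<Rightarrow> real" where
  "susceptibility A s = Max (range (\<lambda>x. \<Sum>y\<in>UNIV. ising_E A s 0 (\<lambda>\<sigma>. \<sigma>$x * \<sigma>$y)))"

end

theory Submission
  imports Defs
begin

text \<open>Let \<open>B = I - A\<close>, a positive semidefinite matrix, and write \<open>\<sigma> \<bullet> B \<sigma>\<close> as a sum of the squares of the linear forms
  \<open>b k \<bullet> \<sigma>\<close>. Since \<open>\<sigma> \<bullet> \<sigma>\<close> is constant on spin configurations, every expectation \<open>u(t, h)\<close> of a fixed function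
  under the measure at inverse temperature \<open>t\<close> and field \<open>h\<close> solves a parabolic equation \<open>\<partial>\<^sub>t u = L u\<close> in the field variable \<open>h\<close>;
  so does the Dirichlet form \<open>D\<close> of the square root of \<open>F\<close>. The entropy solves the same equation with source \<open>2 Q\<close>,
  where \<open>Q = (\<Sum>k. Cov(F, b k \<bullet> \<sigma>)\<^sup>2) / (4 E F)\<close>, and \<open>Q\<close> itself satisfies \<open>\<partial>\<^sub>t Q \<le> L Q + 2 \<chi>\<^sub>t Q\<close>, because the
  Gram matrix of the covariances of the \<open>b k \<bullet> \<sigma>\<close> is bounded by \<open>\<chi>\<^sub>t\<close> uniformly in \<open>h\<close>. At time \<open>0\<close> the measure is a product
  measure, for which \<open>Q \<le> D / 2\<close> and entropy at most \<open>D\<close>. The maximum principle propagates both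
  bounds, first to \<open>Q \<le> exp (2 * \<integral>\<chi>) * D / 2\<close> and then to the entropy.

  The uniform bound on covariances rests on the inequality of Ding, Song and Sun: for ferromagnetic couplings
  \<open>Cov\<^sub>h(\<sigma>\<^sub>x, \<sigma>\<^sub>y)\<close> is at most its value in zero field.\<close>

section \<open>Correlations decrease in a field\<close>

text \<open>The field serves as the space variable because differentiating the weight along
  \<open>b k\<close> inserts the factor \<open>b k \<bullet> \<sigma>\<close>. The maximum principle
  compares functions of the field on the whole space, so the covariance bound has to hold in every
  field and not only in the one of the theorem; this is what makes a correlation inequality
  necessary. The energy is the comparison function because it averages a function of the
  configuration alone and hence has no source. \<open>Q\<close> is the squared gradient, along the
  \<open>b k\<close>, of the square root of \<open>E F\<close>, so at time 0 it can be measured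
  against the differences of \<open>sqrt F\<close>.

  The correlation inequality resists a direct comparison of covariances. It is proved for the cross
  ratio of the four joint weights of two spins, which does not see the fields at these two sites. In
  the coupling of an edge \<open>yu\<close> and the field at \<open>u\<close> its logarithm is a sum
  of logarithms of one-spin partition functions, for which first- and second-order conditions at a
  maximum are explicit.\<close>

text \<open>A configuration is encoded by the set of its plus spins. For \<open>P\<close> disjoint from \<open>U\<close>, \<open>ptn V J h U P\<close> is the
  partition function of the configurations with plus set \<open>P\<close> outside \<open>U\<close>.\<close>

definition spin :: "'a set \<Rightarrow> 'a \<Rightarrow> real" where
  "spin X v = (if v \<in> X then 1 else - 1)"

definition wt :: "'a set \<Rightarrow> ('a \<Rightarrow> 'a \<Rightarrow> real) \<Rightarrow> ('a \<Rightarrow> real) \<Rightarrow> 'a set \<Rightarrow> real" where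
  "wt V J h X = exp ((\<Sum>a\<in>V. \<Sum>b\<in>V. J a b * (spin X a * spin X b)) / 2 + (\<Sum>a\<in>V. h a * spin X a))"

definition ptn :: "'a set \<Rightarrow> ('a \<Rightarrow> 'a \<Rightarrow> real) \<Rightarrow> ('a \<Rightarrow> real) \<Rightarrow> 'a set \<Rightarrow> 'a set \<Rightarrow> real" where
  "ptn V J h U P = (\<Sum>X\<in>Pow U. wt V J h (P \<union> X))"

text \<open>The diagonal is left free: \<open>- t * A\<close> has a negative diagonal when
  \<open>t\<close> is positive, and contracting an edge adds diagonal entries. As spins square to
  one, these only contribute constant factors.\<close>

definition ferro :: "'a set \<Rightarrow> ('a \<Rightarrow> 'a \<Rightarrow> real) \<Rightarrow> bool" where
  "ferro V J \<longleftrightarrow> (\<forall>a\<in>V. \<forall>b\<in>V. J a b = J b a \<and> (a \<noteq> b \<longrightarrow> 0 \<le> J a b))"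

section \<open>The FKG lattice condition\<close>

lemma wt_pos [simp]: "0 < wt V J h X"
  by (simp add: wt_def)

lemma ptn_pos [simp]: "finite U \<Longrightarrow> 0 < ptn V J h U P"
  unfolding ptn_def by (rule sum_pos) auto

lemma sum_Pow_insert:
  fixes f :: "'a set \<Rightarrow> real"
  assumes "finite U" "v \<notin> U"
  shows "(\<Sum>X\<in>Pow (insert v U). f X) = (\<Sum>X\<in>Pow U. f X) + (\<Sum>X\<in>Pow U. f (insert v X))"
proof -
  have "Pow U \<inter> insert v ` Pow U = {}" using assms by auto
  moreover have "inj_on (insert v) (Pow U)"
    using assms by (auto simp: inj_on_def)
  ultimately show ?thesis using assms
    by (simp add: Pow_insert sum.union_disjoint sum.reindex)
qed

lemma ptn_insert:
  assumes "finite U" "v \<notin> U"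
  shows "ptn V J h (insert v U) P = ptn V J h U P + ptn V J h U (insert v P)"
  unfolding ptn_def using sum_Pow_insert[OF assms] by simp

text \<open>The fields contribute equally to both sides, since union and intersection preserve the
  sum of the two spins at each site. For a pair of distinct sites the product of spins is
  supermodular and its coupling is nonnegative; diagonal terms agree.\<close>

lemma wt_supermodular:
  assumes "ferro V J"
  shows "wt V J h P * wt V J h Q \<le> wt V J h (P \<union> Q) * wt V J h (P \<inter> Q)"
proof -
  have 1: "spin (P\<union>Q) a + spin (P\<inter>Q) a = spin P a + spin Q a" for a
    by (auto simp: spin_def)
  have 2: "J a b * (spin P a * spin P b) + J a b * (spin Q a * spin Q b)
     \<le> J a b * (spin (P\<union>Q) a * spin (P\<union>Q) b) + J a b * (spin (P\<inter>Q) a * spin (P\<inter>Q) b)"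
    if "a \<in> V" "b \<in> V" for a b
  proof (cases "a = b")
    case True then show ?thesis by (auto simp: spin_def)
  next
    case False
    then have "0 \<le> J a b" using assms that by (auto simp: ferro_def)
    moreover have "(spin P a * spin P b) + (spin Q a * spin Q b)
      \<le> (spin (P\<union>Q) a * spin (P\<union>Q) b) + (spin (P\<inter>Q) a * spin (P\<inter>Q) b)"
      by (auto simp: spin_def)
    ultimately show ?thesis
      by (metis (no_types, lifting) distrib_left mult_left_mono)
  qed
  have "(\<Sum>a\<in>V. \<Sum>b\<in>V. J a b * (spin P a * spin P b)) + (\<Sum>a\<in>V. \<Sum>b\<in>V. J a b * (spin Q a * spin Q b))
    \<le> (\<Sum>a\<in>V. \<Sum>b\<in>V. J a b * (spin (P\<union>Q) a * spin (P\<union>Q) b))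
       + (\<Sum>a\<in>V. \<Sum>b\<in>V. J a b * (spin (P\<inter>Q) a * spin (P\<inter>Q) b))"
    unfolding sum.distrib[symmetric] by (intro sum_mono 2)
  moreover have "(\<Sum>a\<in>V. h a * spin P a) + (\<Sum>a\<in>V. h a * spin Q a)
     = (\<Sum>a\<in>V. h a * spin (P\<union>Q) a) + (\<Sum>a\<in>V. h a * spin (P\<inter>Q) a)"
    unfolding sum.distrib[symmetric] by (simp add: distrib_left[symmetric] 1)
  ultimately show ?thesis
    unfolding wt_def exp_add[symmetric] by (simp add: field_simps)
qed

text \<open>Expanding \<open>(c - p) * (c - q)\<close> shows that \<open>c * (p + q)\<close> is at
  most \<open>c * c + p * q\<close>. This is the numerical core of the four functions
  theorem.\<close>

lemma four_numbers:
  fixes p q c d :: real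
  assumes "p \<le> c" "q \<le> c" "p * q \<le> c * d" "0 < c"
  shows "p + q \<le> c + d"
proof -
  have "0 \<le> (c - p) * (c - q)" using assms by simp
  then have "c * (p + q) \<le> c * (c + d)" using assms(3) by (simp add: algebra_simps)
  then show ?thesis using assms(4) by simp
qed

text \<open>The lattice condition survives summing out a spin \<open>v\<close>. After splitting on
  \<open>v\<close>, the two products in which \<open>v\<close> has the same sign compare directly.
  The two mixed products are each at most the same product, with \<open>v\<close> in the union only;
  their sum is handled by \<open>four_numbers\<close>.\<close>

lemma ptn_supermodular:
  assumes "ferro V J" "finite U" "P \<inter> U = {}" "Q \<inter> U = {}"
  shows "ptn V J h U P * ptn V J h U Q \<le> ptn V J h U (P \<union> Q) * ptn V J h U (P \<inter> Q)"
  using assms(2-)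
proof (induction U arbitrary: P Q rule: finite_induct)
  case empty
  then show ?case using wt_supermodular[OF assms(1)] by (simp add: ptn_def)
next
  case (insert v U)
  let ?f = "ptn V J h U"
  have disj: "P \<inter> U = {}" "Q \<inter> U = {}" "insert v P \<inter> U = {}" "insert v Q \<inter> U = {}" "v \<notin> P" "v \<notin> Q"
    using insert by auto
  have a: "?f P * ?f Q \<le> ?f (P\<union>Q) * ?f (P\<inter>Q)" using insert.IH disj by simp
  have b: "?f (insert v P) * ?f (insert v Q) \<le> ?f (insert v (P\<union>Q)) * ?f (insert v (P\<inter>Q))"
    using insert.IH[OF disj(3,4)] by (simp add: insert_Diff_if Un_commute)
  have c: "?f (insert v P) * ?f Q \<le> ?f (insert v (P\<union>Q)) * ?f (P\<inter>Q)"
    using insert.IH[OF disj(3,2)] disj by simp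
  have d: "?f P * ?f (insert v Q) \<le> ?f (insert v (P\<union>Q)) * ?f (P\<inter>Q)"
    using insert.IH[OF disj(1,4)] disj by simp
  have pos: "0 < ?f X" for X using insert.hyps by simp
  have "(?f (insert v P) * ?f Q) * (?f P * ?f (insert v Q))
     \<le> (?f (P\<union>Q) * ?f (P\<inter>Q)) * (?f (insert v (P\<union>Q)) * ?f (insert v (P\<inter>Q)))"
    using mult_mono[OF a b] pos by (simp add: mult_ac less_imp_le)
  then have e: "?f (insert v P) * ?f Q + ?f P * ?f (insert v Q)
     \<le> ?f (insert v (P\<union>Q)) * ?f (P\<inter>Q) + ?f (P\<union>Q) * ?f (insert v (P\<inter>Q))"
    by (intro four_numbers[OF c d]) (simp_all add: mult_ac pos)
  show ?case
    unfolding ptn_insert[OF insert.hyps]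
    using a b e by (simp add: algebra_simps)
qed

section \<open>Maxima in one variable and logarithms of one-spin partition functions\<close>

lemma second_derivative_at_max:
  fixes f f' :: "real \<Rightarrow> real"
  assumes d1: "\<And>s. (f has_real_derivative f' s) (at s)"
    and d2: "(f' has_real_derivative c) (at x)"
    and max: "\<And>s. \<bar>s - x\<bar> < e \<Longrightarrow> f s \<le> f x" and "0 < e"
  shows "f' x = 0" "c \<le> 0"
proof -
  show 0: "f' x = 0"
    using DERIV_local_max[OF d1 \<open>0 < e\<close>] max by (simp add: abs_minus_commute)
  show "c \<le> 0"
  proof (rule ccontr)
    assume "\<not> c \<le> 0"
    \<comment> \<open>A positive derivative of \<open>f'\<close> at its zero \<open>x\<close> makes
      \<open>f'\<close> positive just to the right, so \<open>f\<close> would rise above its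
      maximum.\<close>
    then obtain d where d: "d > 0" "\<And>h. h > 0 \<Longrightarrow> h < d \<Longrightarrow> f' x < f' (x + h)"
      using DERIV_pos_inc_right[OF d2] by auto
    define h where "h = min d e / 2"
    have h: "0 < h" "h < d" "h < e" using d(1) \<open>0 < e\<close> by (auto simp: h_def)
    obtain z where z: "x < z" "z < x + h" "f (x + h) - f x = h * f' z"
      using MVT2[of x "x + h" f f'] h d1 by auto
    have "f' z > 0" using d(2)[of "z - x"] z h 0 by auto
    then have "0 < h * f' z" using h by simp
    then show False using max[of "x + h"] z h by simp
  qed
qed

text \<open>The logarithm of the partition function of one spin with weights \<open>a\<close> for
  plus and \<open>b\<close> for minus in the field \<open>x\<close>. Its derivative
  \<open>mtanh\<close> is the mean of that spin, and \<open>1 - mtanh\<^sup>2\<close> is the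
  variance.\<close>

definition lcosh :: "real \<Rightarrow> real \<Rightarrow> real \<Rightarrow> real" where
  "lcosh a b x = ln (a * exp x + b * exp (- x))"

definition mtanh :: "real \<Rightarrow> real \<Rightarrow> real \<Rightarrow> real" where
  "mtanh a b x = (a * exp x - b * exp (- x)) / (a * exp x + b * exp (- x))"

context
  fixes a b :: real
  assumes ab: "0 < a" "0 < b"
begin

lemma lcosh_denom_pos: "0 < a * exp x + b * exp (- x)" for x :: real
  using ab by (simp add: add_pos_pos)

lemma lcosh_deriv: "(lcosh a b has_real_derivative mtanh a b x) (at x)"
  unfolding lcosh_def[abs_def] mtanh_def
  using lcosh_denom_pos[of x] by (auto intro!: derivative_eq_intros simp: field_simps)

lemma mtanh_deriv: "(mtanh a b has_real_derivative 1 - (mtanh a b x)\<^sup>2) (at x)"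
  unfolding mtanh_def[abs_def]
  using lcosh_denom_pos[of x]
  apply (auto intro!: derivative_eq_intros simp: power_divide)
  apply (simp add: divide_simps)
  apply (simp add: power2_eq_square algebra_simps)
  done

lemma exp_lcosh: "exp (lcosh a b x) = a * exp x + b * exp (- x)"
  using lcosh_denom_pos by (simp add: lcosh_def)

lemma lcosh_at_top: "((\<lambda>x. lcosh a b x - x) \<longlongrightarrow> ln a) at_top"
proof -
  have eq: "lcosh a b x - x = ln (a + b * exp (- (2 * x)))" for x
  proof -
    have "a * exp x + b * exp (- x) = exp x * (a + b * exp (- (2*x)))"
      by (simp add: algebra_simps exp_add[symmetric])
    moreover have "0 < a + b * exp (- (2 * x))" using ab by (simp add: add_pos_pos)
    ultimately show ?thesis unfolding lcosh_def by (simp add: ln_mult)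
  qed
  have "((\<lambda>x::real. exp (- (2 * x))) \<longlongrightarrow> 0) at_top"
    by real_asymp
  then have "((\<lambda>x. ln (a + b * exp (- (2 * x)))) \<longlongrightarrow> ln (a + b * 0)) at_top"
    using ab by (intro tendsto_intros) auto
  then show ?thesis by (simp add: eq)
qed

lemma lcosh_at_bot: "((\<lambda>x. lcosh a b x + x) \<longlongrightarrow> ln b) at_bot"
proof -
  have eq: "lcosh a b x + x = ln (b + a * exp (2 * x))" for x
  proof -
    have "a * exp x + b * exp (- x) = exp (- x) * (b + a * exp (2*x))"
      by (simp add: algebra_simps exp_add[symmetric])
    moreover have "0 < b + a * exp (2 * x)" using ab by (simp add: add_pos_pos)
    ultimately show ?thesis unfolding lcosh_def by (simp add: ln_mult)
  qed
  have "((\<lambda>x::real. exp (2 * x)) \<longlongrightarrow> 0) at_bot"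
    by real_asymp
  then have "((\<lambda>x. ln (b + a * exp (2 * x))) \<longlongrightarrow> ln (b + a * 0)) at_bot"
    using ab by (intro tendsto_intros) auto
  then show ?thesis by (simp add: eq)
qed

end

text \<open>The hypothesis says that the first spin is biased towards plus at least as much as the
  second. It then has the larger mean in every field, so the difference of the logarithms increases
  from its limit \<open>ln (b / d)\<close> at minus infinity to its limit \<open>ln (a / c)\<close>
  at plus infinity.\<close>

lemma lcosh_diff_bounds:
  assumes "0 < a" "0 < b" "0 < c" "0 < d" "b * c \<le> a * d"
  shows "lcosh a b x - lcosh c d x \<le> ln (a / c)" "ln (b / d) \<le> lcosh a b x - lcosh c d x"
    "mtanh c d x \<le> mtanh a b x"
proof -
  have *: "0 < a * exp x + b * exp (- x)" "0 < c * exp x + d * exp (- x)"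
    using assms by (simp_all add: add_pos_pos)
  have e: "lcosh a b x - lcosh c d x = ln ((a * exp x + b * exp (- x)) / (c * exp x + d * exp (- x)))"
    unfolding lcosh_def using * by (simp add: ln_div)
  have "b * c * exp (- x) \<le> a * d * exp (- x)" using assms(5) by simp
  then show "lcosh a b x - lcosh c d x \<le> ln (a / c)"
    unfolding e using assms by (subst ln_le_cancel_iff) (auto simp: add_pos_pos divide_simps algebra_simps)
  have "b * c * exp x \<le> a * d * exp x" using assms(5) by simp
  then show "ln (b / d) \<le> lcosh a b x - lcosh c d x"
    unfolding e using assms by (subst ln_le_cancel_iff) (auto simp: add_pos_pos divide_simps algebra_simps)
  have "(c * exp x - d * exp (- x)) * (a * exp x + b * exp (- x)) \<le> (a * exp x - b * exp (- x)) * (c * exp x + d * exp (- x))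
     \<longleftrightarrow> 2 * (b * c) * (exp x * exp (- x)) \<le> 2 * (a * d) * (exp x * exp (- x))"
    by (simp add: algebra_simps)
  then have "(c * exp x - d * exp (- x)) * (a * exp x + b * exp (- x)) \<le> (a * exp x - b * exp (- x)) * (c * exp x + d * exp (- x))"
    using assms(5) by (simp add: exp_add[symmetric])
  then show "mtanh c d x \<le> mtanh a b x"
    unfolding mtanh_def using * by (simp add: divide_simps)
qed

text \<open>The plus weights dominate only in the product, possibly with equality; the positive
  field \<open>x\<close> makes the inequality strict.\<close>

lemma mtanh_sum_pos:
  assumes "0 < a" "0 < b" "0 < c" "0 < d" "b * d \<le> a * c" "0 < x"
  shows "0 < mtanh a b x + mtanh c d x"
proof -
  have *: "0 < a * exp x + b * exp (- x)" "0 < c * exp x + d * exp (- x)"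
    using assms by (simp_all add: add_pos_pos)
  have "b * d * (exp (-x) * exp (- x)) < a * c * (exp x * exp x)"
    unfolding exp_add[symmetric] using assms by (intro mult_le_less_imp_less) auto
  then have "0 < (a * exp x - b * exp (- x)) * (c * exp x + d * exp (- x)) + (c * exp x - d * exp (- x)) * (a * exp x + b * exp (- x))"
    by (simp add: algebra_simps)
  then show ?thesis unfolding mtanh_def using *
    by (simp add: add_frac_eq zero_less_mult_iff zero_less_divide_iff mult.commute)
qed

lemma lcosh_diff_at_top:
  assumes "0 < a" "0 < b" "0 < c" "0 < d"
  shows "((\<lambda>x. lcosh a b x - lcosh c d x) \<longlongrightarrow> ln (a / c)) at_top"
  using tendsto_diff[OF lcosh_at_top[OF assms(1,2)] lcosh_at_top[OF assms(3,4)]] assms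
  by (simp add: ln_div)

lemma lcosh_diff_at_bot:
  assumes "0 < a" "0 < b" "0 < c" "0 < d"
  shows "((\<lambda>x. lcosh a b x - lcosh c d x) \<longlongrightarrow> ln (b / d)) at_bot"
  using tendsto_diff[OF lcosh_at_bot[OF assms(1,2)] lcosh_at_bot[OF assms(3,4)]] assms
  by (simp add: ln_div)

lemma lcosh_continuous:
  assumes "0 < a" "0 < b" shows "continuous_on S (lcosh a b)"
  by (meson DERIV_isCont assms continuous_at_imp_continuous_on lcosh_deriv)

text \<open>The parameters are the weights of the configurations of \<open>(x, y)\<close> (\<open>a\<close>: \<open>++\<close>, \<open>b\<close>: \<open>--\<close>, \<open>c\<close>: \<open>+-\<close>, \<open>d\<close>: \<open>-+\<close>) together with
  the spin \<open>+\<close> (index 1) or \<open>-\<close> (index 2) at a neighbour \<open>u\<close> of \<open>y\<close>, without the edge \<open>yu\<close>; \<open>p\<close> and \<open>n\<close> are their zero-field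
  analogues. Then \<open>excess j s\<close> compares the logarithms of the cross ratios of \<open>(x, y)\<close> with and without field, when
  the edge \<open>yu\<close> has coupling \<open>j\<close> and \<open>u\<close> is in the field \<open>s\<close>.\<close>

locale edge_excess =
  fixes a1 a2 b1 b2 c1 c2 d1 d2 p1 p2 n1 n2 :: real
  assumes pos: "0 < a1" "0 < a2" "0 < b1" "0 < b2" "0 < c1" "0 < c2" "0 < d1" "0 < d2"
      "0 < p1" "0 < p2" "0 < n1" "0 < n2"
    and fkg_ad: "a2 * d1 \<le> a1 * d2" and fkg_bc: "b1 * c2 \<le> b2 * c1"
    and fkg_0: "p2 * n1 \<le> p1 * n2" "p2 * n2 \<le> p1 * n1"
begin

definition excess :: "real \<Rightarrow> real \<Rightarrow> real" where
  "excess j s = (lcosh a1 a2 (s + j) - lcosh d1 d2 (s + j)) + (lcosh b1 b2 (s - j) - lcosh c1 c2 (s - j))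
     - 2 * (lcosh p1 p2 j - lcosh n1 n2 j)"

lemma ad_bounds: "lcosh a1 a2 x - lcosh d1 d2 x \<le> ln (a1 / d1)"
  using lcosh_diff_bounds(1)[of a1 a2 d1 d2] pos fkg_ad by simp

lemma bc_bounds: "lcosh b1 b2 x - lcosh c1 c2 x \<le> ln (b2 / c2)"
proof -
  have "ln (c2 / b2) \<le> lcosh c1 c2 x - lcosh b1 b2 x"
    using lcosh_diff_bounds(2)[of c1 c2 b1 b2] pos fkg_bc by (simp add: mult.commute)
  then show ?thesis using pos by (simp add: ln_div)
qed

lemma zero_mono:
  assumes "0 \<le> x" shows "lcosh p1 p2 0 - lcosh n1 n2 0 \<le> lcosh p1 p2 x - lcosh n1 n2 x"
proof (rule DERIV_nonneg_imp_nondecreasing[OF assms])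
  fix y
  show "\<exists>z. ((\<lambda>y. lcosh p1 p2 y - lcosh n1 n2 y) has_real_derivative z) (at y) \<and> 0 \<le> z"
    using lcosh_diff_bounds(3)[of p1 p2 n1 n2 y] pos fkg_0
    by (intro exI[of _ "mtanh p1 p2 y - mtanh n1 n2 y"] conjI derivative_intros lcosh_deriv) simp_all
qed

lemma excess_continuous: "continuous_on S (\<lambda>(j, s). excess j s)"
proof -
  have *: "continuous_on S (\<lambda>x. lcosh u v (f x))" if "0 < u" "0 < v" "continuous_on S f" for u v and f :: "real \<times> real \<Rightarrow> real"
    using continuous_on_compose2[OF lcosh_continuous[OF that(1,2), of UNIV] that(3)] by auto
  show ?thesis unfolding excess_def case_prod_beta
    by (intro continuous_intros * pos)
qed

text \<open>Outside a box the excess stays below its value \<open>e\<close> at the violation. For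
  large \<open>j\<close> it is controlled by \<open>con\<close>, uniformly in \<open>s\<close>. For
  large \<open>s\<close> of either sign one of the two differences is near its limit, the other is
  below its supremum, and the zero-field part is at least its value at \<open>j = 0\<close>; letting
  \<open>s\<close> tend to infinity in \<open>del\<close> bounds what remains. Finally
  \<open>del\<close> itself excludes a maximum at \<open>j = 0\<close>.\<close>

lemma excess_attains_max:
  assumes del: "\<And>s. excess 0 s \<le> 0"
    and con: "ln (a1 / d1) + ln (b2 / c2) \<le> 2 * ln (p1 / n1)"
    and viol: "0 < excess j1 s1" "0 < j1"
  obtains j s where "0 < j" "0 < excess j s" "\<And>j' s'. 0 \<le> j' \<Longrightarrow> excess j' s' \<le> excess j s"
proof -
  define e where "e = excess j1 s1"
  have e: "0 < e" using viol by (simp add: e_def)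
  have "eventually (\<lambda>j. ln (p1 / n1) - e / 2 < lcosh p1 p2 j - lcosh n1 n2 j) at_top"
    using order_tendstoD(1)[OF lcosh_diff_at_top[of p1 p2 n1 n2]] pos e by simp
  then obtain J0 where J0: "\<And>j. J0 \<le> j \<Longrightarrow> ln (p1 / n1) - e / 2 < lcosh p1 p2 j - lcosh n1 n2 j"
    by (auto simp: eventually_at_top_linorder)
  define J where "J = max (max J0 0) j1"
  have far_j: "excess j s < e" if "J \<le> j" for j s
    using ad_bounds[of "s+j"] bc_bounds[of "s-j"] J0[of j] con that by (simp add: excess_def J_def)
  have bot0: "ln (a1 / d1) + ln (b1 / c1) \<le> 2 * (lcosh p1 p2 0 - lcosh n1 n2 0)"
  proof (rule tendsto_upperbound)
    show "((\<lambda>s. (lcosh a1 a2 s - lcosh d1 d2 s) + (lcosh b1 b2 s - lcosh c1 c2 s)) \<longlongrightarrow> ln (a1 / d1) + ln (b1 / c1)) at_top"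
      by (intro tendsto_add lcosh_diff_at_top pos)
    show "\<forall>\<^sub>F s in at_top. (lcosh a1 a2 s - lcosh d1 d2 s) + (lcosh b1 b2 s - lcosh c1 c2 s) \<le> 2 * (lcosh p1 p2 0 - lcosh n1 n2 0)"
      using del by (intro always_eventually allI) (simp add: excess_def)
  qed simp
  have bot1: "ln (a2 / d2) + ln (b2 / c2) \<le> 2 * (lcosh p1 p2 0 - lcosh n1 n2 0)"
  proof (rule tendsto_upperbound)
    show "((\<lambda>s. (lcosh a1 a2 s - lcosh d1 d2 s) + (lcosh b1 b2 s - lcosh c1 c2 s)) \<longlongrightarrow> ln (a2 / d2) + ln (b2 / c2)) at_bot"
      by (intro tendsto_add lcosh_diff_at_bot pos)
    show "\<forall>\<^sub>F s in at_bot. (lcosh a1 a2 s - lcosh d1 d2 s) + (lcosh b1 b2 s - lcosh c1 c2 s) \<le> 2 * (lcosh p1 p2 0 - lcosh n1 n2 0)"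
      using del by (intro always_eventually allI) (simp add: excess_def)
  qed simp
  have "eventually (\<lambda>x. lcosh b1 b2 x - lcosh c1 c2 x < ln (b1 / c1) + e) at_top"
    using order_tendstoD(2)[OF lcosh_diff_at_top[of b1 b2 c1 c2]] pos e by simp
  then obtain S1 where S1: "\<And>x. S1 \<le> x \<Longrightarrow> lcosh b1 b2 x - lcosh c1 c2 x < ln (b1 / c1) + e"
    by (auto simp: eventually_at_top_linorder)
  have "eventually (\<lambda>x. lcosh a1 a2 x - lcosh d1 d2 x < ln (a2 / d2) + e) at_bot"
    using order_tendstoD(2)[OF lcosh_diff_at_bot[of a1 a2 d1 d2]] pos e by simp
  then obtain S2 where S2: "\<And>x. x \<le> S2 \<Longrightarrow> lcosh a1 a2 x - lcosh d1 d2 x < ln (a2 / d2) + e"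
    by (auto simp: eventually_at_bot_linorder)
  \<comment> \<open>\<open>J\<close> compensates for the shift of \<open>s\<close> by at most
    \<open>J\<close> in the arguments \<open>s + j\<close> and \<open>s - j\<close>;
    \<open>\<bar>s1\<bar>\<close> keeps the violation inside the box.\<close>
  define S where "S = \<bar>S1\<bar> + \<bar>S2\<bar> + J + \<bar>s1\<bar>"
  have far_s: "excess j s < e" if "0 \<le> j" "j \<le> J" "S < \<bar>s\<bar>" for j s
  proof (cases "0 \<le> s")
    case True
    then have "S1 \<le> s - j" using that by (simp add: S_def)
    from S1[OF this] show ?thesis
      using ad_bounds[of "s+j"] bot0 zero_mono[OF that(1)] by (simp add: excess_def)
  next
    case False
    then have "s + j \<le> S2" using that by (simp add: S_def)
    from S2[OF this] show ?thesis
      using bc_bounds[of "s-j"] bot1 zero_mono[OF that(1)] by (simp add: excess_def)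
  qed
  have ne: "(j1, s1) \<in> {0..J} \<times> {-S..S}"
    using viol by (auto simp: J_def S_def)
  have "compact ({0..J} \<times> {-S..S})" by (intro compact_Times) auto
  then obtain q where q: "q \<in> {0..J} \<times> {-S..S}"
     "\<And>r. r \<in> {0..J} \<times> {-S..S} \<Longrightarrow> (\<lambda>(j, s). excess j s) r \<le> (\<lambda>(j, s). excess j s) q"
    using continuous_attains_sup[OF _ _ excess_continuous, of "{0..J} \<times> {-S..S}"] ne by (metis empty_iff)
  obtain j s where js: "q = (j, s)" by force
  have e_le: "e \<le> excess j s" using q(2)[OF ne] by (simp add: js e_def)
  have max: "excess j' s' \<le> excess j s" if "0 \<le> j'" for j' s'
  proof (cases "j' \<le> J \<and> \<bar>s'\<bar> \<le> S")
    case True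
    then have "(j', s') \<in> {0..J} \<times> {-S..S}" using that by (simp add: abs_le_iff)
    from q(2)[OF this] show ?thesis by (simp add: js)
  next
    case False
    then have "J \<le> j' \<or> (j' \<le> J \<and> S < \<bar>s'\<bar>)" by linarith
    then have "excess j' s' < e" using far_j[of j' s'] far_s[of j' s'] that by blast
    then show ?thesis using e_le by linarith
  qed
  have "j \<noteq> 0" using del[of s] e_le e by auto
  then have "0 < j" using q(1) js by auto
  then show thesis using that[of j s] max less_le_trans[OF e e_le] by blast
qed

text \<open>In a two-spin table with aligned entries \<open>u + d\<close>, \<open>u - d\<close> and
  opposite entries \<open>v + d\<close>, \<open>v - d\<close>, the asymmetry \<open>d\<close> can
  only raise the cross ratio when \<open>v \<le> u\<close>. So it is at least
  \<open>(u / v)\<^sup>2\<close>, the square of \<open>(1 + k) / (1 - k)\<close>, and this increases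
  with the correlation \<open>k\<close>.\<close>

lemma correlation_ratio_lower:
  fixes S k d :: real
  assumes "0 \<le> k" "\<bar>d\<bar> < S * (1 - k) / 2" "0 < S" "0 \<le> k0" "k0 < k"
  shows "(S * (1 - k) / 2 - d) * (S * (1 - k) / 2 + d) * (1 + k0)\<^sup>2
       < (S * (1 + k) / 2 + d) * (S * (1 + k) / 2 - d) * (1 - k0)\<^sup>2"
proof -
  define u v where "u = S * (1 + k) / 2" and "v = S * (1 - k) / 2"
  have v: "0 < v" "v \<le> u" "\<bar>d\<bar> < v" using assms by (auto simp: u_def v_def)
  then have "k < 1" using assms(3) by (simp add: v_def zero_less_mult_iff)
  have "v * (1 + k0) < u * (1 - k0)"
    using assms by (simp add: u_def v_def field_simps)
  then have "(v * (1 + k0))\<^sup>2 < (u * (1 - k0))\<^sup>2"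
    using v assms(4) by (intro power_strict_mono) auto
  then have "(v\<^sup>2 - d\<^sup>2) * (v * (1 + k0))\<^sup>2 < (v\<^sup>2 - d\<^sup>2) * (u * (1 - k0))\<^sup>2"
    using v by (intro mult_strict_left_mono) (auto simp: power2_strict_mono abs_less_iff)
  also have "\<dots> \<le> v\<^sup>2 * ((u\<^sup>2 - d\<^sup>2) * (1 - k0)\<^sup>2)"
  proof -
    have "v\<^sup>2 \<le> u\<^sup>2" using v by (intro power_mono) auto
    then have "(v\<^sup>2 - d\<^sup>2) * u\<^sup>2 \<le> v\<^sup>2 * (u\<^sup>2 - d\<^sup>2)" by (simp add: algebra_simps mult_left_mono)
    then have "((v\<^sup>2 - d\<^sup>2) * u\<^sup>2) * (1 - k0)\<^sup>2 \<le> (v\<^sup>2 * (u\<^sup>2 - d\<^sup>2)) * (1 - k0)\<^sup>2"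
      by (rule mult_right_mono) simp
    then show ?thesis by (simp add: power_mult_distrib mult_ac)
  qed
  finally have "v\<^sup>2 * ((v\<^sup>2 - d\<^sup>2) * (1 + k0)\<^sup>2) < v\<^sup>2 * ((u\<^sup>2 - d\<^sup>2) * (1 - k0)\<^sup>2)"
    by (simp add: power_mult_distrib mult_ac)
  then have "(v\<^sup>2 - d\<^sup>2) * (1 + k0)\<^sup>2 < (u\<^sup>2 - d\<^sup>2) * (1 - k0)\<^sup>2"
    using v by simp
  then show ?thesis
    unfolding u_def[symmetric] v_def[symmetric] by (simp add: power2_eq_square algebra_simps)
qed

text \<open>The bounds at \<open>j = 0\<close> (edge deleted) and \<open>j = \<infinity>\<close> (edge contracted) force a positive excess to be attained at an interior
  maximum, whose first- and second-order conditions yield a violation for the pair \<open>(x, u)\<close>.\<close>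

lemma violation_moves_to_neighbour:
  assumes del: "\<And>s. excess 0 s \<le> 0"
    and con: "ln (a1 / d1) + ln (b2 / c2) \<le> 2 * ln (p1 / n1)"
    and viol: "0 < excess j1 s1" "0 < j1"
    and ge1: "\<And>j. 0 \<le> j \<Longrightarrow> n1 * exp j + n2 * exp (- j) \<le> p1 * exp j + p2 * exp (- j)"
  obtains j s t where "0 < j"
    "(a2 * exp (- (s + j) + t) + c2 * exp (- (s - j) - t)) * (d1 * exp (s + j + t) + b1 * exp (s - j - t))
       * (p1 * exp j + n2 * exp (- j))\<^sup>2
     < (a1 * exp (s + j + t) + c1 * exp (s - j - t)) * (b2 * exp (- (s - j) - t) + d2 * exp (- (s + j) + t))
       * (p2 * exp (- j) + n1 * exp j)\<^sup>2"
proof -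
  obtain j s where js: "0 < j" "0 < excess j s" and
    max: "\<And>j' s'. 0 \<le> j' \<Longrightarrow> excess j' s' \<le> excess j s"
    using excess_attains_max[OF del con viol] by metis
  \<comment> \<open>Conditional means of the spin at \<open>u\<close> given \<open>(x, y)\<close>
    equal to \<open>++\<close>, \<open>--\<close>, \<open>+-\<close>, \<open>-+\<close>;
    \<open>A0\<close> and \<open>D0\<close> are the zero-field means given \<open>++\<close> and
    \<open>-+\<close>.\<close>
  define A B C D where "A = mtanh a1 a2 (s + j)" and "B = mtanh b1 b2 (s - j)"
    and "C = mtanh c1 c2 (s - j)" and "D = mtanh d1 d2 (s + j)"
  define A0 D0 where "A0 = mtanh p1 p2 j" and "D0 = mtanh n1 n2 j"
  have ds: "((\<lambda>s. excess j s) has_real_derivative A + B - C - D) (at s)"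
    unfolding excess_def A_def B_def C_def D_def
    by (rule derivative_eq_intros DERIV_chain2[OF lcosh_deriv] pos refl | simp)+
  have "A + B - C - D = 0"
    using DERIV_local_max[OF ds, of 1] max js(1) by (simp add: less_imp_le)
  then have crit: "A + B = C + D" by simp
  define dj where "dj = (\<lambda>j. (mtanh a1 a2 (s + j) - mtanh d1 d2 (s + j)) - (mtanh b1 b2 (s - j) - mtanh c1 c2 (s - j))
     - 2 * (mtanh p1 p2 j - mtanh n1 n2 j))"
  have d1: "((\<lambda>j. excess j s) has_real_derivative dj j) (at j)" for j
    unfolding excess_def dj_def
    by (rule derivative_eq_intros DERIV_chain2[OF lcosh_deriv] pos refl | simp)+
  have d2: "(dj has_real_derivative (((1 - A\<^sup>2) - (1 - D\<^sup>2)) + ((1 - B\<^sup>2) - (1 - C\<^sup>2)) - 2 * ((1 - A0\<^sup>2) - (1 - D0\<^sup>2)))) (at j)"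
    unfolding dj_def A_def B_def C_def D_def A0_def D0_def
    by (rule derivative_eq_intros DERIV_chain2[OF mtanh_deriv] pos refl | simp)+
  have locmax: "excess j' s \<le> excess j s" if "\<bar>j' - j\<bar> < j" for j'
    using max that by simp
  have "dj j = 0" and sec: "((1 - A\<^sup>2) - (1 - D\<^sup>2)) + ((1 - B\<^sup>2) - (1 - C\<^sup>2)) - 2 * ((1 - A0\<^sup>2) - (1 - D0\<^sup>2)) \<le> 0"
    using second_derivative_at_max[OF d1 d2 locmax js(1)] by auto
  \<comment> \<open>These variables factor the second-order condition: with \<open>crit\<close>, the
    sum \<open>A\<^sup>2 - D\<^sup>2 + B\<^sup>2 - C\<^sup>2\<close> is \<open>2 * X * Y\<close>,
    and its zero-field counterpart is \<open>2 * X0 * Y0\<close>. The vanishing derivative in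
    \<open>j\<close> says \<open>X = X0\<close>.\<close>
  define X Y where "X = A - D" and "Y = A - C"
  define X0 Y0 where "X0 = A0 - D0" and "Y0 = A0 + D0"
  have X: "X = X0" using \<open>dj j = 0\<close> crit
    by (simp add: dj_def X_def X0_def A_def B_def C_def D_def A0_def D0_def)
  have BX: "B = C - X" using crit by (simp add: X_def)
  have XY: "X0 * Y0 \<le> X * Y"
    using sec unfolding X0_def Y0_def X_def Y_def BX
    by (simp add: power2_eq_square algebra_simps)
  \<comment> \<open>Otherwise the two zero-field spins have proportional weights, so the zero-field
    term already equals its limit at infinite coupling, and \<open>con\<close> makes the excess
    nonpositive.\<close>
  have X0: "0 < X0"
  proof (rule ccontr)
    assume "\<not> 0 < X0"
    then have "mtanh p1 p2 j \<le> mtanh n1 n2 j" by (simp add: X0_def A0_def D0_def)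
    moreover have "0 < p1 * exp j + p2 * exp (- j)" "0 < n1 * exp j + n2 * exp (- j)"
      using pos by (simp_all add: add_pos_pos)
    ultimately have "(p1 * n2) * (exp j * exp (- j)) \<le> (p2 * n1) * (exp j * exp (- j))"
      by (simp add: mtanh_def divide_simps algebra_simps)
    then have eq: "p1 * n2 = p2 * n1" using fkg_0 by (simp add: exp_add[symmetric])
    have "p1 / n1 = p2 / n2" using eq pos by (simp add: field_simps)
    then have "ln (p1 / n1) \<le> lcosh p1 p2 j - lcosh n1 n2 j"
      using lcosh_diff_bounds(2)[of p1 p2 n1 n2 j] pos fkg_0 by simp
    then have "excess j s \<le> 0"
      using ad_bounds[of "s+j"] bc_bounds[of "s-j"] con by (simp add: excess_def)
    then show False using js by simp
  qed
  have Y: "Y0 \<le> Y" using XY X X0 by simp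
  have Y0: "0 < Y0"
    unfolding Y0_def A0_def D0_def using mtanh_sum_pos[of p1 p2 n1 n2] pos fkg_0 js by simp
  define za zb zc zd where "za = a1 * exp (s + j) + a2 * exp (- (s + j))"
    and "zb = b1 * exp (s - j) + b2 * exp (- (s - j))"
    and "zc = c1 * exp (s - j) + c2 * exp (- (s - j))"
    and "zd = d1 * exp (s + j) + d2 * exp (- (s + j))"
  have z: "0 < za" "0 < zb" "0 < zc" "0 < zd"
    using pos by (simp_all add: za_def zb_def zc_def zd_def add_pos_pos)
  define zp zn where "zp = p1 * exp j + p2 * exp (- j)" and "zn = n1 * exp j + n2 * exp (- j)"
  have zpn: "0 < zn" "zn \<le> zp" using pos ge1[of j] js by (simp_all add: zp_def zn_def add_pos_pos)
  \<comment> \<open>Fields \<open>r\<close> at \<open>x\<close> and \<open>t\<close> at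
    \<open>y\<close> that give \<open>++\<close> and \<open>--\<close> the common weight
    \<open>\<alpha>\<close>, and \<open>+-\<close> and \<open>-+\<close> the common weight
    \<open>\<beta>\<close>, a balance that flip symmetry provides in zero field. In the conclusion
    \<open>r\<close> cancels, because the cross ratio of \<open>(x, u)\<close> ignores the field at
    \<open>x\<close>.\<close>
  define r t where "r = (ln (zb / za) / 2 + ln (zd / zc) / 2) / 2"
    and "t = (ln (zb / za) / 2 - ln (zd / zc) / 2) / 2"
  define \<alpha> \<beta> where "\<alpha> = sqrt (za * zb)" and "\<beta> = sqrt (zc * zd)"
  have ab: "0 < \<alpha>" "0 < \<beta>" using z by (simp_all add: \<alpha>_def \<beta>_def)
  have half: "exp (ln (x / y) / 2) * y = sqrt (x * y)" if "0 < x" "0 < y" for x y :: real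
  proof -
    have "exp (ln (x / y) / 2) = sqrt (x / y)"
      using that by (simp add: ln_sqrt[symmetric])
    also have "\<dots> * y = sqrt (x * y)"
      using that by (simp add: real_sqrt_divide real_sqrt_mult field_simps)
    finally show ?thesis .
  qed
  have rt: "exp (r + t) * za = \<alpha>" "exp (- r - t) * zb = \<alpha>" "exp (r - t) * zc = \<beta>" "exp (- r + t) * zd = \<beta>"
  proof -
    show "exp (r + t) * za = \<alpha>" using half[of zb za] z by (simp add: r_def t_def \<alpha>_def mult.commute field_simps)
    have e1: "- r - t = ln (za / zb) / 2" using z by (simp add: r_def t_def ln_div field_simps)
    show "exp (- r - t) * zb = \<alpha>" unfolding e1 \<alpha>_def by (rule half) (use z in auto)
    show "exp (r - t) * zc = \<beta>" using half[of zd zc] z by (simp add: r_def t_def \<beta>_def mult.commute field_simps)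
    have e2: "- r + t = ln (zc / zd) / 2" using z by (simp add: r_def t_def ln_div field_simps)
    show "exp (- r + t) * zd = \<beta>" unfolding e2 \<beta>_def by (rule half) (use z in auto)
  qed
  have mt: "2 * (a1 * exp (s + j)) = za * (1 + A)" "2 * (a2 * exp (- (s + j))) = za * (1 - A)"
     "2 * (b1 * exp (s - j)) = zb * (1 + B)" "2 * (b2 * exp (- (s - j))) = zb * (1 - B)"
     "2 * (c1 * exp (s - j)) = zc * (1 + C)" "2 * (c2 * exp (- (s - j))) = zc * (1 - C)"
     "2 * (d1 * exp (s + j)) = zd * (1 + D)" "2 * (d2 * exp (- (s + j))) = zd * (1 - D)"
    using z by (simp_all add: A_def B_def C_def D_def za_def zb_def zc_def zd_def mtanh_def field_simps)
  \<comment> \<open>The joint weights of the spins at \<open>(x, u)\<close> with the spin at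
    \<open>y\<close> summed out.\<close>
  define Npp Npm Nmp Nmm where
     "Npp = exp r * (a1 * exp (s + j + t) + c1 * exp (s - j - t))"
     and "Npm = exp r * (a2 * exp (- (s + j) + t) + c2 * exp (- (s - j) - t))"
     and "Nmp = exp (- r) * (d1 * exp (s + j + t) + b1 * exp (s - j - t))"
     and "Nmm = exp (- r) * (b2 * exp (- (s - j) - t) + d2 * exp (- (s + j) + t))"
  have ex: "exp (r + t) = exp r * exp t" "exp (- r - t) = exp (- r) * exp (- t)"
      "exp (r - t) = exp r * exp (- t)" "exp (- r + t) = exp (- r) * exp t"
    by (simp_all add: exp_add[symmetric])
  have N: "2 * Npp = \<alpha> * (1 + A) + \<beta> * (1 + C)" "2 * Npm = \<alpha> * (1 - A) + \<beta> * (1 - C)"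
     "2 * Nmp = \<beta> * (1 + D) + \<alpha> * (1 + B)" "2 * Nmm = \<alpha> * (1 - B) + \<beta> * (1 - D)"
  proof -
    have "2 * Npp = exp (r + t) * (2 * (a1 * exp (s + j))) + exp (r - t) * (2 * (c1 * exp (s - j)))"
      unfolding Npp_def ex by (simp add: exp_add exp_diff exp_minus algebra_simps divide_simps)
    then show "2 * Npp = \<alpha> * (1 + A) + \<beta> * (1 + C)" unfolding mt by (simp add: rt(1,3)[symmetric] mult_ac)
    have "2 * Npm = exp (r + t) * (2 * (a2 * exp (- (s + j)))) + exp (r - t) * (2 * (c2 * exp (- (s - j))))"
      unfolding Npm_def ex by (simp add: exp_add exp_diff exp_minus algebra_simps divide_simps)
    then show "2 * Npm = \<alpha> * (1 - A) + \<beta> * (1 - C)" unfolding mt by (simp add: rt(1,3)[symmetric] mult_ac)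
    have "2 * Nmp = exp (- r + t) * (2 * (d1 * exp (s + j))) + exp (- r - t) * (2 * (b1 * exp (s - j)))"
      unfolding Nmp_def ex by (simp add: exp_add exp_diff exp_minus algebra_simps divide_simps)
    then show "2 * Nmp = \<beta> * (1 + D) + \<alpha> * (1 + B)" unfolding mt by (simp add: rt(4)[symmetric] rt(2)[symmetric] mult_ac)
    have "2 * Nmm = exp (- r - t) * (2 * (b2 * exp (- (s - j)))) + exp (- r + t) * (2 * (d2 * exp (- (s + j))))"
      unfolding Nmm_def ex by (simp add: exp_add exp_diff exp_minus algebra_simps divide_simps)
    then show "2 * Nmm = \<alpha> * (1 - B) + \<beta> * (1 - D)" unfolding mt by (simp add: rt(4)[symmetric] rt(2)[symmetric] mult_ac)
  qed
  \<comment> \<open>\<open>K\<close> is the correlation of \<open>(x, y)\<close> in the balanced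
    measure and \<open>k\<close> that of \<open>(x, u)\<close>. The positive excess says
    \<open>K0 < K\<close>; together with \<open>X = X0\<close>, \<open>Y0 \<le> Y\<close> and
    \<open>0 \<le> K0\<close> this gives \<open>k0 < k\<close>.\<close>
  define S K k where "S = \<alpha> + \<beta>" and "K = (\<alpha> - \<beta>) / (\<alpha> + \<beta>)" and "k = (X + K * Y) / 2"
  define S0 K0 k0 where "S0 = zp + zn" and "K0 = (zp - zn) / (zp + zn)" and "k0 = (X0 + K0 * Y0) / 2"
  have S: "0 < S" "0 < S0" using ab zpn by (auto simp: S_def S0_def)
  have SK: "S * K = \<alpha> - \<beta>" "S0 * K0 = zp - zn" using S by (simp_all add: S_def K_def S0_def K0_def)
  have Sk: "S * k = \<alpha> * (A - B) / 2 + \<beta> * (C - D) / 2"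
  proof -
    have "S * k = (S * X + (S * K) * Y) / 2" by (simp add: k_def algebra_simps)
    also have "\<dots> = \<alpha> * (A - B) / 2 + \<beta> * (C - D) / 2"
      unfolding SK unfolding S_def BX X_def Y_def by (simp add: field_simps)
    finally show ?thesis .
  qed
  have Sk0: "S0 * k0 = zp * A0 - zn * D0"
  proof -
    have "S0 * k0 = (S0 * X0 + (S0 * K0) * Y0) / 2" by (simp add: k0_def algebra_simps)
    also have "\<dots> = zp * A0 - zn * D0"
      unfolding SK unfolding S0_def X0_def Y0_def by (simp add: field_simps)
    finally show ?thesis .
  qed
  have K0: "0 \<le> K0" using zpn by (simp add: K0_def)
  have KK: "K0 < K"
  proof -
    have "2 * (ln zp - ln zn) < (ln za - ln zd) + (ln zb - ln zc)"
      using js(2) by (simp add: excess_def lcosh_def za_def zb_def zc_def zd_def zp_def zn_def)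
    then have "ln (zp\<^sup>2 * (zc * zd)) < ln (zn\<^sup>2 * (za * zb))"
      using z zpn by (simp add: ln_mult ln_realpow)
    then have "zp\<^sup>2 * (zc * zd) < zn\<^sup>2 * (za * zb)"
      using z zpn by (subst (asm) ln_less_cancel_iff) auto
    then have "sqrt (zp\<^sup>2 * (zc * zd)) < sqrt (zn\<^sup>2 * (za * zb))" by simp
    then have "zp * \<beta> < zn * \<alpha>"
      using zpn by (simp add: real_sqrt_mult \<alpha>_def \<beta>_def)
    then show ?thesis using ab zpn by (simp add: K_def K0_def divide_simps) (simp add: algebra_simps)
  qed
  have k: "0 \<le> k0" "k0 < k"
  proof -
    show "0 \<le> k0" using X0 K0 Y0 by (simp add: k0_def)
    have "K0 * Y0 < K * Y0" using KK Y0 by simp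
    also have "\<dots> \<le> K * Y" using Y KK K0 by (intro mult_left_mono) auto
    finally show "k0 < k" by (simp add: k_def k0_def X)
  qed
  define d where "d = (Npp - Nmm) / 2"
  have sums: "Npp + Npm = S" "Nmp + Nmm = S" "Npp + Nmm = S * (1 + k)"
    using N Sk by (simp_all add: S_def field_simps)
  have eqs: "Npp = S * (1 + k) / 2 + d" "Nmm = S * (1 + k) / 2 - d"
     "Npm = S * (1 - k) / 2 - d" "Nmp = S * (1 - k) / 2 + d"
    using sums by (simp_all add: d_def field_simps)
  have Npos: "0 < Npm" "0 < Nmp" unfolding Npm_def Nmp_def using pos by (simp_all add: add_pos_pos)
  have main: "Npm * Nmp * (1 + k0)\<^sup>2 < Npp * Nmm * (1 - k0)\<^sup>2"
    unfolding eqs using Npos[unfolded eqs] k S(1)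
    by (intro correlation_ratio_lower) auto
  have N0: "p1 * exp j + n2 * exp (- j) = S0 / 2 * (1 + k0)" "p2 * exp (- j) + n1 * exp j = S0 / 2 * (1 - k0)"
  proof -
    have m0: "2 * (p1 * exp j) = zp * (1 + A0)" "2 * (p2 * exp (- j)) = zp * (1 - A0)"
        "2 * (n1 * exp j) = zn * (1 + D0)" "2 * (n2 * exp (- j)) = zn * (1 - D0)"
      using zpn by (simp_all add: A0_def D0_def zp_def zn_def mtanh_def field_simps)
    show "p1 * exp j + n2 * exp (- j) = S0 / 2 * (1 + k0)"
      using m0 Sk0 by (simp add: S0_def algebra_simps)
    show "p2 * exp (- j) + n1 * exp j = S0 / 2 * (1 - k0)"
      using m0 Sk0 by (simp add: S0_def algebra_simps)
  qed
  have main2: "Npm * Nmp * (p1 * exp j + n2 * exp (- j))\<^sup>2 < Npp * Nmm * (p2 * exp (- j) + n1 * exp j)\<^sup>2"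
    unfolding N0 power_mult_distrib using mult_strict_left_mono[OF main, of "(S0/2)\<^sup>2"] S
    by (simp add: mult_ac)
  have "exp r * exp (- r) = 1" by (simp add: exp_add[symmetric])
  then have cancel: "exp r * x * (exp (- r) * y) = x * y" for x y
    by (metis mult.assoc mult.left_commute mult_1)
  show thesis
    by (rule that[OF js(1), of s t]) (use main2 in \<open>simp only: Npp_def Npm_def Nmp_def Nmm_def cancel\<close>)
qed

end

text \<open>The odds ratio of the spins at \<open>x\<close> and \<open>y\<close>: it is 1 when they
  are independent and larger when they are positively correlated.\<close>

definition cross_ratio :: "'a set \<Rightarrow> ('a \<Rightarrow> 'a \<Rightarrow> real) \<Rightarrow> ('a \<Rightarrow> real) \<Rightarrow> 'a \<Rightarrow> 'a \<Rightarrow> real" where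
  "cross_ratio V J h x y = (let Z = ptn V J h (V - {x, y}) in (Z {x, y} * Z {}) / (Z {x} * Z {y}))"

definition edges :: "'a set \<Rightarrow> ('a \<Rightarrow> 'a \<Rightarrow> real) \<Rightarrow> ('a \<times> 'a) set" where
  "edges V J = {(a, b) \<in> V \<times> V. a \<noteq> b \<and> J a b \<noteq> 0}"

definition set_coupling :: "('a \<Rightarrow> 'a \<Rightarrow> real) \<Rightarrow> 'a \<Rightarrow> 'a \<Rightarrow> real \<Rightarrow> 'a \<Rightarrow> 'a \<Rightarrow> real" where
  "set_coupling J y u j a b = (if a = y \<and> b = u \<or> a = u \<and> b = y then j else J a b)"

definition contract :: "('a \<Rightarrow> 'a \<Rightarrow> real) \<Rightarrow> 'a \<Rightarrow> 'a \<Rightarrow> 'a \<Rightarrow> 'a \<Rightarrow> real" where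
  "contract J y u a b = J a b + (if a = y then J u b else 0) + (if b = y then J a u else 0)"

section \<open>Weights under changes of field and coupling, global flip and contraction\<close>

lemma wt_cong: "(\<And>a. a \<in> V \<Longrightarrow> a \<in> X \<longleftrightarrow> a \<in> Y) \<Longrightarrow> (\<And>a. a \<in> V \<Longrightarrow> h a = h' a) \<Longrightarrow>
   wt V J h X = wt V J h' Y"
  unfolding wt_def spin_def by (auto intro!: arg_cong2[where f="(+)"] arg_cong2[where f="(/)"] sum.cong)

lemma wt_field:
  assumes "finite V" "v \<in> V"
  shows "wt V J (h(v := s)) X = wt V J (h(v := 0)) X * exp (s * spin X v)"
proof -
  have "(\<Sum>a\<in>V. (h(v := s)) a * spin X a) = (\<Sum>a\<in>V. (h(v := 0)) a * spin X a + (if a = v then s * spin X v else 0))"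
    by (intro sum.cong) auto
  also have "\<dots> = (\<Sum>a\<in>V. (h(v := 0)) a * spin X a) + s * spin X v"
    using assms by (simp add: sum.distrib)
  finally show ?thesis unfolding wt_def by (simp add: exp_add[symmetric])
qed

lemma sum_sum_delta:
  fixes f :: "'a \<Rightarrow> real"
  assumes "finite V" "y \<in> V"
  shows "(\<Sum>a\<in>V. \<Sum>b\<in>V. if a = y then f b else 0) = (\<Sum>b\<in>V. f b)"
proof -
  have "(\<Sum>b\<in>V. if a = y then f b else 0) = (if a = y then (\<Sum>b\<in>V. f b) else 0)" for a by simp
  then show ?thesis using assms by simp
qed

lemma wt_set_coupling:
  assumes "finite V" "y \<in> V" "u \<in> V" "y \<noteq> u"
  shows "wt V (set_coupling J y u j) h X = wt V (set_coupling J y u 0) h X * exp (j * (spin X y * spin X u))"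
proof -
  have "(\<Sum>a\<in>V. \<Sum>b\<in>V. set_coupling J y u j a b * (spin X a * spin X b))
     = (\<Sum>a\<in>V. \<Sum>b\<in>V. set_coupling J y u 0 a b * (spin X a * spin X b)
         + (if a = y then (if b = u then j * (spin X y * spin X u) else 0) else 0)
         + (if a = u then (if b = y then j * (spin X y * spin X u) else 0) else 0))"
    using assms(4) by (intro sum.cong) (auto simp: set_coupling_def)
  also have "\<dots> = (\<Sum>a\<in>V. \<Sum>b\<in>V. set_coupling J y u 0 a b * (spin X a * spin X b)) + 2 * (j * (spin X y * spin X u))"
    using assms by (simp add: sum.distrib sum_sum_delta)
  finally show ?thesis unfolding wt_def by (simp add: exp_add[symmetric] add_divide_distrib)
qed

lemma wt_flip:
  "wt V J (\<lambda>_. 0) X = wt V J (\<lambda>_. 0) (V - X)"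
proof -
  have "spin (V - X) a = - spin X a" if "a \<in> V" for a using that by (simp add: spin_def)
  then show ?thesis unfolding wt_def by simp
qed

lemma ptn_flip:
  assumes "U \<inter> P = {}"
  shows "ptn V J (\<lambda>_. 0) U P = ptn V J (\<lambda>_. 0) U (V - U - P)"
proof -
  have "(\<Sum>X\<in>Pow U. wt V J (\<lambda>_. 0) (P \<union> X)) = (\<Sum>X\<in>Pow U. wt V J (\<lambda>_. 0) (P \<union> (U - X)))"
    by (rule sum.reindex_bij_witness[of _ "\<lambda>X. U - X" "\<lambda>X. U - X"]) (auto simp: double_diff)
  also have "\<dots> = (\<Sum>X\<in>Pow U. wt V J (\<lambda>_. 0) (V - U - P \<union> X))"
  proof (intro sum.cong refl)
    fix X assume "X \<in> Pow U"
    then show "wt V J (\<lambda>_. 0) (P \<union> (U - X)) = wt V J (\<lambda>_. 0) (V - U - P \<union> X)"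
      using assms by (subst wt_flip) (intro wt_cong, auto)
  qed
  finally show ?thesis by (simp add: ptn_def)
qed

lemma wt_contract:
  assumes "finite V" "y \<in> V" "u \<in> V" "y \<noteq> u" "h u = 0" "u \<in> X \<longleftrightarrow> y \<in> X"
  shows "wt V J h X = exp (J u u / 2) * wt (V - {u}) (contract J y u) h X"
proof -
  let ?s = "spin X" and ?W = "V - {u}"
  have s: "?s u = ?s y" using assms by (simp add: spin_def)
  have ss: "?s y * ?s y = 1" by (simp add: spin_def)
  have V: "finite ?W" "y \<in> ?W" using assms by auto
  have rem: "(\<Sum>a\<in>V. g a) = g u + (\<Sum>a\<in>?W. g a)" for g :: "'a \<Rightarrow> real"
    using assms by (intro sum.remove)
  have "(\<Sum>a\<in>V. \<Sum>b\<in>V. J a b * (?s a * ?s b))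
      = J u u * (?s u * ?s u) + (\<Sum>b\<in>?W. J u b * (?s u * ?s b)) + ((\<Sum>a\<in>?W. J a u * (?s a * ?s u)) + (\<Sum>a\<in>?W. \<Sum>b\<in>?W. J a b * (?s a * ?s b)))"
    by (simp add: rem sum.distrib)
  also have "\<dots> = J u u + (\<Sum>a\<in>?W. \<Sum>b\<in>?W. contract J y u a b * (?s a * ?s b))"
  proof -
    have c1: "(\<Sum>a\<in>?W. \<Sum>b\<in>?W. if a = y then J u b * (?s y * ?s b) else 0) = (\<Sum>b\<in>?W. J u b * (?s y * ?s b))"
      using V by (rule sum_sum_delta)
    have "(\<Sum>a\<in>?W. \<Sum>b\<in>?W. contract J y u a b * (?s a * ?s b))
       = (\<Sum>a\<in>?W. \<Sum>b\<in>?W. J a b * (?s a * ?s b) + (if a = y then J u b * (?s y * ?s b) else 0) + (if b = y then J a u * (?s a * ?s y) else 0))"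
      by (intro sum.cong) (auto simp: contract_def algebra_simps)
    also have "\<dots> = (\<Sum>a\<in>?W. \<Sum>b\<in>?W. J a b * (?s a * ?s b)) + (\<Sum>b\<in>?W. J u b * (?s y * ?s b)) + (\<Sum>a\<in>?W. J a u * (?s a * ?s y))"
      using V by (simp add: sum.distrib c1)
    finally show ?thesis using ss by (simp add: s)
  qed
  finally have e: "(\<Sum>a\<in>V. \<Sum>b\<in>V. J a b * (?s a * ?s b)) = J u u + (\<Sum>a\<in>?W. \<Sum>b\<in>?W. contract J y u a b * (?s a * ?s b))" .
  have f: "(\<Sum>a\<in>V. h a * ?s a) = (\<Sum>a\<in>?W. h a * ?s a)"
    using assms(5) by (simp add: rem)
  show ?thesis unfolding wt_def e f exp_add[symmetric] by (simp add: add_divide_distrib)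
qed

lemma ferro_set_coupling: "ferro V J \<Longrightarrow> 0 \<le> j \<Longrightarrow> ferro V (set_coupling J y u j)"
  unfolding ferro_def set_coupling_def by auto

lemma ferro_contract: "ferro V J \<Longrightarrow> u \<in> V \<Longrightarrow> ferro (V - {u}) (contract J y u)"
  unfolding ferro_def contract_def by (auto simp: add_nonneg_nonneg)

lemma set_coupling_same: "ferro V J \<Longrightarrow> y \<in> V \<Longrightarrow> u \<in> V \<Longrightarrow> set_coupling J y u (J y u) = J"
  by (auto simp: set_coupling_def fun_eq_iff ferro_def)

lemma sum_Pow_Un:
  fixes f :: "'a set \<Rightarrow> real"
  assumes "finite A" "finite B" "A \<inter> B = {}"
  shows "(\<Sum>Z\<in>Pow (A \<union> B). f Z) = (\<Sum>X\<in>Pow A. \<Sum>Y\<in>Pow B. f (X \<union> Y))"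
  using assms
proof (induction A arbitrary: f rule: finite_induct)
  case (insert v A)
  have "(\<Sum>Z\<in>Pow (insert v A \<union> B). f Z) = (\<Sum>Z\<in>Pow (A \<union> B). f Z) + (\<Sum>Z\<in>Pow (A \<union> B). f (insert v Z))"
    using insert by (simp add: sum_Pow_insert)
  also have "\<dots> = (\<Sum>X\<in>Pow (insert v A). \<Sum>Y\<in>Pow B. f (X \<union> Y))"
    using insert by (simp add: sum_Pow_insert)
  finally show ?case .
qed simp

text \<open>Each partition function splits into a factor depending on the spin at \<open>y\<close>
  and one depending on the spin at \<open>x\<close>. Every such factor occurs once above and once
  below.\<close>

lemma cross_ratio_decoupled:
  assumes "finite V" "W \<subseteq> V" "y \<in> W" "x \<in> V - W"
    and no: "\<And>a b. a \<in> W \<Longrightarrow> b \<in> V - W \<Longrightarrow> J a b = 0 \<and> J b a = 0"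
  shows "cross_ratio V J h x y = 1"
proof -
  let ?R = "V - W"
  have fin: "finite W" "finite ?R" using assms finite_subset by auto
  have split: "(\<Sum>a\<in>V. g a) = (\<Sum>a\<in>W. g a) + (\<Sum>a\<in>?R. g a)" for g :: "'a \<Rightarrow> real"
    using sum.subset_diff[OF assms(2,1)] by (simp add: add.commute)
  have wt: "wt V J h X = wt W J h X * wt ?R J h X" for X
  proof -
    have 2: "(\<Sum>a\<in>W. \<Sum>b\<in>?R. J a b * (spin X a * spin X b)) = 0"
      using no by (intro sum.neutral ballI) simp
    have 3: "(\<Sum>a\<in>?R. \<Sum>b\<in>W. J a b * (spin X a * spin X b)) = 0"
      using no by (intro sum.neutral ballI) simp
    show ?thesis unfolding wt_def exp_add[symmetric] split sum.distrib 2 3 by (simp add: add_divide_distrib)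
  qed
  have U: "V - {x, y} = (W - {y}) \<union> (?R - {x})" using assms by auto
  have p: "ptn V J h (V - {x, y}) P = ptn W J h (W - {y}) (P \<inter> {y}) * ptn ?R J h (?R - {x}) (P \<inter> {x})" if "P \<subseteq> {x, y}" for P
  proof -
    have "ptn V J h (V - {x, y}) P = (\<Sum>X\<in>Pow (W - {y}). \<Sum>Y\<in>Pow (?R - {x}). wt W J h (P \<union> (X \<union> Y)) * wt ?R J h (P \<union> (X \<union> Y)))"
      unfolding ptn_def U wt using fin by (subst sum_Pow_Un) auto
    also have "\<dots> = (\<Sum>X\<in>Pow (W - {y}). \<Sum>Y\<in>Pow (?R - {x}). wt W J h (P \<inter> {y} \<union> X) * wt ?R J h (P \<inter> {x} \<union> Y))"
      using that assms by (intro sum.cong refl arg_cong2[where f="(*)"] wt_cong) auto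
    finally show ?thesis by (simp add: ptn_def sum_product)
  qed
  have "x \<noteq> y" using assms by auto
  have "0 < ptn W J h (W - {y}) P" "0 < ptn ?R J h (?R - {x}) P" for P using fin by simp_all
  then have "ptn W J h (W - {y}) P \<noteq> 0" "ptn ?R J h (?R - {x}) P \<noteq> 0" for P by (metis less_irrefl)+
  then show ?thesis unfolding cross_ratio_def Let_def using \<open>x \<noteq> y\<close>
    by (simp add: p)
qed

text \<open>The inequality of Ding, Song and Sun in terms of cross ratios. The covariance bound is
  recovered from it through \<open>covariance_le_ratio\<close>.\<close>

definition field_decreases :: "'a set \<Rightarrow> ('a \<Rightarrow> 'a \<Rightarrow> real) \<Rightarrow> bool" where
  "field_decreases V J \<longleftrightarrow>
     (\<forall>x\<in>V. \<forall>y\<in>V. \<forall>h. x \<noteq> y \<longrightarrow> cross_ratio V J h x y \<le> cross_ratio V J (\<lambda>_. 0) x y)"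

lemma ptn_fields:
  assumes "finite V" "y \<in> V" "u \<in> V" "y \<noteq> u" "y \<notin> U" "u \<notin> U"
  shows "ptn V (set_coupling J y u j) (h(u := s, y := t)) U P
    = ptn V (set_coupling J y u 0) (h(u := 0, y := 0)) U P
       * exp (j * (spin P y * spin P u) + s * spin P u + t * spin P y)"
  unfolding ptn_def sum_distrib_right
proof (rule sum.cong[OF refl])
  fix X assume "X \<in> Pow U"
  then have sp: "spin (P \<union> X) y = spin P y" "spin (P \<union> X) u = spin P u"
    using assms by (auto simp: spin_def)
  let ?J = "set_coupling J y u 0" and ?X = "P \<union> X"
  have "wt V (set_coupling J y u j) (h(u := s, y := t)) ?X
      = wt V ?J (h(u := s, y := t)) ?X * exp (j * (spin P y * spin P u))"
    using wt_set_coupling[OF assms(1-4), of J j "h(u := s, y := t)" ?X] by (simp add: sp)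
  also have "wt V ?J (h(u := s, y := t)) ?X = wt V ?J (h(u := s, y := 0)) ?X * exp (t * spin P y)"
    using wt_field[OF assms(1,2), of ?J "h(u := s)" t ?X] by (simp add: sp)
  also have "h(u := s, y := 0) = (h(y := 0))(u := s)" using assms(4) by auto
  also have "wt V ?J ((h(y := 0))(u := s)) ?X = wt V ?J ((h(y := 0))(u := 0)) ?X * exp (s * spin P u)"
    using wt_field[OF assms(1,3), of ?J "h(y := 0)" s ?X] by (simp add: sp)
  also have "(h(y := 0))(u := 0) = h(u := 0, y := 0)" using assms(4) by auto
  finally show "wt V (set_coupling J y u j) (h(u := s, y := t)) ?X
     = wt V ?J (h(u := 0, y := 0)) ?X * exp (j * (spin P y * spin P u) + s * spin P u + t * spin P y)"
    by (simp only: exp_add mult_ac)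
qed

text \<open>Each sign of the spin at \<open>y\<close> occurs once in the numerator and once in the
  denominator, so the factors from its field cancel.\<close>

lemma cross_ratio_field_right:
  assumes "finite V" "y \<in> V" "x \<noteq> y"
  shows "cross_ratio V J (h(y := t)) x y = cross_ratio V J h x y"
proof -
  have *: "ptn V J (h'(y := t)) (V - {x, y}) P = ptn V J (h'(y := 0)) (V - {x, y}) P * exp (t * spin P y)" for h' t P
    unfolding ptn_def sum_distrib_right
    by (rule sum.cong[OF refl]) (subst wt_field[OF assms(1,2)], auto simp: spin_def)
  have "cross_ratio V J (h'(y := t)) x y = cross_ratio V J (h'(y := 0)) x y" for h' t
    unfolding cross_ratio_def Let_def *[of h' t] using assms(3)
    by (simp add: spin_def exp_minus divide_simps)
  from this[of h t] this[of h "h y"] show ?thesis by simp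
qed

lemma cross_ratio_zero_diagonal:
  assumes "finite V" "x \<in> V" "y \<in> V" "x \<noteq> y"
  shows "ptn V J (\<lambda>_. 0) (V - {x, y}) {} = ptn V J (\<lambda>_. 0) (V - {x, y}) {x, y}"
    "ptn V J (\<lambda>_. 0) (V - {x, y}) {x} = ptn V J (\<lambda>_. 0) (V - {x, y}) {y}"
proof -
  have "V - (V - {x, y}) - {} = {x, y}" "V - (V - {x, y}) - {x} = {y}" using assms by auto
  then show "ptn V J (\<lambda>_. 0) (V - {x, y}) {} = ptn V J (\<lambda>_. 0) (V - {x, y}) {x, y}"
    "ptn V J (\<lambda>_. 0) (V - {x, y}) {x} = ptn V J (\<lambda>_. 0) (V - {x, y}) {y}"
    using ptn_flip[of "V - {x, y}" "{}" V J] ptn_flip[of "V - {x, y}" "{x}" V J] by simp_all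
qed

lemma frac_less_frac:
  fixes a b c d :: real
  assumes "0 < b" "0 < d" "d * a < c * b"
  shows "a / b < c / d"
  using assms by (simp add: divide_simps mult.commute)

text \<open>Summing out all sites but \<open>x\<close>, \<open>y\<close>, \<open>u\<close> leaves
  eight weights \<open>z\<close> and their zero-field analogues \<open>w\<close>, the latter halved
  in number by flip symmetry; these are the parameters of \<open>edge_excess\<close>. Deleting the
  edge is the case \<open>j = 0\<close>, and contracting it is the limit of infinite
  \<open>j\<close>. The new violation comes with an altered coupling on the edge \<open>yu\<close>,
  which is why \<open>j\<close> is part of the conclusion.\<close>

lemma edge_step:
  assumes fin: "finite V" and fer: "ferro V J" and xyu: "x \<in> V" "y \<in> V" "u \<in> V" "x \<noteq> y" "y \<noteq> u" "x \<noteq> u"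
    and Jyu: "0 < J y u"
    and del: "field_decreases V (set_coupling J y u 0)"
    and con: "field_decreases (V - {u}) (contract (set_coupling J y u 0) y u)"
    and viol: "cross_ratio V J (\<lambda>_. 0) x y < cross_ratio V J h x y"
  obtains j h' where "0 < j" "cross_ratio V (set_coupling J y u j) (\<lambda>_. 0) x u < cross_ratio V (set_coupling J y u j) h' x u"
proof -
  define U where "U = V - {x, y, u}"
  define J0 where "J0 = set_coupling J y u 0"
  define h0 where "h0 = h(u := 0, y := 0)"
  define z where "z = ptn V J0 h0 U"
  define w where "w = ptn V J0 (\<lambda>_. 0) U"
  have U: "finite U" "x \<notin> U" "y \<notin> U" "u \<notin> U" using fin by (auto simp: U_def)
  have VU: "V - {x, y} = insert u U" "V - {x, u} = insert y U" using xyu by (auto simp: U_def)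
  have ferJ: "ferro V (set_coupling J y u j)" if "0 \<le> j" for j using ferro_set_coupling[OF fer that] .
  have fer0: "ferro V J0" using ferJ[of 0] by (simp add: J0_def)
  have zf: "ptn V (set_coupling J y u j) (h(u := s, y := t)) U P
     = z P * exp (j * (spin P y * spin P u) + s * spin P u + t * spin P y)" for j s t P
    unfolding z_def J0_def h0_def by (rule ptn_fields) (use fin xyu U in auto)
  have wf: "ptn V (set_coupling J y u j) (\<lambda>_. 0) U P = w P * exp (j * (spin P y * spin P u))" for j P
    using ptn_fields[of V y u U J j "\<lambda>_. 0" 0 0 P] fin xyu U
    by (simp add: w_def J0_def fun_upd_idem)
  have zw_pos: "0 < z P" "0 < w P" for P unfolding z_def w_def using U by simp_all
  have ne: "z P \<noteq> 0" "w P \<noteq> 0" for P using zw_pos[of P] by simp_all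
  have wflip: "w {} = w {x, y, u}" "w {u} = w {x, y}" "w {x} = w {y, u}" "w {x, u} = w {y}"
  proof -
    have "V - U - {} = {x, y, u}" "V - U - {u} = {x, y}" "V - U - {x} = {y, u}" "V - U - {x, u} = {y}"
      using xyu by (auto simp: U_def)
    then show "w {} = w {x, y, u}" "w {u} = w {x, y}" "w {x} = w {y, u}" "w {x, u} = w {y}"
      unfolding w_def using ptn_flip[of U "{}" V J0] ptn_flip[of U "{u}" V J0] ptn_flip[of U "{x}" V J0] ptn_flip[of U "{x, u}" V J0] U
      by simp_all
  qed
  have zs: "z P * z Q \<le> z (P \<union> Q) * z (P \<inter> Q)" if "P \<inter> U = {}" "Q \<inter> U = {}" for P Q
    unfolding z_def by (rule ptn_supermodular[OF fer0 U(1) that])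
  have ws: "w P * w Q \<le> w (P \<union> Q) * w (P \<inter> Q)" if "P \<inter> U = {}" "Q \<inter> U = {}" for P Q
    unfolding w_def by (rule ptn_supermodular[OF fer0 U(1) that])
  have sets: "{x, y} \<union> {y, u} = {x, y, u}" "{x, y} \<inter> {y, u} = {y}" "{u} \<union> {x} = {x, u}" "{u} \<inter> {x} = {}"
    "{x, y} \<union> {x, u} = {x, y, u}" "{x, y} \<inter> {x, u} = {x}"
    using xyu by auto
  interpret edge_excess "z {x, y, u}" "z {x, y}" "z {u}" "z {}" "z {x, u}" "z {x}" "z {y, u}" "z {y}"
    "w {x, y, u}" "w {x, y}" "w {y, u}" "w {y}"
  proof
    show "z {x, y} * z {y, u} \<le> z {x, y, u} * z {y}" using zs[of "{x, y}" "{y, u}"] U sets by simp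
    show "z {u} * z {x} \<le> z {} * z {x, u}" using zs[of "{u}" "{x}"] U sets by (simp add: mult.commute)
    show "w {x, y} * w {y, u} \<le> w {x, y, u} * w {y}" using ws[of "{x, y}" "{y, u}"] U sets by simp
    show "w {x, y} * w {y} \<le> w {x, y, u} * w {y, u}"
      using ws[of "{x, y}" "{x, u}"] U unfolding sets by (simp add: wflip)
  qed (simp_all add: zw_pos)
  have elz: "exp (lcosh (z P) (z Q) r) = z P * exp r + z Q * exp (- r)" for P Q r
    by (rule exp_lcosh) (simp_all add: zw_pos)
  have elw: "exp (lcosh (w P) (w Q) r) = w P * exp r + w Q * exp (- r)" for P Q r
    by (rule exp_lcosh) (simp_all add: zw_pos)
  have Zxy: "ptn V (set_coupling J y u j) (h(u := s, y := 0)) (V - {x, y}) {x, y} = exp (lcosh (z {x, y, u}) (z {x, y}) (s + j))"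
    "ptn V (set_coupling J y u j) (h(u := s, y := 0)) (V - {x, y}) {} = exp (lcosh (z {u}) (z {}) (s - j))"
    "ptn V (set_coupling J y u j) (h(u := s, y := 0)) (V - {x, y}) {x} = exp (lcosh (z {x, u}) (z {x}) (s - j))"
    "ptn V (set_coupling J y u j) (h(u := s, y := 0)) (V - {x, y}) {y} = exp (lcosh (z {y, u}) (z {y}) (s + j))" for j s
    unfolding VU elz ptn_insert[OF U(1) U(4)] zf
    using xyu by (simp_all add: spin_def insert_commute algebra_simps)
  have Wxy: "ptn V (set_coupling J y u j) (\<lambda>_. 0) (V - {x, y}) {x, y} = exp (lcosh (w {x, y, u}) (w {x, y}) j)"
    "ptn V (set_coupling J y u j) (\<lambda>_. 0) (V - {x, y}) {y} = exp (lcosh (w {y, u}) (w {y}) j)" for j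
    unfolding VU elw ptn_insert[OF U(1) U(4)] wf
    using xyu by (simp_all add: spin_def insert_commute algebra_simps)
  have cr0: "cross_ratio V (set_coupling J y u j) (\<lambda>_. 0) x y
      = exp (2 * (lcosh (w {x, y, u}) (w {x, y}) j - lcosh (w {y, u}) (w {y}) j))" for j
    unfolding cross_ratio_def Let_def cross_ratio_zero_diagonal[OF fin xyu(1,2,4)] Wxy
    by (simp add: exp_add[symmetric] exp_diff[symmetric])
  have crh: "cross_ratio V (set_coupling J y u j) (h(u := s)) x y
      = exp (excess j s) * cross_ratio V (set_coupling J y u j) (\<lambda>_. 0) x y" for j s
  proof -
    have "cross_ratio V (set_coupling J y u j) (h(u := s)) x y = cross_ratio V (set_coupling J y u j) (h(u := s, y := 0)) x y"
      using cross_ratio_field_right[OF fin xyu(2) xyu(4)] by metis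
    also have "\<dots> = exp (excess j s) * cross_ratio V (set_coupling J y u j) (\<lambda>_. 0) x y"
      unfolding cr0 unfolding cross_ratio_def Let_def Zxy excess_def exp_add[symmetric] exp_diff[symmetric]
      by (simp add: algebra_simps)
    finally show ?thesis .
  qed
  have cr0pos: "0 < cross_ratio V (set_coupling J y u j) (\<lambda>_. 0) x y" for j by (simp add: cr0)
  have 1: "excess 0 s \<le> 0" for s
    using del crh[of 0 s] cr0pos[of 0] xyu unfolding field_decreases_def
    by (metis exp_le_one_iff mult_le_cancel_right2 not_le)
  have Jsym: "J u y = J y u" using fer xyu by (auto simp: ferro_def)
  have J: "set_coupling J y u (J y u) = J" by (rule set_coupling_same[OF fer xyu(2,3)])
  have "h(u := h u) = h" by simp
  then have 3: "0 < excess (J y u) (h u)"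
    using viol crh[of "J y u" "h u"] cr0pos[of "J y u"] unfolding J by auto
  \<comment> \<open>In zero field ferromagnetic spins at \<open>x\<close> and \<open>y\<close>
    prefer to agree: the lattice condition for \<open>{x}\<close> and \<open>{y}\<close> bounds a
    square by a square, because flip symmetry identifies the weights in pairs.\<close>
  have 4: "w {y, u} * exp j + w {y} * exp (- j) \<le> w {x, y, u} * exp j + w {x, y} * exp (- j)" if "0 \<le> j" for j
  proof -
    let ?Z = "ptn V (set_coupling J y u j) (\<lambda>_. 0) (V - {x, y})"
    have "?Z {x} * ?Z {y} \<le> ?Z ({x} \<union> {y}) * ?Z ({x} \<inter> {y})"
      by (rule ptn_supermodular[OF ferJ[OF that]]) (use fin in auto)
    moreover have "{x} \<union> {y} = {x, y}" "{x} \<inter> {y} = {}" using xyu by auto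
    ultimately have "?Z {y} * ?Z {y} \<le> ?Z {x, y} * ?Z {x, y}"
      by (simp add: cross_ratio_zero_diagonal[OF fin xyu(1,2,4)])
    then have "(?Z {y})\<^sup>2 \<le> (?Z {x, y})\<^sup>2" by (simp only: power2_eq_square)
    moreover have "0 \<le> ?Z {x, y}" using fin by (intro less_imp_le ptn_pos) simp
    ultimately have "?Z {y} \<le> ?Z {x, y}" by (rule power2_le_imp_le)
    then show ?thesis unfolding Wxy elw .
  qed
  have 2: "ln (z {x, y, u} / z {y, u}) + ln (z {} / z {x}) \<le> 2 * ln (w {x, y, u} / w {y, u})"
  proof -
    let ?V = "V - {u}" and ?C = "contract (set_coupling J y u 0) y u"
    have Vu: "?V - {x, y} = U" using xyu by (auto simp: U_def)
    \<comment> \<open>When the spins at \<open>y\<close> and \<open>u\<close> agree, the weight is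
      that of the contracted system up to the constant \<open>exp (J0 u u / 2)\<close>, which drops
      out of the cross ratio.\<close>
    have ct: "ptn V J0 g U P = exp (J0 u u / 2) * ptn ?V ?C g U (P - {u})"
      if "g u = 0" "u \<in> P \<longleftrightarrow> y \<in> P" for g P
      unfolding ptn_def sum_distrib_left
    proof (rule sum.cong[OF refl])
      fix X assume X: "X \<in> Pow U"
      have "wt V J0 g (P \<union> X) = exp (J0 u u / 2) * wt ?V (contract J0 y u) g (P \<union> X)"
        by (rule wt_contract) (use fin xyu that X U in auto)
      also have "wt ?V (contract J0 y u) g (P \<union> X) = wt ?V (contract J0 y u) g (P - {u} \<union> X)"
        by (rule wt_cong) auto
      finally show "wt V J0 g (P \<union> X) = exp (J0 u u / 2) * wt ?V ?C g (P - {u} \<union> X)" by (simp add: J0_def)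
    qed
    have "cross_ratio ?V ?C h0 x y = (z {x, y, u} * z {}) / (z {x} * z {y, u})"
      unfolding cross_ratio_def Let_def Vu z_def using xyu
      by (simp add: ct h0_def insert_Diff_if)
    moreover have "cross_ratio ?V ?C (\<lambda>_. 0) x y = (w {x, y, u} * w {}) / (w {x} * w {y, u})"
      unfolding cross_ratio_def Let_def Vu w_def using xyu
      by (simp add: ct insert_Diff_if)
    moreover have "cross_ratio ?V ?C h0 x y \<le> cross_ratio ?V ?C (\<lambda>_. 0) x y"
      using con xyu by (auto simp: field_decreases_def)
    ultimately have "(z {x, y, u} / z {y, u}) * (z {} / z {x}) \<le> (w {x, y, u} / w {y, u})\<^sup>2"
      by (simp add: wflip power2_eq_square mult_ac)
    then have "ln ((z {x, y, u} / z {y, u}) * (z {} / z {x})) \<le> ln ((w {x, y, u} / w {y, u})\<^sup>2)"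
      by (subst ln_le_cancel_iff) (simp_all add: zw_pos ne)
    moreover have "ln ((z {x, y, u} / z {y, u}) * (z {} / z {x})) = ln (z {x, y, u} / z {y, u}) + ln (z {} / z {x})"
      by (rule ln_mult_pos) (simp_all add: zw_pos)
    moreover have "ln ((w {x, y, u} / w {y, u})\<^sup>2) = 2 * ln (w {x, y, u} / w {y, u})"
      by (simp add: ln_realpow zw_pos)
    ultimately show ?thesis by linarith
  qed
  obtain j s t where j: "0 < j" and
    ineq: "(z {x, y} * exp (- (s + j) + t) + z {x} * exp (- (s - j) - t)) * (z {y, u} * exp (s + j + t) + z {u} * exp (s - j - t))
       * (w {x, y, u} * exp j + w {y} * exp (- j))\<^sup>2
     < (z {x, y, u} * exp (s + j + t) + z {x, u} * exp (s - j - t)) * (z {} * exp (- (s - j) - t) + z {y} * exp (- (s + j) + t))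
       * (w {x, y} * exp (- j) + w {y, u} * exp j)\<^sup>2"
    by (rule violation_moves_to_neighbour[OF 1 2 3 Jyu 4])
  let ?Jj = "set_coupling J y u j" and ?h = "h(u := s, y := t)"
  have Zxu: "ptn V ?Jj ?h (V - {x, u}) {x, u} = z {x, y, u} * exp (s + j + t) + z {x, u} * exp (s - j - t)"
    "ptn V ?Jj ?h (V - {x, u}) {} = z {} * exp (- (s - j) - t) + z {y} * exp (- (s + j) + t)"
    "ptn V ?Jj ?h (V - {x, u}) {x} = z {x, y} * exp (- (s + j) + t) + z {x} * exp (- (s - j) - t)"
    "ptn V ?Jj ?h (V - {x, u}) {u} = z {y, u} * exp (s + j + t) + z {u} * exp (s - j - t)"
    unfolding VU ptn_insert[OF U(1) U(3)] zf
    using xyu by (simp_all add: spin_def insert_commute algebra_simps)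
  have Wxu: "ptn V ?Jj (\<lambda>_. 0) (V - {x, u}) {x, u} = w {x, y, u} * exp j + w {y} * exp (- j)"
    "ptn V ?Jj (\<lambda>_. 0) (V - {x, u}) {x} = w {x, y} * exp (- j) + w {y, u} * exp j"
    unfolding VU ptn_insert[OF U(1) U(3)] wf
    using xyu wflip by (simp_all add: spin_def insert_commute algebra_simps)
  have fw: "0 < w {x, y} * exp (- j) + w {y, u} * exp j" "0 < z {x, y} * exp (- (s + j) + t) + z {x} * exp (- (s - j) - t)"
    "0 < z {y, u} * exp (s + j + t) + z {u} * exp (s - j - t)"
    by (intro add_pos_pos mult_pos_pos zw_pos exp_gt_zero)+
  have e1: "cross_ratio V ?Jj (\<lambda>_. 0) x u = (w {x, y, u} * exp j + w {y} * exp (- j))\<^sup>2 / (w {x, y} * exp (- j) + w {y, u} * exp j)\<^sup>2"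
    unfolding cross_ratio_def Let_def power2_eq_square
    using cross_ratio_zero_diagonal[OF fin xyu(1,3,6), of ?Jj] by (simp add: Wxu)
  have e2: "cross_ratio V ?Jj ?h x u = ((z {x, y, u} * exp (s + j + t) + z {x, u} * exp (s - j - t)) * (z {} * exp (- (s - j) - t) + z {y} * exp (- (s + j) + t)))
      / ((z {x, y} * exp (- (s + j) + t) + z {x} * exp (- (s - j) - t)) * (z {y, u} * exp (s + j + t) + z {u} * exp (s - j - t)))"
    unfolding cross_ratio_def Let_def Zxu ..
  have e3: "cross_ratio V ?Jj (\<lambda>_. 0) x u < cross_ratio V ?Jj ?h x u"
    unfolding e1 e2 by (rule frac_less_frac[OF zero_less_power[OF fw(1)] mult_pos_pos[OF fw(2,3)] ineq])
  show thesis by (rule that[OF j e3])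
qed

section \<open>Induction on sites and edges\<close>

lemma edges_finite: "finite V \<Longrightarrow> finite (edges V J)"
  by (rule finite_subset[of _ "V \<times> V"]) (auto simp: edges_def)

lemma edges_set_coupling_pos:
  assumes "ferro V J" "y \<in> V" "u \<in> V" "J y u \<noteq> 0" "0 < j"
  shows "edges V (set_coupling J y u j) = edges V J"
proof -
  have "J u y = J y u" using assms by (auto simp: ferro_def)
  then show ?thesis using assms unfolding edges_def set_coupling_def by auto
qed

lemma card_edges_delete:
  assumes "finite V" "y \<in> V" "u \<in> V" "y \<noteq> u" "J y u \<noteq> 0"
  shows "card (edges V (set_coupling J y u 0)) < card (edges V J)"
proof (rule psubset_card_mono[OF edges_finite[OF assms(1)]])
  have "(y, u) \<in> edges V J" "(y, u) \<notin> edges V (set_coupling J y u 0)"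
    using assms by (auto simp: edges_def set_coupling_def)
  moreover have "edges V (set_coupling J y u 0) \<subseteq> edges V J"
    by (auto simp: edges_def set_coupling_def split: if_splits)
  ultimately show "edges V (set_coupling J y u 0) \<subset> edges V J" by auto
qed

text \<open>The coupling of \<open>x\<close> and \<open>y\<close> multiplies the two aligned weights
  by \<open>exp (J x y)\<close> and the two others by its inverse. The resulting factor does not
  depend on the field, so a violation persists when the edge between \<open>x\<close> and
  \<open>y\<close> is deleted.\<close>

lemma cross_ratio_delete_direct:
  assumes "finite V" "ferro V J" "x \<in> V" "y \<in> V" "x \<noteq> y"
  shows "cross_ratio V J h x y = exp (4 * J x y) * cross_ratio V (set_coupling J x y 0) h x y"
proof -
  have J: "set_coupling J x y (J x y) = J" by (rule set_coupling_same[OF assms(2-4)])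
  have *: "ptn V J h (V - {x, y}) P = ptn V (set_coupling J x y 0) h (V - {x, y}) P * exp (J x y * (spin P x * spin P y))"
    if "P \<subseteq> {x, y}" for P
    unfolding ptn_def sum_distrib_right
  proof (rule sum.cong[OF refl])
    fix X assume "X \<in> Pow (V - {x, y})"
    then have "spin (P \<union> X) x = spin P x" "spin (P \<union> X) y = spin P y" by (auto simp: spin_def)
    then show "wt V J h (P \<union> X) = wt V (set_coupling J x y 0) h (P \<union> X) * exp (J x y * (spin P x * spin P y))"
      using wt_set_coupling[OF assms(1,3,4,5), of J "J x y" h "P \<union> X"] by (simp add: J)
  qed
  have e: "exp (4 * J x y) = exp (J x y) ^ 4" by (simp add: exp_of_nat_mult[symmetric])
  show ?thesis
    unfolding cross_ratio_def Let_def e using assms(5)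
    by (simp add: * spin_def exp_minus divide_simps power4_eq_xxxx)
qed

text \<open>The sites \<open>y\<close> for which \<open>(x, y)\<close> violates the inequality, for some couplings on the same edges, form a set that is closed under
  neighbours and not adjacent to \<open>x\<close>; hence its spins are independent of the spin at \<open>x\<close>.\<close>

lemma field_decreases_step:
  fixes V :: "'a set"
  assumes fin: "finite V" and fer: "ferro V J"
    and smaller: "\<And>(V' :: 'a set) J'. finite V' \<Longrightarrow> card V' < card V \<Longrightarrow> ferro V' J' \<Longrightarrow> field_decreases V' J'"
    and fewer: "\<And>J'. ferro V J' \<Longrightarrow> card (edges V J') < card (edges V J) \<Longrightarrow> field_decreases V J'"
  shows "field_decreases V J"
proof (rule ccontr)
  assume "\<not> field_decreases V J"
  then obtain x y0 h0 where x: "x \<in> V" "y0 \<in> V" "x \<noteq> y0"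
    and viol0: "cross_ratio V J (\<lambda>_. 0) x y0 < cross_ratio V J h0 x y0"
    by (auto simp: field_decreases_def not_le)
  \<comment> \<open>The couplings \<open>K\<close> must be allowed to vary because
    \<open>edge_step\<close> alters one of them. Fixing the edge set makes deletion of an edge from
    \<open>K\<close> fall under the hypothesis \<open>fewer\<close>.\<close>
  define bad where "bad y K \<longleftrightarrow> ferro V K \<and> edges V K = edges V J \<and>
      (\<exists>h. cross_ratio V K (\<lambda>_. 0) x y < cross_ratio V K h x y)" for y K
  define W where "W = {y \<in> V. y \<noteq> x \<and> (\<exists>K. bad y K)}"
  have del: "field_decreases V (set_coupling K a b 0)"
    if "ferro V K" "edges V K = edges V J" "a \<in> V" "b \<in> V" "a \<noteq> b" "K a b \<noteq> 0" for K a b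
    using fewer[OF ferro_set_coupling[OF that(1)], of 0 a b] card_edges_delete[where J = K, OF fin that(3-6)] that(2) by simp
  have no_x: "(x, y) \<notin> edges V J" if "y \<in> W" for y
  proof
    assume e: "(x, y) \<in> edges V J"
    obtain K h where K: "ferro V K" "edges V K = edges V J" "cross_ratio V K (\<lambda>_. 0) x y < cross_ratio V K h x y"
      using \<open>y \<in> W\<close> by (auto simp: W_def bad_def)
    have xy: "x \<in> V" "y \<in> V" "x \<noteq> y" "K x y \<noteq> 0" using e K(2) by (auto simp: edges_def)
    have "field_decreases V (set_coupling K x y 0)" using del[OF K(1,2) xy] .
    then have "cross_ratio V (set_coupling K x y 0) h x y \<le> cross_ratio V (set_coupling K x y 0) (\<lambda>_. 0) x y"
      using xy by (auto simp: field_decreases_def)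
    then show False using K(3) unfolding cross_ratio_delete_direct[OF fin K(1) xy(1-3)] by simp
  qed
  have closed: "u \<in> W" if "y \<in> W" "(y, u) \<in> edges V J" for y u
  proof -
    obtain K h where K: "ferro V K" "edges V K = edges V J" "cross_ratio V K (\<lambda>_. 0) x y < cross_ratio V K h x y"
      using \<open>y \<in> W\<close> by (auto simp: W_def bad_def)
    have yu: "y \<in> V" "u \<in> V" "y \<noteq> u" "K y u \<noteq> 0" using that(2) K(2) by (auto simp: edges_def)
    have xy: "x \<noteq> y" using that(1) by (auto simp: W_def)
    have "x \<noteq> u"
    proof
      assume "x = u"
      then have "(x, y) \<in> edges V J" using yu K(1,2) x(1) by (auto simp: edges_def ferro_def)
      then show False using no_x that(1) by blast
    qed
    have pos: "0 < K y u" using K(1) yu by (fastforce simp: ferro_def)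
    have con: "field_decreases (V - {u}) (contract (set_coupling K y u 0) y u)"
    proof (rule smaller)
      show "card (V - {u}) < card V" using fin yu by (intro psubset_card_mono) auto
      show "ferro (V - {u}) (contract (set_coupling K y u 0) y u)"
        using yu by (intro ferro_contract ferro_set_coupling K(1)) auto
    qed (use fin in simp)
    obtain j h' where "0 < j" "cross_ratio V (set_coupling K y u j) (\<lambda>_. 0) x u < cross_ratio V (set_coupling K y u j) h' x u"
      using edge_step[OF fin K(1) x(1) yu(1,2) xy yu(3) \<open>x \<noteq> u\<close> pos del[OF K(1,2) yu] con K(3)] .
    then have "bad u (set_coupling K y u j)"
      unfolding bad_def using ferro_set_coupling[OF K(1)] edges_set_coupling_pos[OF K(1) yu(1,2,4)] K(2) by auto
    then show "u \<in> W" using yu \<open>x \<noteq> u\<close> by (auto simp: W_def)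
  qed
  have "y0 \<in> W" using x viol0 fer by (auto simp: W_def bad_def)
  moreover have "J a b = 0 \<and> J b a = 0" if "a \<in> W" "b \<in> V - W" for a b
  proof -
    have ab: "a \<in> V" "b \<in> V" "a \<noteq> b" using that by (auto simp: W_def)
    then have "(a, b) \<notin> edges V J" using closed[OF that(1)] that(2) by auto
    then show ?thesis using ab fer by (auto simp: edges_def ferro_def)
  qed
  moreover have "W \<subseteq> V" "x \<in> V - W" using x by (auto simp: W_def)
  ultimately have "cross_ratio V J h x y0 = 1" for h
    by (intro cross_ratio_decoupled[OF fin]) auto
  then show False using viol0 by simp
qed

text \<open>The induction is lexicographic: contraction removes a site, whatever it does to the
  edges, and deletion removes an edge on the same sites.\<close>

theorem field_decreases_ferro:
  fixes V :: "'a set"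
  assumes "finite V" "ferro V J" shows "field_decreases V J"
  using assms
proof (induction "card V" arbitrary: V J rule: less_induct)
  case (less V)
  note outer = less
  from \<open>ferro V J\<close> show ?case
  proof (induction "card (edges V J)" arbitrary: J rule: less_induct)
    case (less J)
    show ?case
    proof (rule field_decreases_step[OF outer(2) less.prems])
      show "field_decreases V' J'" if "finite V'" "card V' < card V" "ferro V' J'" for V' :: "'a set" and J'
        using outer(1)[OF that(2,1,3)] .
      show "field_decreases V J'" if "ferro V J'" "card (edges V J') < card (edges V J)" for J'
        using less.hyps[OF that(2,1)] .
    qed
  qed
qed

section \<open>Covariances of the Ising model\<close>

definition config :: "'n::finite set \<Rightarrow> real^'n" where
  "config X = (\<chi> v. spin X v)"

lemma config_nth [simp]: "config X $ v = spin X v"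
  by (simp add: config_def)

lemma bij_betw_config: "bij_betw config UNIV (spins :: (real^'n::finite) set)"
proof (rule bij_betw_byWitness[where f' = "\<lambda>\<sigma>. {v. \<sigma> $ v = 1}"])
  show "\<forall>\<sigma>\<in>spins. config {v. \<sigma> $ v = 1} = (\<sigma> :: real^'n)"
    by (auto simp: spins_def vec_eq_iff spin_def)
qed (auto simp: spins_def spin_def split: if_splits)

lemma spins_configE:
  assumes "\<sigma> \<in> spins" obtains X where "\<sigma> = config X"
proof -
  have "\<sigma> \<in> range config" unfolding bij_betw_imp_surj_on[OF bij_betw_config] by (rule assms)
  then show thesis using that by (rule rangeE)
qed

lemma sum_spins: "(\<Sum>\<sigma>\<in>spins. f \<sigma>) = (\<Sum>X\<in>UNIV. f (config X))"
  using sum.reindex_bij_betw[OF bij_betw_config, of f] by simp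

lemma finite_spins [simp]: "finite (spins :: (real^'n::finite) set)"
  using bij_betw_finite[OF bij_betw_config] by auto

lemma config_in_spins [simp]: "config X \<in> spins"
  using bij_betw_config by (auto simp: bij_betw_def)

lemma spins_nonempty [simp]: "spins \<noteq> {}"
  using config_in_spins by blast

lemma spins_nth:
  assumes "\<sigma> \<in> spins"
  shows "\<sigma> $ x * \<sigma> $ x = 1" "\<bar>\<sigma> $ x\<bar> = 1" "\<sigma> $ x \<le> 1" "- 1 \<le> \<sigma> $ x"
proof -
  have "\<sigma> $ x = 1 \<or> \<sigma> $ x = -1" using assms by (simp add: spins_def)
  then show "\<sigma> $ x * \<sigma> $ x = 1" "\<bar>\<sigma> $ x\<bar> = 1" "\<sigma> $ x \<le> 1" "- 1 \<le> \<sigma> $ x" by auto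
qed

lemma ising_weight_pos [simp]: "0 < ising_weight A t h \<sigma>"
  by (simp add: ising_weight_def)

lemma ising_Z_pos [simp]: "0 < ising_Z A t h"
  unfolding ising_Z_def by (rule sum_pos) auto

lemma ising_weight_config:
  "ising_weight A t h (config X) = wt UNIV (\<lambda>a b. - t * A $ a $ b) (\<lambda>a. h $ a) X"
  unfolding ising_weight_def wt_def exp_add
  by (simp add: inner_vec_def matrix_vector_mult_def sum_distrib_left sum_distrib_right sum_divide_distrib mult_ac sum_negf)

lemma ising_E_const [simp]: "ising_E A t h (\<lambda>_. c) = c"
proof -
  have "ising_Z A t h \<noteq> 0" using ising_Z_pos[of A t h] by linarith
  then show ?thesis by (simp add: ising_E_def ising_Z_def sum_distrib_left[symmetric])
qed

lemma ising_E_add: "ising_E A t h (\<lambda>\<sigma>. f \<sigma> + g \<sigma>) = ising_E A t h f + ising_E A t h g"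
  by (simp add: ising_E_def distrib_right sum.distrib add_divide_distrib)

lemma ising_E_diff: "ising_E A t h (\<lambda>\<sigma>. f \<sigma> - g \<sigma>) = ising_E A t h f - ising_E A t h g"
  by (simp add: ising_E_def left_diff_distrib sum_subtractf diff_divide_distrib)

lemma ising_E_cmult: "ising_E A t h (\<lambda>\<sigma>. c * f \<sigma>) = c * ising_E A t h f"
  by (simp add: ising_E_def sum_distrib_left mult_ac)

lemma ising_E_sum: "ising_E A t h (\<lambda>\<sigma>. \<Sum>i\<in>I. f i \<sigma>) = (\<Sum>i\<in>I. ising_E A t h (f i))"
  unfolding ising_E_def sum_distrib_right sum_divide_distrib[symmetric]
  by (subst sum.swap) simp

lemma ising_E_cong: "(\<And>\<sigma>. \<sigma> \<in> spins \<Longrightarrow> f \<sigma> = g \<sigma>) \<Longrightarrow> ising_E A t h f = ising_E A t h g"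
  unfolding ising_E_def by (intro arg_cong2[where f = "(/)"] sum.cong) auto

lemma ising_E_mono: "(\<And>\<sigma>. \<sigma> \<in> spins \<Longrightarrow> f \<sigma> \<le> g \<sigma>) \<Longrightarrow> ising_E A t h f \<le> ising_E A t h g"
  unfolding ising_E_def
  by (intro divide_right_mono sum_mono mult_right_mono) (auto intro: less_imp_le)

lemma ising_E_pair:
  fixes x y :: "'n::finite"
  assumes "x \<noteq> y" and J: "J = (\<lambda>a b. - t * A $ a $ b)"
    and Z: "Z = ptn UNIV J (\<lambda>a. h $ a) (UNIV - {x, y})"
  shows "ising_Z A t h = Z {x, y} + Z {} + Z {x} + Z {y}"
    "ising_E A t h (\<lambda>\<sigma>. \<sigma> $ x * \<sigma> $ y) = (Z {x, y} + Z {} - Z {x} - Z {y}) / ising_Z A t h"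
    "ising_E A t h (\<lambda>\<sigma>. \<sigma> $ x) = (Z {x, y} + Z {x} - Z {} - Z {y}) / ising_Z A t h"
    "ising_E A t h (\<lambda>\<sigma>. \<sigma> $ y) = (Z {x, y} + Z {y} - Z {} - Z {x}) / ising_Z A t h"
proof -
  let ?U = "UNIV - {x, y}" and ?w = "wt UNIV J (\<lambda>a. h $ a)"
  have U: "finite ?U" "y \<notin> ?U" "finite (insert y ?U)" "x \<notin> insert y ?U" "UNIV = Pow (insert x (insert y ?U))"
    using assms(1) by auto
  have *: "(\<Sum>\<sigma>\<in>spins. f (\<sigma> $ x) (\<sigma> $ y) * ising_weight A t h \<sigma>)
     = f 1 1 * Z {x, y} + f 1 (-1) * Z {x} + f (-1) 1 * Z {y} + f (-1) (-1) * Z {}" for f :: "real \<Rightarrow> real \<Rightarrow> real"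
  proof -
    have "(\<Sum>\<sigma>\<in>spins. f (\<sigma> $ x) (\<sigma> $ y) * ising_weight A t h \<sigma>) = (\<Sum>X\<in>Pow (insert x (insert y ?U)). f (spin X x) (spin X y) * ?w X)"
      unfolding sum_spins ising_weight_config J[symmetric] U(5)[symmetric] by simp
    also have "\<dots> = (\<Sum>X\<in>Pow ?U. f (spin X x) (spin X y) * ?w X) + (\<Sum>X\<in>Pow ?U. f (spin (insert y X) x) (spin (insert y X) y) * ?w (insert y X))
      + ((\<Sum>X\<in>Pow ?U. f (spin (insert x X) x) (spin (insert x X) y) * ?w (insert x X))
         + (\<Sum>X\<in>Pow ?U. f (spin (insert x (insert y X)) x) (spin (insert x (insert y X)) y) * ?w (insert x (insert y X))))"
      unfolding sum_Pow_insert[OF U(3,4)] sum_Pow_insert[OF U(1,2)] ..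
    also have "(\<Sum>X\<in>Pow ?U. f (spin X x) (spin X y) * ?w X) = f (-1) (-1) * Z {}"
      unfolding Z ptn_def sum_distrib_left by (intro sum.cong) (auto simp: spin_def)
    also have "(\<Sum>X\<in>Pow ?U. f (spin (insert y X) x) (spin (insert y X) y) * ?w (insert y X)) = f (-1) 1 * Z {y}"
      unfolding Z ptn_def sum_distrib_left using assms(1) by (intro sum.cong) (auto simp: spin_def)
    also have "(\<Sum>X\<in>Pow ?U. f (spin (insert x X) x) (spin (insert x X) y) * ?w (insert x X)) = f 1 (-1) * Z {x}"
      unfolding Z ptn_def sum_distrib_left using assms(1) by (intro sum.cong) (auto simp: spin_def)
    also have "(\<Sum>X\<in>Pow ?U. f (spin (insert x (insert y X)) x) (spin (insert x (insert y X)) y) * ?w (insert x (insert y X))) = f 1 1 * Z {x, y}"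
      unfolding Z ptn_def sum_distrib_left by (intro sum.cong) (auto simp: spin_def)
    finally show ?thesis by simp
  qed
  show "ising_Z A t h = Z {x, y} + Z {} + Z {x} + Z {y}"
    unfolding ising_Z_def using *[of "\<lambda>_ _. 1"] by simp
  show "ising_E A t h (\<lambda>\<sigma>. \<sigma> $ x * \<sigma> $ y) = (Z {x, y} + Z {} - Z {x} - Z {y}) / ising_Z A t h"
    unfolding ising_E_def using *[of "\<lambda>a b. a * b"] by simp
  show "ising_E A t h (\<lambda>\<sigma>. \<sigma> $ x) = (Z {x, y} + Z {x} - Z {} - Z {y}) / ising_Z A t h"
    unfolding ising_E_def using *[of "\<lambda>a b. a"] by simp
  show "ising_E A t h (\<lambda>\<sigma>. \<sigma> $ y) = (Z {x, y} + Z {y} - Z {} - Z {x}) / ising_Z A t h"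
    unfolding ising_E_def using *[of "\<lambda>a b. b"] by simp
qed

definition ising_cov :: "real^'n^'n \<Rightarrow> real \<Rightarrow> real^'n::finite \<Rightarrow> (real^'n \<Rightarrow> real) \<Rightarrow> (real^'n \<Rightarrow> real) \<Rightarrow> real" where
  "ising_cov A t h f g = ising_E A t h (\<lambda>\<sigma>. f \<sigma> * g \<sigma>) - ising_E A t h f * ising_E A t h g"

text \<open>With weights \<open>a\<close>, \<open>b\<close> of \<open>++\<close>, \<open>--\<close>
  and \<open>c\<close>, \<open>d\<close> of \<open>+-\<close>, \<open>-+\<close>, the left side is
  the covariance. Replacing each pair by its geometric mean keeps the numerator and lowers the
  total, so the covariance is at most the correlation \<open>(p - q) / (p + q)\<close> of a balanced
  table with the same cross ratio. That correlation is monotone in the cross ratio.\<close>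

lemma covariance_le_ratio:
  fixes a b c d a0 c0 :: real
  assumes pos: "0 < a" "0 < b" "0 < c" "0 < d" "0 < a0" "0 < c0"
    and fkg: "c * d \<le> a * b" and ratio: "(a * b) / (c * d) \<le> (a0 * a0) / (c0 * c0)"
  shows "4 * (a * b - c * d) / (a + b + c + d)\<^sup>2 \<le> (a0 - c0) / (a0 + c0)"
proof -
  define p q where "p = sqrt (a * b)" and "q = sqrt (c * d)"
  have pq: "0 < p" "0 < q" "p\<^sup>2 = a * b" "q\<^sup>2 = c * d" "q \<le> p" using pos fkg by (simp_all add: p_def q_def)
  have "2 * p \<le> a + b" "2 * q \<le> c + d"
    using arith_geo_mean_sqrt[of a b] arith_geo_mean_sqrt[of c d] pos by (simp_all add: p_def q_def)
  then have "(2 * (p + q))\<^sup>2 \<le> (a + b + c + d)\<^sup>2"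
    using pq by (intro power_mono) auto
  then have "4 * (a * b - c * d) / (a + b + c + d)\<^sup>2 \<le> 4 * (a * b - c * d) / (2 * (p + q))\<^sup>2"
    using fkg pq by (intro divide_left_mono mult_nonneg_nonneg mult_pos_pos) (auto simp: pos add_pos_pos)
  also have "\<dots> = (p - q) / (p + q)"
  proof -
    have "4 * (a * b - c * d) = 4 * ((p - q) * (p + q))" unfolding pq(3,4)[symmetric] by (simp add: power2_eq_square algebra_simps)
    moreover have "4 * ((p - q) * r) / (2 * r)\<^sup>2 = (p - q) / r" if "r \<noteq> 0" for r
      using that by (simp add: power2_eq_square)
    moreover have "p + q \<noteq> 0" using pq by simp
    ultimately show ?thesis by (simp only:)
  qed
  also have "\<dots> \<le> (a0 - c0) / (a0 + c0)"
  proof -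
    have "a * b / (c * d) * ((c * d) * (c0 * c0)) \<le> a0 * a0 / (c0 * c0) * ((c * d) * (c0 * c0))"
      by (rule mult_right_mono[OF ratio]) (simp add: pos less_imp_le)
    then have "a * b * (c0 * c0) \<le> a0 * a0 * (c * d)" using pos by simp
    then have "(p * c0)\<^sup>2 \<le> (a0 * q)\<^sup>2"
      unfolding power_mult_distrib pq(3,4) by (simp add: power2_eq_square)
    then have le: "p * c0 \<le> a0 * q" by (rule power2_le_imp_le) (use pq pos in simp)
    have "(p - q) * (a0 + c0) \<le> (a0 - c0) * (p + q)"
      using le by (simp add: algebra_simps)
    then show ?thesis using pq pos by (simp add: divide_le_eq le_divide_eq)
  qed
  finally show ?thesis .
qed

lemma two_spin_covariance:
  fixes a b c d s :: real
  assumes "s = a + b + c + d" "s \<noteq> 0"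
  shows "(a + b - c - d) / s - (a + c - b - d) / s * ((a + d - b - c) / s) = 4 * (a * b - c * d) / s\<^sup>2"
proof -
  have "(a + b - c - d) * s - (a + c - b - d) * (a + d - b - c) = 4 * (a * b - c * d)"
    unfolding assms(1) by (simp add: algebra_simps)
  moreover have "u / s - v / s * (w / s) = (u * s - v * w) / s\<^sup>2" for u v w
    using assms(2) by (simp add: power2_eq_square diff_divide_distrib)
  ultimately show ?thesis by (simp only:)
qed

locale ferromagnet =
  fixes A :: "real^'n^'n::finite"
  assumes sym: "transpose A = A" and offdiag: "\<And>x y. x \<noteq> y \<Longrightarrow> A $ x $ y \<le> 0"
begin

lemma ferro_couplings: "0 \<le> t \<Longrightarrow> ferro UNIV (\<lambda>a b. - t * A $ a $ b)"
  using sym offdiag unfolding ferro_def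
  by (auto simp: transpose_def vec_eq_iff mult_nonneg_nonpos)

text \<open>For distinct sites the lower bound is the lattice condition for \<open>{x}\<close> and
  \<open>{y}\<close>, and the upper bound is the cross ratio inequality. For equal sites both follow
  from \<open>\<sigma> $ x\<close> being of square one.\<close>

lemma ising_cov_bounds:
  assumes t: "0 \<le> t"
  shows "0 \<le> ising_cov A t h (\<lambda>\<sigma>. \<sigma> $ x) (\<lambda>\<sigma>. \<sigma> $ y)"
    "ising_cov A t h (\<lambda>\<sigma>. \<sigma> $ x) (\<lambda>\<sigma>. \<sigma> $ y) \<le> ising_E A t 0 (\<lambda>\<sigma>. \<sigma> $ x * \<sigma> $ y)"
proof -
  have "0 \<le> ising_cov A t h (\<lambda>\<sigma>. \<sigma> $ x) (\<lambda>\<sigma>. \<sigma> $ y) \<and>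
    ising_cov A t h (\<lambda>\<sigma>. \<sigma> $ x) (\<lambda>\<sigma>. \<sigma> $ y) \<le> ising_E A t 0 (\<lambda>\<sigma>. \<sigma> $ x * \<sigma> $ y)"
  proof (cases "x = y")
    case True
    have one: "ising_E A t h (\<lambda>\<sigma>. \<sigma> $ y * \<sigma> $ y) = 1" for h
      using ising_E_cong[of "\<lambda>\<sigma>. \<sigma> $ y * \<sigma> $ y" "\<lambda>_. 1" A t h] by (simp add: spins_nth)
    have "ising_E A t h (\<lambda>\<sigma>. \<sigma> $ y) \<le> ising_E A t h (\<lambda>_. 1)"
      by (rule ising_E_mono) (rule spins_nth)
    moreover have "ising_E A t h (\<lambda>_. - 1) \<le> ising_E A t h (\<lambda>\<sigma>. \<sigma> $ y)"
      by (rule ising_E_mono) (rule spins_nth)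
    ultimately have "\<bar>ising_E A t h (\<lambda>\<sigma>. \<sigma> $ y)\<bar> \<le> 1" by simp
    then have "ising_E A t h (\<lambda>\<sigma>. \<sigma> $ y) * ising_E A t h (\<lambda>\<sigma>. \<sigma> $ y) \<le> 1"
      by (simp add: abs_square_le_1 flip: power2_eq_square)
    then show ?thesis using True by (simp add: ising_cov_def one)
  next
    case False
    define J where "J = (\<lambda>a b. - t * A $ a $ b)"
    define Z where "Z = ptn UNIV J (\<lambda>a. h $ a) (UNIV - {x, y})"
    define W where "W = ptn UNIV J (\<lambda>_. 0) (UNIV - {x, y})"
    have J: "ferro UNIV J" unfolding J_def by (rule ferro_couplings[OF t])
    have pos: "0 < Z P" "0 < W P" for P by (simp_all add: Z_def W_def)
    have W: "W {} = W {x, y}" "W {x} = W {y}"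
      unfolding W_def using cross_ratio_zero_diagonal[of UNIV x y J] False by simp_all
    have W': "W = ptn UNIV J (\<lambda>a. (0 :: real^'n) $ a) (UNIV - {x, y})" by (simp add: W_def)
    note hE = ising_E_pair[OF False J_def Z_def]
    note zE = ising_E_pair[OF False J_def W']
    have "Z {x} * Z {y} \<le> Z ({x} \<union> {y}) * Z ({x} \<inter> {y})"
      unfolding Z_def by (rule ptn_supermodular[OF J]) auto
    then have fkg: "Z {x} * Z {y} \<le> Z {x, y} * Z {}" using False by (simp add: insert_commute)
    have "cross_ratio UNIV J (\<lambda>a. h $ a) x y \<le> cross_ratio UNIV J (\<lambda>_. 0) x y"
      using field_decreases_ferro[OF _ J] False by (simp add: field_decreases_def)
    then have ratio: "Z {x, y} * Z {} / (Z {x} * Z {y}) \<le> W {x, y} * W {x, y} / (W {y} * W {y})"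
      by (simp add: cross_ratio_def Let_def Z_def[symmetric] W_def[symmetric] W)
    have "ising_Z A t h \<noteq> 0" using ising_Z_pos[of A t h] by linarith
    then have cov: "ising_cov A t h (\<lambda>\<sigma>. \<sigma> $ x) (\<lambda>\<sigma>. \<sigma> $ y) = 4 * (Z {x, y} * Z {} - Z {x} * Z {y}) / (Z {x, y} + Z {} + Z {x} + Z {y})\<^sup>2"
      unfolding ising_cov_def hE(2-4) hE(1)[symmetric] using hE(1) by (intro two_spin_covariance) auto
    have E0: "ising_E A t 0 (\<lambda>\<sigma>. \<sigma> $ x * \<sigma> $ y) = (W {x, y} - W {y}) / (W {x, y} + W {y})"
    proof -
      have e: "W {x, y} + W {} - W {x} - W {y} = 2 * (W {x, y} - W {y})" "ising_Z A t 0 = 2 * (W {x, y} + W {y})"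
        unfolding zE(1) W by simp_all
      show ?thesis unfolding zE(2) e by (rule mult_divide_mult_cancel_left) simp
    qed
    have "4 * (Z {x, y} * Z {} - Z {x} * Z {y}) / (Z {x, y} + Z {} + Z {x} + Z {y})\<^sup>2 \<le> (W {x, y} - W {y}) / (W {x, y} + W {y})"
      by (rule covariance_le_ratio[OF pos(1) pos(1) pos(1) pos(1) pos(2) pos(2) fkg ratio])
    moreover have "0 \<le> 4 * (Z {x, y} * Z {} - Z {x} * Z {y}) / (Z {x, y} + Z {} + Z {x} + Z {y})\<^sup>2"
      using fkg by simp
    ultimately show ?thesis unfolding cov E0 by simp
  qed
  then show "0 \<le> ising_cov A t h (\<lambda>\<sigma>. \<sigma> $ x) (\<lambda>\<sigma>. \<sigma> $ y)"
    "ising_cov A t h (\<lambda>\<sigma>. \<sigma> $ x) (\<lambda>\<sigma>. \<sigma> $ y) \<le> ising_E A t 0 (\<lambda>\<sigma>. \<sigma> $ x * \<sigma> $ y)" by auto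
qed

text \<open>A Schur test: nonnegative covariances allow \<open>v $ x * v $ y\<close> to be replaced
  by half the sum of squares, after which they are compared with the zero-field correlations, whose
  row sums are at most the susceptibility.\<close>

lemma ising_variance_le:
  assumes t: "0 \<le> t"
  shows "ising_cov A t h (\<lambda>\<sigma>. v \<bullet> \<sigma>) (\<lambda>\<sigma>. v \<bullet> \<sigma>) \<le> susceptibility A t * (v \<bullet> v)"
proof -
  let ?K = "\<lambda>x y. ising_E A t 0 (\<lambda>\<sigma>. \<sigma> $ x * \<sigma> $ y)" and ?C = "\<lambda>x y. ising_cov A t h (\<lambda>\<sigma>. \<sigma> $ x) (\<lambda>\<sigma>. \<sigma> $ y)"
  have K0: "0 \<le> ?K x y" for x y using ising_cov_bounds[OF t, of h x y] by linarith
  have "ising_cov A t h (\<lambda>\<sigma>. v \<bullet> \<sigma>) (\<lambda>\<sigma>. v \<bullet> \<sigma>) = (\<Sum>x\<in>UNIV. \<Sum>y\<in>UNIV. v $ x * v $ y * ?C x y)"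
  proof -
    have "(\<lambda>\<sigma>. (v \<bullet> \<sigma>) * (v \<bullet> \<sigma>)) = (\<lambda>\<sigma>. \<Sum>x\<in>UNIV. \<Sum>y\<in>UNIV. (v $ x * v $ y) * (\<sigma> $ x * \<sigma> $ y))"
      by (simp add: fun_eq_iff inner_vec_def sum_product mult_ac)
    then have "ising_E A t h (\<lambda>\<sigma>. (v \<bullet> \<sigma>) * (v \<bullet> \<sigma>)) = (\<Sum>x\<in>UNIV. \<Sum>y\<in>UNIV. v $ x * v $ y * ising_E A t h (\<lambda>\<sigma>. \<sigma> $ x * \<sigma> $ y))"
      by (simp add: ising_E_sum ising_E_cmult)
    moreover have "ising_E A t h (\<lambda>\<sigma>. v \<bullet> \<sigma>) = (\<Sum>x\<in>UNIV. v $ x * ising_E A t h (\<lambda>\<sigma>. \<sigma> $ x))"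
      by (simp add: inner_vec_def ising_E_sum ising_E_cmult)
    ultimately show ?thesis
      by (simp add: ising_cov_def sum_product sum_subtractf right_diff_distrib mult_ac)
  qed
  also have "\<dots> \<le> (\<Sum>x\<in>UNIV. \<Sum>y\<in>UNIV. ((v $ x)\<^sup>2 + (v $ y)\<^sup>2) / 2 * ?K x y)"
  proof (intro sum_mono)
    fix x y
    have "v $ x * v $ y * ?C x y \<le> ((v $ x)\<^sup>2 + (v $ y)\<^sup>2) / 2 * ?C x y"
      using ising_cov_bounds(1)[OF t] sum_squares_bound[of "v $ x" "v $ y"] by (intro mult_right_mono) auto
    also have "\<dots> \<le> ((v $ x)\<^sup>2 + (v $ y)\<^sup>2) / 2 * ?K x y"
      using ising_cov_bounds(2)[OF t] by (intro mult_left_mono) auto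
    finally show "v $ x * v $ y * ?C x y \<le> ((v $ x)\<^sup>2 + (v $ y)\<^sup>2) / 2 * ?K x y" .
  qed
  also have "\<dots> = (\<Sum>x\<in>UNIV. (v $ x)\<^sup>2 * (\<Sum>y\<in>UNIV. ?K x y))"
  proof -
    have "(\<Sum>x\<in>UNIV. \<Sum>y\<in>UNIV. (v $ y)\<^sup>2 * ?K x y) = (\<Sum>x\<in>UNIV. \<Sum>y\<in>UNIV. (v $ x)\<^sup>2 * ?K x y)"
      by (subst sum.swap) (simp add: mult.commute)
    then show ?thesis
      by (simp add: add_divide_distrib distrib_right sum.distrib sum_distrib_left sum_divide_distrib[symmetric])
  qed
  also have "\<dots> \<le> (\<Sum>x\<in>UNIV. (v $ x)\<^sup>2 * susceptibility A t)"
    unfolding susceptibility_def by (intro sum_mono mult_left_mono Max_ge) auto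
  also have "\<dots> = susceptibility A t * (v \<bullet> v)"
    by (simp add: inner_vec_def power2_eq_square sum_distrib_left mult_ac)
  finally show ?thesis .
qed

end

section \<open>The product measure\<close>

lemma Phi_ge_tangent:
  assumes "0 \<le> M" "0 < N" shows "M * (ln N + 1) - N \<le> Phi M"
proof (cases "M = 0")
  case False
  then have M: "0 < M" using assms by simp
  have "M * ln (N / M) \<le> M * (N / M - 1)"
    using M assms by (intro mult_left_mono ln_le_minus_one) auto
  then show ?thesis using M assms by (simp add: Phi_def ln_div algebra_simps)
qed (use assms in \<open>simp add: Phi_def\<close>)

text \<open>The tangent point \<open>(a\<^sup>2 + a * b + b\<^sup>2) / 3\<close> makes the derivative of the difference a perfect cube
  (up to a positive factor).\<close>

lemma two_point_aux:
  fixes x :: real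
  assumes "0 \<le> x"
  shows "(1 + x + x\<^sup>2) / 3 - 1 - ln ((1 + x + x\<^sup>2) / 3) \<le> (1 - x)\<^sup>2 / 2"
proof -
  define d where "d = (\<lambda>x::real. (1 - x)\<^sup>2 / 2 - (1 + x + x\<^sup>2) / 3 + 1 + ln ((1 + x + x\<^sup>2) / 3))"
  define d' where "d' = (\<lambda>x::real. (x - 1) ^ 3 / (3 * (1 + x + x\<^sup>2)))"
  have deriv: "(d has_real_derivative d' y) (at y)" if "0 \<le> y" for y
  proof -
    have p: "0 < 1 + y + y\<^sup>2" using that by (simp add: add_pos_nonneg)
    have "(d has_real_derivative (y - 1) - (1 + 2 * y) / 3 + (1 + 2 * y) / (1 + y + y\<^sup>2)) (at y)"
      unfolding d_def using p by (auto intro!: derivative_eq_intros simp: field_simps)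
    moreover have "(y - 1) - (1 + 2 * y) / 3 + (1 + 2 * y) / (1 + y + y\<^sup>2) = d' y"
      unfolding d'_def using p by (simp add: divide_simps) (simp add: power2_eq_square power3_eq_cube algebra_simps)
    ultimately show ?thesis by simp
  qed
  have "d 1 \<le> d x"
  proof (cases "1 \<le> x")
    case True
    show ?thesis
    proof (rule DERIV_nonneg_imp_nondecreasing[OF True])
      fix y assume "1 \<le> y" "y \<le> x"
      then show "\<exists>z. (d has_real_derivative z) (at y) \<and> 0 \<le> z"
        by (intro exI[of _ "d' y"] conjI deriv) (auto simp: d'_def)
    qed
  next
    case False
    then have "x \<le> 1" by simp
    then show ?thesis
    proof (rule DERIV_nonpos_imp_nonincreasing)
      fix y assume "x \<le> y" "y \<le> 1"
      then show "\<exists>z. (d has_real_derivative z) (at y) \<and> z \<le> 0"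
        using assms by (intro exI[of _ "d' y"] conjI deriv)
          (auto simp: d'_def power3_eq_cube mult_nonneg_nonpos2 zero_le_mult_iff intro!: divide_nonpos_nonneg mult_nonneg_nonpos)
    qed
  qed
  moreover have "d 1 = 0" by (simp add: d_def)
  ultimately show ?thesis unfolding d_def by linarith
qed

text \<open>Homogeneity of degree two reduces the case of nonzero \<open>a\<close> to the ratio
  \<open>x = b / a\<close>.\<close>

lemma two_point_half:
  assumes "0 \<le> a" "0 \<le> b" "a \<noteq> 0 \<or> b \<noteq> 0" "N = (a\<^sup>2 + a * b + b\<^sup>2) / 3"
  shows "Phi (a\<^sup>2) - a\<^sup>2 * (ln N + 1) + N \<le> (a - b)\<^sup>2 / 2"
proof (cases "a = 0")
  case True
  then have "3 * N = b\<^sup>2" using assms by simp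
  then have "N \<le> b\<^sup>2 / 2" using zero_le_power2[of b] by linarith
  then show ?thesis using True by (simp add: Phi_def)
next
  case False
  then have a: "0 < a" using assms by simp
  define x where "x = b / a"
  have x: "0 \<le> x" "b = a * x" using a assms by (simp_all add: x_def)
  have p: "0 < (1 + x + x\<^sup>2) / 3" using x by (simp add: add_pos_nonneg)
  have N: "N = a\<^sup>2 * ((1 + x + x\<^sup>2) / 3)" unfolding assms(4) x(2) by (simp add: power2_eq_square algebra_simps)
  have "ln N = ln (a\<^sup>2) + ln ((1 + x + x\<^sup>2) / 3)" unfolding N using a p by (subst ln_mult_pos) auto
  then have "Phi (a\<^sup>2) - a\<^sup>2 * (ln N + 1) + N = a\<^sup>2 * ((1 + x + x\<^sup>2) / 3 - 1 - ln ((1 + x + x\<^sup>2) / 3))"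
    by (simp add: Phi_def N algebra_simps)
  also have "\<dots> \<le> a\<^sup>2 * ((1 - x)\<^sup>2 / 2)" by (intro mult_left_mono two_point_aux x) simp
  also have "\<dots> = (a - b)\<^sup>2 / 2" unfolding x(2) by (simp add: power2_eq_square algebra_simps)
  finally show ?thesis .
qed

text \<open>Bounding the entropy by the tangent of \<open>Phi\<close> at any \<open>N\<close> leaves
  a weighted average of two deficits. For a choice of \<open>N\<close> symmetric in the two points
  each deficit is at most \<open>(a - b)\<^sup>2 / 2\<close>, so the bound is uniform in the weights
  \<open>p\<close>, \<open>q\<close>.\<close>

lemma two_point_lsi:
  assumes "0 \<le> p" "0 \<le> q" "p + q = 1" "0 \<le> u" "0 \<le> v"
  shows "p * Phi u + q * Phi v - Phi (p * u + q * v) \<le> (sqrt u - sqrt v)\<^sup>2 / 2"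
proof (cases "u = 0 \<and> v = 0")
  case True then show ?thesis by (simp add: Phi_def)
next
  case False
  define a b N where "a = sqrt u" and "b = sqrt v" and "N = (a\<^sup>2 + a * b + b\<^sup>2) / 3"
  have ab: "0 \<le> a" "0 \<le> b" "a \<noteq> 0 \<or> b \<noteq> 0" "u = a\<^sup>2" "v = b\<^sup>2" using assms False by (auto simp: a_def b_def)
  have N: "0 < N"
  proof -
    have "0 < a\<^sup>2 + b\<^sup>2" using ab(3) by (simp add: sum_power2_gt_zero_iff)
    then have "0 < (a\<^sup>2 + b\<^sup>2) + a * b" by (rule add_pos_nonneg) (use ab in simp)
    then show ?thesis by (simp add: N_def)
  qed
  have "Phi u - u * (ln N + 1) + N \<le> (a - b)\<^sup>2 / 2"
    unfolding ab(4) by (rule two_point_half[OF ab(1-3) N_def])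
  moreover have "Phi v - v * (ln N + 1) + N \<le> (a - b)\<^sup>2 / 2"
  proof -
    have "b \<noteq> 0 \<or> a \<noteq> 0" "N = (b\<^sup>2 + b * a + a\<^sup>2) / 3" using ab(3) by (auto simp: N_def)
    from two_point_half[OF ab(2,1) this] show ?thesis unfolding ab(5) power2_commute[of a b] .
  qed
  ultimately have "p * (Phi u - u * (ln N + 1) + N) + q * (Phi v - v * (ln N + 1) + N) \<le> p * ((a - b)\<^sup>2 / 2) + q * ((a - b)\<^sup>2 / 2)"
    using assms by (intro add_mono mult_left_mono) auto
  also have "\<dots> = (a - b)\<^sup>2 / 2" using assms(3) by (metis distrib_right mult_1)
  finally have 1: "p * (Phi u - u * (ln N + 1) + N) + q * (Phi v - v * (ln N + 1) + N) \<le> (a - b)\<^sup>2 / 2" .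
  have "(p * u + q * v) * (ln N + 1) - N \<le> Phi (p * u + q * v)"
    using assms N by (intro Phi_ge_tangent) auto
  moreover have "p * N + q * N = N" using assms(3) by (metis distrib_right mult_1)
  ultimately show ?thesis using 1 unfolding a_def b_def by (simp add: algebra_simps)
qed

text \<open>The root of \<open>p * u + q * v\<close> is the Euclidean norm of the vector with
  entries \<open>sqrt (p * u)\<close> and \<open>sqrt (q * v)\<close>; this is the reverse triangle
  inequality.\<close>

lemma sqrt_average_contraction:
  assumes "0 \<le> p" "0 \<le> q" "0 \<le> u" "0 \<le> v" "0 \<le> u'" "0 \<le> v'"
  shows "(sqrt (p * u + q * v) - sqrt (p * u' + q * v'))\<^sup>2 \<le> p * (sqrt u - sqrt u')\<^sup>2 + q * (sqrt v - sqrt v')\<^sup>2"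
proof -
  define a b a' b' where "a = sqrt u" and "b = sqrt v" and "a' = sqrt u'" and "b' = sqrt v'"
  have e: "u = a\<^sup>2" "v = b\<^sup>2" "u' = a'\<^sup>2" "v' = b'\<^sup>2" and nn: "0 \<le> a" "0 \<le> b" "0 \<le> a'" "0 \<le> b'"
    using assms by (simp_all add: a_def b_def a'_def b'_def)
  define S S' where "S = p * u + q * v" and "S' = p * u' + q * v'"
  have S: "0 \<le> S" "0 \<le> S'" using assms by (simp_all add: S_def S'_def)
  have "p * (a * a') + q * (b * b') \<le> sqrt S * sqrt S'"
  proof -
    have "(p * (a * a') + q * (b * b'))\<^sup>2 \<le> S * S'"
    proof -
      have "S * S' - (p * (a * a') + q * (b * b'))\<^sup>2 = p * q * (a * b' - b * a')\<^sup>2"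
        unfolding S_def S'_def e by (simp add: power2_eq_square algebra_simps)
      moreover have "0 \<le> p * q * (a * b' - b * a')\<^sup>2" using assms by simp
      ultimately show ?thesis by linarith
    qed
    then show ?thesis unfolding real_sqrt_mult[symmetric] by (rule real_le_rsqrt)
  qed
  then have "S + S' - 2 * (sqrt S * sqrt S') \<le> p * (a - a')\<^sup>2 + q * (b - b')\<^sup>2"
    unfolding S_def S'_def e by (simp add: power2_eq_square algebra_simps)
  moreover have "(sqrt S - sqrt S')\<^sup>2 = S + S' - 2 * (sqrt S * sqrt S')"
    using S by (simp add: power2_diff)
  ultimately show ?thesis by (simp add: S_def S'_def a_def b_def a'_def b'_def)
qed

section \<open>Resampling single spins of the product measure\<close>

lemma flip_nth: "flip x \<sigma> $ y = (if y = x then - \<sigma> $ y else \<sigma> $ y)"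
  by (simp add: flip_def)

lemma flip_flip [simp]: "flip x (flip x \<sigma>) = \<sigma>"
  by (simp add: vec_eq_iff flip_nth)

lemma flip_commute: "flip x (flip y \<sigma>) = flip y (flip x \<sigma>)"
  by (simp add: vec_eq_iff flip_nth)

lemma flip_in_spins [simp]: "flip x \<sigma> \<in> spins \<longleftrightarrow> \<sigma> \<in> spins"
proof -
  have "flip x \<sigma> \<in> spins" if "\<sigma> \<in> spins" for \<sigma>
    using that by (auto simp: spins_def flip_nth)
  from this[of \<sigma>] this[of "flip x \<sigma>"] show ?thesis by auto
qed

lemma sum_spins_flip: "(\<Sum>\<sigma>\<in>spins. f (flip x \<sigma>)) = (\<Sum>\<sigma>\<in>spins. f \<sigma>)"
  by (rule sum.reindex_bij_witness[of _ "flip x" "flip x"]) auto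

lemma ising_weight_zero: "ising_weight A 0 h \<sigma> = exp (h \<bullet> \<sigma>)"
  by (simp add: ising_weight_def)

lemma inner_flip: "h \<bullet> flip x \<sigma> = h \<bullet> \<sigma> - 2 * (h $ x * \<sigma> $ x)"
proof -
  have "h \<bullet> flip x \<sigma> = (\<Sum>y\<in>UNIV. h $ y * \<sigma> $ y - (if y = x then 2 * (h $ x * \<sigma> $ x) else 0))"
    unfolding inner_vec_def by (intro sum.cong) (auto simp: flip_nth)
  then show ?thesis by (simp add: sum_subtractf inner_vec_def)
qed

text \<open>At inverse temperature 0 the spins are independent, and this is the probability that a
  fresh spin at \<open>x\<close> agrees with \<open>\<sigma> $ x\<close>. Accordingly
  \<open>resample\<close> is the conditional expectation given all other spins.\<close>

definition keep_prob :: "real^'n \<Rightarrow> 'n \<Rightarrow> real^'n::finite \<Rightarrow> real" where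
  "keep_prob h x \<sigma> = exp (h $ x * \<sigma> $ x) / (exp (h $ x * \<sigma> $ x) + exp (- (h $ x * \<sigma> $ x)))"

definition resample :: "real^'n \<Rightarrow> 'n \<Rightarrow> (real^'n \<Rightarrow> real) \<Rightarrow> real^'n::finite \<Rightarrow> real" where
  "resample h x G \<sigma> = keep_prob h x \<sigma> * G \<sigma> + keep_prob h x (flip x \<sigma>) * G (flip x \<sigma>)"

lemma keep_prob_pos: "0 < keep_prob h x \<sigma>"
  by (simp add: keep_prob_def add_pos_pos)

lemma keep_prob_sum: "keep_prob h x \<sigma> + keep_prob h x (flip x \<sigma>) = 1"
proof -
  have "0 < exp (h $ x * \<sigma> $ x) + exp (- (h $ x * \<sigma> $ x))" by (simp add: add_pos_pos)
  then show ?thesis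
    by (simp add: keep_prob_def flip_nth add_divide_distrib[symmetric] add.commute)
qed

lemma keep_prob_other: "y \<noteq> x \<Longrightarrow> keep_prob h x (flip y \<sigma>) = keep_prob h x \<sigma>"
  by (simp add: keep_prob_def flip_nth)

lemma resample_other:
  assumes "y \<noteq> x" shows "resample h x G (flip y \<sigma>) = resample h x (\<lambda>\<sigma>. G (flip y \<sigma>)) \<sigma>"
  using assms keep_prob_other[OF assms, of h] by (simp add: resample_def flip_commute[of x y])

lemma resample_self: "resample h x G (flip x \<sigma>) = resample h x G \<sigma>"
  by (simp add: resample_def)

lemma resample_nonneg: "(\<And>\<sigma>. 0 \<le> G \<sigma>) \<Longrightarrow> 0 \<le> resample h x G \<sigma>"
  by (simp add: resample_def keep_prob_pos less_imp_le)

text \<open>Detailed balance for the fresh spin at \<open>x\<close>, stated as \<open>bal\<close>,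
  moves the flipped term back to \<open>\<sigma>\<close>.\<close>

lemma ising_E_resample: "ising_E A 0 h (resample h x G) = ising_E A 0 h G"
proof -
  have bal: "keep_prob h x \<sigma> * exp (h \<bullet> flip x \<sigma>) = keep_prob h x (flip x \<sigma>) * exp (h \<bullet> \<sigma>)" for \<sigma>
  proof -
    have "exp (h $ x * \<sigma> $ x) * exp (h \<bullet> flip x \<sigma>) = exp (- (h $ x * \<sigma> $ x)) * exp (h \<bullet> \<sigma>)"
      unfolding inner_flip exp_add[symmetric] by simp
    then show ?thesis by (simp add: keep_prob_def flip_nth add.commute)
  qed
  have "(\<Sum>\<sigma>\<in>spins. keep_prob h x (flip x \<sigma>) * G (flip x \<sigma>) * exp (h \<bullet> \<sigma>))
      = (\<Sum>\<sigma>\<in>spins. keep_prob h x \<sigma> * G \<sigma> * exp (h \<bullet> flip x \<sigma>))"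
    using sum_spins_flip[of "\<lambda>\<sigma>. keep_prob h x \<sigma> * G \<sigma> * exp (h \<bullet> flip x \<sigma>)" x] by simp
  also have "\<dots> = (\<Sum>\<sigma>\<in>spins. keep_prob h x (flip x \<sigma>) * G \<sigma> * exp (h \<bullet> \<sigma>))"
    using bal by (intro sum.cong) (simp_all add: mult_ac)
  finally have "(\<Sum>\<sigma>\<in>spins. resample h x G \<sigma> * exp (h \<bullet> \<sigma>))
     = (\<Sum>\<sigma>\<in>spins. keep_prob h x \<sigma> * G \<sigma> * exp (h \<bullet> \<sigma>)) + (\<Sum>\<sigma>\<in>spins. keep_prob h x (flip x \<sigma>) * G \<sigma> * exp (h \<bullet> \<sigma>))"
    by (simp add: resample_def distrib_right sum.distrib)
  also have "\<dots> = (\<Sum>\<sigma>\<in>spins. (keep_prob h x \<sigma> + keep_prob h x (flip x \<sigma>)) * G \<sigma> * exp (h \<bullet> \<sigma>))"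
    by (simp add: distrib_right sum.distrib)
  finally show ?thesis by (simp add: ising_E_def ising_weight_zero keep_prob_sum)
qed

text \<open>\<open>H\<close> is \<open>G\<close> averaged successively over the spins in
  \<open>X\<close>, and the entropy telescopes. Each averaging costs at most the two-point bound,
  while \<open>sqrt_average_contraction\<close> keeps the differences at the remaining sites from
  growing. The clause on invariant sites \<open>y\<close> carries invariance at already averaged
  sites through the later steps.\<close>

lemma tensorisation:
  fixes G :: "real^'n::finite \<Rightarrow> real"
  assumes "finite X" "\<And>\<sigma>. 0 \<le> G \<sigma>"
  shows "\<exists>H. (\<forall>\<sigma>. 0 \<le> H \<sigma>) \<and> ising_E A 0 h H = ising_E A 0 h G \<and> (\<forall>x\<in>X. \<forall>\<sigma>. H (flip x \<sigma>) = H \<sigma>)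
     \<and> (\<forall>y. (\<forall>\<sigma>. G (flip y \<sigma>) = G \<sigma>) \<longrightarrow> (\<forall>\<sigma>. H (flip y \<sigma>) = H \<sigma>))
     \<and> ising_E A 0 h (\<lambda>\<sigma>. Phi (G \<sigma>)) - ising_E A 0 h (\<lambda>\<sigma>. Phi (H \<sigma>))
        \<le> (\<Sum>x\<in>X. ising_E A 0 h (\<lambda>\<sigma>. (sqrt (G \<sigma>) - sqrt (G (flip x \<sigma>)))\<^sup>2)) / 2"
  using assms
proof (induction X arbitrary: G rule: finite_induct)
  case empty then show ?case by (intro exI[of _ G]) auto
next
  case (insert x X)
  let ?E = "ising_E A 0 h" and ?G = "resample h x G"
  have G0: "0 \<le> ?G \<sigma>" for \<sigma> using resample_nonneg insert.prems by blast
  obtain H where H: "\<forall>\<sigma>. 0 \<le> H \<sigma>" "?E H = ?E ?G" "\<forall>x\<in>X. \<forall>\<sigma>. H (flip x \<sigma>) = H \<sigma>"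
    "\<And>y. (\<forall>\<sigma>. ?G (flip y \<sigma>) = ?G \<sigma>) \<Longrightarrow> (\<forall>\<sigma>. H (flip y \<sigma>) = H \<sigma>)"
    "?E (\<lambda>\<sigma>. Phi (?G \<sigma>)) - ?E (\<lambda>\<sigma>. Phi (H \<sigma>)) \<le> (\<Sum>y\<in>X. ?E (\<lambda>\<sigma>. (sqrt (?G \<sigma>) - sqrt (?G (flip y \<sigma>)))\<^sup>2)) / 2"
    using insert.IH[of ?G] G0 by blast
  have one: "?E (\<lambda>\<sigma>. Phi (G \<sigma>)) - ?E (\<lambda>\<sigma>. Phi (?G \<sigma>)) \<le> ?E (\<lambda>\<sigma>. (sqrt (G \<sigma>) - sqrt (G (flip x \<sigma>)))\<^sup>2) / 2"
  proof -
    have "?E (\<lambda>\<sigma>. Phi (G \<sigma>)) - ?E (\<lambda>\<sigma>. Phi (?G \<sigma>)) = ?E (\<lambda>\<sigma>. resample h x (\<lambda>\<sigma>. Phi (G \<sigma>)) \<sigma> - Phi (?G \<sigma>))"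
      unfolding ising_E_diff using ising_E_resample[of A h x "\<lambda>\<sigma>. Phi (G \<sigma>)"] by simp
    also have "\<dots> \<le> ?E (\<lambda>\<sigma>. (1 / 2) * (sqrt (G \<sigma>) - sqrt (G (flip x \<sigma>)))\<^sup>2)"
    proof (rule ising_E_mono)
      fix \<sigma>
      show "resample h x (\<lambda>\<sigma>. Phi (G \<sigma>)) \<sigma> - Phi (?G \<sigma>) \<le> (1 / 2) * (sqrt (G \<sigma>) - sqrt (G (flip x \<sigma>)))\<^sup>2"
        unfolding resample_def
        using two_point_lsi[OF less_imp_le[OF keep_prob_pos] less_imp_le[OF keep_prob_pos] keep_prob_sum insert.prems insert.prems]
        by simp
    qed
    finally show ?thesis unfolding ising_E_cmult by simp
  qed
  have two: "?E (\<lambda>\<sigma>. (sqrt (?G \<sigma>) - sqrt (?G (flip y \<sigma>)))\<^sup>2) \<le> ?E (\<lambda>\<sigma>. (sqrt (G \<sigma>) - sqrt (G (flip y \<sigma>)))\<^sup>2)"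
    if "y \<in> X" for y
  proof -
    have xy: "y \<noteq> x" using that insert.hyps by auto
    have "?E (\<lambda>\<sigma>. (sqrt (?G \<sigma>) - sqrt (?G (flip y \<sigma>)))\<^sup>2) \<le> ?E (resample h x (\<lambda>\<sigma>. (sqrt (G \<sigma>) - sqrt (G (flip y \<sigma>)))\<^sup>2))"
    proof (rule ising_E_mono)
      fix \<sigma>
      show "(sqrt (?G \<sigma>) - sqrt (?G (flip y \<sigma>)))\<^sup>2 \<le> resample h x (\<lambda>\<sigma>. (sqrt (G \<sigma>) - sqrt (G (flip y \<sigma>)))\<^sup>2) \<sigma>"
        unfolding resample_other[OF xy] unfolding resample_def
        by (rule sqrt_average_contraction) (simp_all add: insert.prems keep_prob_pos less_imp_le)
    qed
    then show ?thesis unfolding ising_E_resample .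
  qed
  have "?E (\<lambda>\<sigma>. Phi (G \<sigma>)) - ?E (\<lambda>\<sigma>. Phi (H \<sigma>)) \<le> (\<Sum>y\<in>insert x X. ?E (\<lambda>\<sigma>. (sqrt (G \<sigma>) - sqrt (G (flip y \<sigma>)))\<^sup>2)) / 2"
  proof -
    have "(\<Sum>y\<in>X. ?E (\<lambda>\<sigma>. (sqrt (?G \<sigma>) - sqrt (?G (flip y \<sigma>)))\<^sup>2)) \<le> (\<Sum>y\<in>X. ?E (\<lambda>\<sigma>. (sqrt (G \<sigma>) - sqrt (G (flip y \<sigma>)))\<^sup>2))"
      by (intro sum_mono two)
    then show ?thesis using one H(5) insert.hyps by simp
  qed
  moreover have "H (flip y \<sigma>) = H \<sigma>" if "y \<in> insert x X" for y \<sigma>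
    using that H(3) H(4)[of x] resample_self[of h x G] by auto
  moreover have "\<forall>\<sigma>. H (flip y \<sigma>) = H \<sigma>" if "\<forall>\<sigma>. G (flip y \<sigma>) = G \<sigma>" for y
  proof (cases "y = x")
    case True then show ?thesis using H(4)[of x] resample_self[of h x G] by simp
  next
    case False then show ?thesis using that by (intro H(4)) (simp add: resample_other)
  qed
  ultimately show ?case using H(1,2) by (intro exI[of _ H]) (simp add: ising_E_resample)
qed

lemma flip_invariant_const:
  assumes "\<And>x \<sigma>. H (flip x \<sigma>) = H \<sigma>" shows "H (config X) = H (config {})"
proof (induction X rule: finite_induct[OF finite])
  case (2 x X)
  have "config (insert x X) = flip x (config X)"
    using 2 by (auto simp: vec_eq_iff flip_nth spin_def)
  then show ?case using 2 assms by simp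
qed simp

theorem product_lsi:
  assumes "\<And>\<sigma>. 0 \<le> G \<sigma>"
  shows "entropy A 0 h G \<le> dirichlet A 0 h (\<lambda>\<sigma>. sqrt (G \<sigma>))"
proof -
  obtain H where H: "ising_E A 0 h H = ising_E A 0 h G" "\<And>x \<sigma>. H (flip x \<sigma>) = H \<sigma>"
    "ising_E A 0 h (\<lambda>\<sigma>. Phi (G \<sigma>)) - ising_E A 0 h (\<lambda>\<sigma>. Phi (H \<sigma>))
        \<le> (\<Sum>x\<in>UNIV. ising_E A 0 h (\<lambda>\<sigma>. (sqrt (G \<sigma>) - sqrt (G (flip x \<sigma>)))\<^sup>2)) / 2"
    using tensorisation[of UNIV G A h] assms by auto
  have const: "H \<sigma> = H (config {})" if "\<sigma> \<in> spins" for \<sigma>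
  proof -
    from that obtain X where "\<sigma> = config X" by (rule spins_configE)
    then show ?thesis using flip_invariant_const[of H X] H(2) by simp
  qed
  define c where "c = H (config {})"
  have "ising_E A 0 h H = ising_E A 0 h (\<lambda>_. c)"
    unfolding c_def by (rule ising_E_cong) (rule const)
  moreover have "ising_E A 0 h (\<lambda>\<sigma>. Phi (H \<sigma>)) = ising_E A 0 h (\<lambda>_. Phi c)"
    unfolding c_def by (rule ising_E_cong) (rule arg_cong[OF const])
  ultimately have "ising_E A 0 h (\<lambda>\<sigma>. Phi (H \<sigma>)) = Phi (ising_E A 0 h H)" by simp
  then show ?thesis using H(1,3) by (simp add: entropy_def dirichlet_def)
qed

lemma ising_E_Cauchy_Schwarz:
  "(ising_E A t h (\<lambda>\<sigma>. f \<sigma> * g \<sigma>))\<^sup>2 \<le> ising_E A t h (\<lambda>\<sigma>. (f \<sigma>)\<^sup>2) * ising_E A t h (\<lambda>\<sigma>. (g \<sigma>)\<^sup>2)"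
proof -
  let ?w = "\<lambda>\<sigma>. sqrt (ising_weight A t h \<sigma>)"
  have w: "?w \<sigma> * ?w \<sigma> = ising_weight A t h \<sigma>" for \<sigma> by (simp add: less_imp_le)
  have "(\<Sum>\<sigma>\<in>spins. (f \<sigma> * ?w \<sigma>) * (g \<sigma> * ?w \<sigma>))\<^sup>2 \<le> (\<Sum>\<sigma>\<in>spins. (f \<sigma> * ?w \<sigma>)\<^sup>2) * (\<Sum>\<sigma>\<in>spins. (g \<sigma> * ?w \<sigma>)\<^sup>2)"
    by (rule Cauchy_Schwarz_ineq_sum)
  moreover have "(f \<sigma> * ?w \<sigma>) * (g \<sigma> * ?w \<sigma>) = f \<sigma> * g \<sigma> * ising_weight A t h \<sigma>"
    "(f \<sigma> * ?w \<sigma>)\<^sup>2 = (f \<sigma>)\<^sup>2 * ising_weight A t h \<sigma>" "(g \<sigma> * ?w \<sigma>)\<^sup>2 = (g \<sigma>)\<^sup>2 * ising_weight A t h \<sigma>" for \<sigma>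
    using w[of \<sigma>] by (simp_all add: power2_eq_square mult_ac)
  ultimately show ?thesis
    unfolding ising_E_def power_divide
    by (simp add: power2_eq_square[of "ising_Z A t h"] divide_right_mono less_imp_le)
qed

text \<open>Averaging over the spin at \<open>x\<close> turns the centred spin into a difference of
  \<open>F\<close> across the flip, with factor \<open>2 * \<sigma> $ x * p * q\<close>. This
  difference factors through square roots, and Cauchy-Schwarz separates the factors. With
  \<open>p + q = 1\<close>, the bound \<open>4 * p * q \<le> 1\<close> and the square
  \<open>(p * a - q * b)\<^sup>2\<close> show that the factor with the sum of roots contributes at
  most the mean of \<open>F\<close>.\<close>

theorem product_gradient_bound:
  assumes "\<And>\<sigma>. 0 \<le> F \<sigma>"
  shows "(ising_cov A 0 h F (\<lambda>\<sigma>. \<sigma> $ x))\<^sup>2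
     \<le> ising_E A 0 h F * ising_E A 0 h (\<lambda>\<sigma>. (sqrt (F \<sigma>) - sqrt (F (flip x \<sigma>)))\<^sup>2)"
proof -
  let ?E = "ising_E A 0 h" and ?p = "keep_prob h x" and ?q = "\<lambda>\<sigma>. keep_prob h x (flip x \<sigma>)"
  have tq: "\<sigma> $ x - tanh (h $ x) = 2 * \<sigma> $ x * ?q \<sigma>" "- \<sigma> $ x - tanh (h $ x) = - (2 * \<sigma> $ x * ?p \<sigma>)" if "\<sigma> \<in> spins" for \<sigma>
  proof -
    have nz: "exp r + exp (- r) \<noteq> 0" for r :: real using exp_gt_zero[of r] exp_gt_zero[of "- r"] by linarith
    have t: "1 - tanh r = 2 * (exp (- r) / (exp r + exp (- r)))" "1 + tanh r = 2 * (exp r / (exp r + exp (- r)))" for r :: real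
      using nz[of r] by (simp_all add: tanh_altdef field_simps)
    have "\<sigma> $ x = 1 \<or> \<sigma> $ x = -1" using that by (simp add: spins_def)
    then show "\<sigma> $ x - tanh (h $ x) = 2 * \<sigma> $ x * ?q \<sigma>" "- \<sigma> $ x - tanh (h $ x) = - (2 * \<sigma> $ x * ?p \<sigma>)"
      using t[of "h $ x"] by (auto simp: keep_prob_def flip_nth add.commute)
  qed
  have key: "?E (\<lambda>\<sigma>. G \<sigma> * (\<sigma> $ x - tanh (h $ x))) = ?E (\<lambda>\<sigma>. 2 * \<sigma> $ x * ?p \<sigma> * ?q \<sigma> * (G \<sigma> - G (flip x \<sigma>)))" for G
  proof -
    have "?E (\<lambda>\<sigma>. G \<sigma> * (\<sigma> $ x - tanh (h $ x))) = ?E (resample h x (\<lambda>\<sigma>. G \<sigma> * (\<sigma> $ x - tanh (h $ x))))"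
      by (simp add: ising_E_resample)
    also have "\<dots> = ?E (\<lambda>\<sigma>. 2 * \<sigma> $ x * ?p \<sigma> * ?q \<sigma> * (G \<sigma> - G (flip x \<sigma>)))"
    proof (rule ising_E_cong)
      fix \<sigma> :: "real^'a" assume "\<sigma> \<in> spins"
      then show "resample h x (\<lambda>\<sigma>. G \<sigma> * (\<sigma> $ x - tanh (h $ x))) \<sigma> = 2 * \<sigma> $ x * ?p \<sigma> * ?q \<sigma> * (G \<sigma> - G (flip x \<sigma>))"
        by (simp add: resample_def flip_nth tq) (simp add: algebra_simps)
    qed
    finally show ?thesis .
  qed
  have "?E (\<lambda>\<sigma>. \<sigma> $ x - tanh (h $ x)) = 0" using key[of "\<lambda>_. 1"] by simp
  then have mean: "?E (\<lambda>\<sigma>. \<sigma> $ x) = tanh (h $ x)" by (simp add: ising_E_diff)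
  have "ising_cov A 0 h F (\<lambda>\<sigma>. \<sigma> $ x) = ?E (\<lambda>\<sigma>. F \<sigma> * (\<sigma> $ x - tanh (h $ x)))"
    unfolding ising_cov_def mean by (simp add: right_diff_distrib ising_E_diff mult.commute[of _ "tanh (h $ x)"] ising_E_cmult)
  also have "\<dots> = ?E (\<lambda>\<sigma>. (sqrt (F \<sigma>) - sqrt (F (flip x \<sigma>))) * (2 * \<sigma> $ x * ?p \<sigma> * ?q \<sigma> * (sqrt (F \<sigma>) + sqrt (F (flip x \<sigma>)))))"
    unfolding key
  proof (rule ising_E_cong)
    fix \<sigma> :: "real^'a"
    have "F \<sigma> - F (flip x \<sigma>) = (sqrt (F \<sigma>) - sqrt (F (flip x \<sigma>))) * (sqrt (F \<sigma>) + sqrt (F (flip x \<sigma>)))"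
      using assms by (simp add: algebra_simps)
    then show "2 * \<sigma> $ x * ?p \<sigma> * ?q \<sigma> * (F \<sigma> - F (flip x \<sigma>))
      = (sqrt (F \<sigma>) - sqrt (F (flip x \<sigma>))) * (2 * \<sigma> $ x * ?p \<sigma> * ?q \<sigma> * (sqrt (F \<sigma>) + sqrt (F (flip x \<sigma>))))"
      by (simp only: mult_ac)
  qed
  finally have cs: "(ising_cov A 0 h F (\<lambda>\<sigma>. \<sigma> $ x))\<^sup>2 \<le> ?E (\<lambda>\<sigma>. (sqrt (F \<sigma>) - sqrt (F (flip x \<sigma>)))\<^sup>2) * ?E (\<lambda>\<sigma>. (2 * \<sigma> $ x * ?p \<sigma> * ?q \<sigma> * (sqrt (F \<sigma>) + sqrt (F (flip x \<sigma>))))\<^sup>2)"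
    using ising_E_Cauchy_Schwarz by simp
  have "?E (\<lambda>\<sigma>. (2 * \<sigma> $ x * ?p \<sigma> * ?q \<sigma> * (sqrt (F \<sigma>) + sqrt (F (flip x \<sigma>))))\<^sup>2) \<le> ?E (resample h x F)"
  proof (rule ising_E_mono)
    fix \<sigma> :: "real^'a" assume \<sigma>: "\<sigma> \<in> spins"
    define p q a b where "p = ?p \<sigma>" and "q = ?q \<sigma>" and "a = sqrt (F \<sigma>)" and "b = sqrt (F (flip x \<sigma>))"
    have pq: "0 < p" "0 < q" "p + q = 1" using keep_prob_pos keep_prob_sum by (simp_all add: p_def q_def)
    have ab: "F \<sigma> = a\<^sup>2" "F (flip x \<sigma>) = b\<^sup>2" using assms by (simp_all add: a_def b_def)
    have "4 * (p * q) \<le> (p + q)\<^sup>2" using zero_le_power2[of "p - q"] by (simp add: power2_eq_square algebra_simps)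
    then have pq4: "4 * (p * q) \<le> 1" using pq by simp
    have "p * q * (a + b)\<^sup>2 \<le> p * a\<^sup>2 + q * b\<^sup>2"
    proof -
      have "(p * a\<^sup>2 + q * b\<^sup>2) * (p + q) - p * q * (a + b)\<^sup>2 = (p * a - q * b)\<^sup>2"
        by (simp add: power2_eq_square algebra_simps)
      then have "(p * a\<^sup>2 + q * b\<^sup>2) - p * q * (a + b)\<^sup>2 = (p * a - q * b)\<^sup>2" using pq by simp
      then show ?thesis using zero_le_power2[of "p * a - q * b"] by linarith
    qed
    then have "4 * (p * q) * (p * q * (a + b)\<^sup>2) \<le> 1 * (p * a\<^sup>2 + q * b\<^sup>2)"
      using pq pq4 by (intro mult_mono) auto
    then have "4 * (p * q) * (p * q * (a + b)\<^sup>2) * (\<sigma> $ x * \<sigma> $ x) \<le> p * a\<^sup>2 + q * b\<^sup>2"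
      unfolding spins_nth(1)[OF \<sigma>] by simp
    moreover have "(2 * \<sigma> $ x * p * q * (a + b))\<^sup>2 = 4 * (p * q) * (p * q * (a + b)\<^sup>2) * (\<sigma> $ x * \<sigma> $ x)"
      by (simp add: power_mult_distrib) (simp add: power2_eq_square mult_ac)
    moreover have "resample h x F \<sigma> = p * a\<^sup>2 + q * b\<^sup>2" unfolding resample_def ab p_def q_def ..
    ultimately show "(2 * \<sigma> $ x * ?p \<sigma> * ?q \<sigma> * (sqrt (F \<sigma>) + sqrt (F (flip x \<sigma>))))\<^sup>2 \<le> resample h x F \<sigma>"
      unfolding p_def[symmetric] q_def[symmetric] a_def[symmetric] b_def[symmetric] by linarith
  qed
  then have le: "?E (\<lambda>\<sigma>. (2 * \<sigma> $ x * ?p \<sigma> * ?q \<sigma> * (sqrt (F \<sigma>) + sqrt (F (flip x \<sigma>))))\<^sup>2) \<le> ?E F"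
    by (simp only: ising_E_resample)
  have "0 \<le> ?E (\<lambda>\<sigma>. (sqrt (F \<sigma>) - sqrt (F (flip x \<sigma>)))\<^sup>2)"
    using ising_E_mono[of "\<lambda>_. 0" "\<lambda>\<sigma>. (sqrt (F \<sigma>) - sqrt (F (flip x \<sigma>)))\<^sup>2" A 0 h] by simp
  from order_trans[OF cs mult_left_mono[OF le this]] show ?thesis by (simp only: mult.commute)
qed

section \<open>A parabolic maximum principle\<close>

lemma deriv_along_line:
  fixes f :: "real^'n::finite \<Rightarrow> real"
  assumes "\<And>h. ((\<lambda>s. f (h + s *\<^sub>R v)) has_real_derivative g h) (at 0)"
  shows "((\<lambda>s. f (h + s *\<^sub>R v)) has_real_derivative g (h + s *\<^sub>R v)) (at s)"
proof -
  have "((\<lambda>r. f (h + s *\<^sub>R v + (r + - s) *\<^sub>R v)) has_real_derivative g (h + s *\<^sub>R v)) (at s)"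
    using DERIV_shift[of "\<lambda>r. f (h + s *\<^sub>R v + r *\<^sub>R v)" "g (h + s *\<^sub>R v)" s "- s"] assms[of "h + s *\<^sub>R v"] by simp
  then show ?thesis by (simp add: algebra_simps)
qed

text \<open>A smooth substitute for the norm: it grows linearly, while its first derivatives and the
  upper bounds on its second derivatives along a fixed vector stay bounded.\<close>

definition barrier :: "real^'n::finite \<Rightarrow> real" where
  "barrier h = sqrt (1 + h \<bullet> h)"

lemma barrier_pos: "0 < 1 + h \<bullet> h" "1 \<le> barrier h" "0 < barrier h" "norm h \<le> barrier h"
proof -
  show 1: "0 < 1 + h \<bullet> h" by (simp add: add_pos_nonneg)
  show 2: "1 \<le> barrier h" by (simp add: barrier_def)
  then show "0 < barrier h" by simp
  show "norm h \<le> barrier h" unfolding barrier_def norm_eq_sqrt_inner by (rule real_sqrt_le_mono) simp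
qed

lemma barrier_deriv:
  "((\<lambda>s. barrier (h + s *\<^sub>R v)) has_real_derivative (h \<bullet> v) / barrier h) (at 0)"
  "((\<lambda>s. ((h + s *\<^sub>R v) \<bullet> v) / barrier (h + s *\<^sub>R v)) has_real_derivative
     ((v \<bullet> v) / barrier h - (h \<bullet> v)\<^sup>2 / barrier h ^ 3)) (at 0)"
proof -
  have e: "1 + (h + s *\<^sub>R v) \<bullet> (h + s *\<^sub>R v) = 1 + h \<bullet> h + 2 * s * (h \<bullet> v) + s\<^sup>2 * (v \<bullet> v)" for s
    by (simp add: inner_add inner_commute power2_eq_square algebra_simps)
  show 1: "((\<lambda>s. barrier (h + s *\<^sub>R v)) has_real_derivative (h \<bullet> v) / barrier h) (at 0)"
    unfolding barrier_def e using barrier_pos(1)[of h]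
    by (auto intro!: derivative_eq_intros simp: field_simps)
  have "((\<lambda>s. ((h + s *\<^sub>R v) \<bullet> v)) has_real_derivative v \<bullet> v) (at 0)"
    by (auto intro!: derivative_eq_intros simp: inner_add_left)
  from DERIV_divide[OF this 1] barrier_pos(3)[of h]
  show "((\<lambda>s. ((h + s *\<^sub>R v) \<bullet> v) / barrier (h + s *\<^sub>R v)) has_real_derivative
     ((v \<bullet> v) / barrier h - (h \<bullet> v)\<^sup>2 / barrier h ^ 3)) (at 0)"
    by (simp add: divide_simps power2_eq_square power3_eq_cube algebra_simps)
qed

text \<open>The field ranges over a noncompact space, so a positive value of \<open>w\<close> need
  not come with an attained maximum. Subtracting \<open>\<epsilon> * (barrier h + K * t)\<close>
  forces one, since \<open>w\<close> is bounded above; by \<open>init\<close> it lies at a positive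
  time. There the space and time conditions contradict \<open>ineq\<close>.\<close>

theorem parabolic_maximum_principle:
  fixes w :: "real \<Rightarrow> real^'n \<Rightarrow> real" and b :: "'k::finite \<Rightarrow> real^'n::finite"
    and g e c :: "'k \<Rightarrow> real \<Rightarrow> real^'n \<Rightarrow> real"
  assumes cont: "continuous_on ({0..T} \<times> UNIV) (\<lambda>(t, h). w t h)"
    and bdd: "\<And>t h. t \<in> {0..T} \<Longrightarrow> w t h \<le> M"
    and init: "\<And>h. w 0 h \<le> 0"
    and D1: "\<And>k t h. ((\<lambda>s. w t (h + s *\<^sub>R b k)) has_real_derivative g k t h) (at 0)"
    and D2: "\<And>k t h. ((\<lambda>s. g k t (h + s *\<^sub>R b k)) has_real_derivative e k t h) (at 0)"
    and Dt: "\<And>t h. t \<in> {0..T} \<Longrightarrow> ((\<lambda>s. w s h) has_real_derivative d t h) (at t within {0..T})"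
    and ineq: "\<And>t h. t \<in> {0..T} \<Longrightarrow> d t h \<le> (\<Sum>k\<in>UNIV. e k t h) / 2 + (\<Sum>k\<in>UNIV. c k t h * g k t h)"
    and drift: "\<And>k t h. t \<in> {0..T} \<Longrightarrow> \<bar>c k t h\<bar> \<le> C"
    and t: "t \<in> {0..T}"
  shows "w t h \<le> 0"
proof (rule ccontr)
  assume "\<not> w t h \<le> 0"
  then have pos: "0 < w t h" by simp
  have C: "0 \<le> C" using drift[OF t] by (meson abs_ge_zero order_trans)
  \<comment> \<open>The first two terms dominate the diffusion and the drift of the barrier; the
    final 1 makes the contradiction strict.\<close>
  define K where "K = (\<Sum>k\<in>UNIV. (b k \<bullet> b k)) / 2 + (\<Sum>k\<in>UNIV. C * norm (b k)) + 1"
  have K: "0 < K" using C by (auto simp: K_def intro!: add_nonneg_pos add_nonneg_nonneg sum_nonneg)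
  \<comment> \<open>Chosen so that the penalty at \<open>(t, h)\<close> is exactly half of
    \<open>w t h\<close>.\<close>
  define \<epsilon> where "\<epsilon> = w t h / (2 * (barrier h + K * t))"
  have den: "0 < barrier h + K * t" using barrier_pos(3)[of h] K t by (simp add: add_pos_nonneg)
  have eps: "0 < \<epsilon>" using pos den by (simp add: \<epsilon>_def)
  define W where "W = (\<lambda>t h. w t h - \<epsilon> * (barrier h + K * t))"
  have half: "x / (2 * y) * y = x / 2" if "0 < y" for x y :: real using that by simp
  have Wpos: "0 < W t h" unfolding W_def \<epsilon>_def half[OF den] using pos by simp
  define R where "R = norm h + \<bar>M\<bar> / \<epsilon> + 1"
  have far: "W t' h' < 0" if "t' \<in> {0..T}" "R < norm h'" for t' h'
  proof -
    have "\<bar>M\<bar> < \<epsilon> * norm h'"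
      using that(2) eps by (simp add: R_def field_simps) (smt (verit) mult_nonneg_nonneg norm_ge_zero)
    also have "\<dots> \<le> \<epsilon> * (barrier h' + K * t')"
      using barrier_pos(4)[of h'] eps K that(1) by (intro mult_left_mono) (auto intro: add_increasing2)
    finally show ?thesis using bdd[OF that(1), of h'] by (simp add: W_def)
  qed
  have "continuous_on ({0..T} \<times> cball 0 R) (\<lambda>(t, h). W t h)"
  proof -
    have "continuous_on ({0..T} \<times> cball 0 R) (\<lambda>(t, h). w t h)" by (rule continuous_on_subset[OF cont]) auto
    then show ?thesis unfolding W_def barrier_def case_prod_beta by (intro continuous_intros)
  qed
  moreover have "compact ({0..T} \<times> cball (0::real^'n) R)" by (intro compact_Times) auto
  moreover have th: "(t, h) \<in> {0..T} \<times> cball 0 R" using t eps by (auto simp: R_def intro!: add_nonneg_nonneg)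
  ultimately obtain z where z: "z \<in> {0..T} \<times> cball 0 R"
    and zmax: "\<And>y. y \<in> {0..T} \<times> cball 0 R \<Longrightarrow> (\<lambda>(t, h). W t h) y \<le> (\<lambda>(t, h). W t h) z"
    using continuous_attains_sup[of "{0..T} \<times> cball (0::real^'n) R" "\<lambda>(t, h). W t h"] by (metis empty_iff)
  obtain t0 h0 where z0: "z = (t0, h0)" by force
  have t0: "t0 \<in> {0..T}" using z z0 by auto
  have W0: "0 < W t0 h0" using zmax[OF th] Wpos by (simp add: z0)
  have max: "W t' h' \<le> W t0 h0" if "t' \<in> {0..T}" for t' h'
  proof (cases "norm h' \<le> R")
    case True then show ?thesis using zmax[of "(t', h')"] that by (simp add: z0)
  next
    case False then show ?thesis using far[OF that, of h'] W0 by simp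
  qed
  have t0pos: "0 < t0"
  proof (rule ccontr)
    assume "\<not> 0 < t0"
    then have "t0 = 0" using t0 by simp
    moreover have "0 \<le> \<epsilon> * barrier h0" using eps barrier_pos(3)[of h0] by simp
    ultimately have "W t0 h0 \<le> 0" using init[of h0] by (simp add: W_def)
    then show False using W0 by simp
  qed
  have space: "g k t0 h0 = \<epsilon> * ((h0 \<bullet> b k) / barrier h0)" "e k t0 h0 \<le> \<epsilon> * (b k \<bullet> b k)" for k
  proof -
    define f where "f = (\<lambda>s. W t0 (h0 + s *\<^sub>R b k))"
    define f' where "f' = (\<lambda>s. g k t0 (h0 + s *\<^sub>R b k) - \<epsilon> * (((h0 + s *\<^sub>R b k) \<bullet> b k) / barrier (h0 + s *\<^sub>R b k)))"
    have d1: "(f has_real_derivative f' s) (at s)" for s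
    proof -
      have "((\<lambda>s. w t0 (h0 + s *\<^sub>R b k)) has_real_derivative g k t0 (h0 + s *\<^sub>R b k)) (at s)"
        by (rule deriv_along_line) (rule D1)
      moreover have "((\<lambda>s. barrier (h0 + s *\<^sub>R b k)) has_real_derivative ((h0 + s *\<^sub>R b k) \<bullet> b k) / barrier (h0 + s *\<^sub>R b k)) (at s)"
        by (rule deriv_along_line) (rule barrier_deriv)
      ultimately show ?thesis unfolding f_def f'_def W_def
        by (auto intro!: derivative_eq_intros)
    qed
    have d2: "(f' has_real_derivative (e k t0 h0 - \<epsilon> * ((b k \<bullet> b k) / barrier h0 - (h0 \<bullet> b k)\<^sup>2 / barrier h0 ^ 3))) (at 0)"
      unfolding f'_def by (rule DERIV_diff[OF D2 DERIV_cmult[OF barrier_deriv(2)]])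
    have "f s \<le> f 0" for s using max[OF t0] by (simp add: f_def)
    then have "f' 0 = 0" "e k t0 h0 - \<epsilon> * ((b k \<bullet> b k) / barrier h0 - (h0 \<bullet> b k)\<^sup>2 / barrier h0 ^ 3) \<le> 0"
      using second_derivative_at_max[OF d1 d2, of 1] by auto
    moreover have "(b k \<bullet> b k) / barrier h0 - (h0 \<bullet> b k)\<^sup>2 / barrier h0 ^ 3 \<le> b k \<bullet> b k"
    proof -
      have "(b k \<bullet> b k) / barrier h0 \<le> (b k \<bullet> b k) / 1"
        using barrier_pos[of h0] by (intro divide_left_mono) auto
      moreover have "0 \<le> (h0 \<bullet> b k)\<^sup>2 / barrier h0 ^ 3" using barrier_pos[of h0] by simp
      ultimately show ?thesis by simp
    qed
    then have "\<epsilon> * ((b k \<bullet> b k) / barrier h0 - (h0 \<bullet> b k)\<^sup>2 / barrier h0 ^ 3) \<le> \<epsilon> * (b k \<bullet> b k)"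
      using eps by (intro mult_left_mono) auto
    ultimately show "g k t0 h0 = \<epsilon> * ((h0 \<bullet> b k) / barrier h0)" "e k t0 h0 \<le> \<epsilon> * (b k \<bullet> b k)"
      by (simp_all add: f'_def)
  qed
  \<comment> \<open>The maximum may sit at the final time, so only earlier times are
    compared.\<close>
  have time: "\<epsilon> * K \<le> d t0 h0"
  proof (rule ccontr)
    assume "\<not> \<epsilon> * K \<le> d t0 h0"
    moreover have "((\<lambda>s. W s h0) has_real_derivative d t0 h0 - \<epsilon> * K) (at t0 within {0..T})"
      unfolding W_def by (auto intro!: derivative_eq_intros Dt t0)
    ultimately obtain r where r: "0 < r" "\<And>s. 0 < s \<Longrightarrow> t0 - s \<in> {0..T} \<Longrightarrow> s < r \<Longrightarrow> W t0 h0 < W (t0 - s) h0"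
      using has_real_derivative_neg_dec_left[of "\<lambda>s. W s h0" "d t0 h0 - \<epsilon> * K" t0 "{0..T}"] by auto
    define s where "s = min r t0 / 2"
    have "0 < s" "s < r" "t0 - s \<in> {0..T}" using r(1) t0pos t0 by (auto simp: s_def)
    then show False using r(2)[of s] max[of "t0 - s" h0] by simp
  qed
  have "c k t0 h0 * g k t0 h0 \<le> \<epsilon> * (C * norm (b k))" for k
  proof -
    have "\<bar>h0 \<bullet> b k\<bar> / barrier h0 \<le> norm (b k)"
    proof -
      have "\<bar>h0 \<bullet> b k\<bar> \<le> norm h0 * norm (b k)" by (rule Cauchy_Schwarz_ineq2)
      also have "\<dots> \<le> barrier h0 * norm (b k)" using barrier_pos(4)[of h0] by (intro mult_right_mono) auto
      finally show ?thesis using barrier_pos(3)[of h0] by (simp add: divide_le_eq mult.commute)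
    qed
    then have "\<bar>c k t0 h0\<bar> * (\<bar>h0 \<bullet> b k\<bar> / barrier h0) \<le> C * norm (b k)"
      using drift[OF t0] C barrier_pos(3)[of h0] by (intro mult_mono) auto
    moreover have "\<bar>c k t0 h0 * ((h0 \<bullet> b k) / barrier h0)\<bar> = \<bar>c k t0 h0\<bar> * (\<bar>h0 \<bullet> b k\<bar> / barrier h0)"
      using barrier_pos(3)[of h0] by (simp add: abs_mult)
    ultimately have "c k t0 h0 * ((h0 \<bullet> b k) / barrier h0) \<le> C * norm (b k)" by linarith
    then have "\<epsilon> * (c k t0 h0 * ((h0 \<bullet> b k) / barrier h0)) \<le> \<epsilon> * (C * norm (b k))"
      using eps by (intro mult_left_mono) auto
    then show ?thesis unfolding space by (simp add: mult_ac)
  qed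
  then have "(\<Sum>k\<in>UNIV. c k t0 h0 * g k t0 h0) \<le> (\<Sum>k\<in>UNIV. \<epsilon> * (C * norm (b k)))" by (rule sum_mono)
  moreover have "(\<Sum>k\<in>UNIV. e k t0 h0) \<le> (\<Sum>k\<in>UNIV. \<epsilon> * (b k \<bullet> b k))" by (rule sum_mono) (rule space)
  ultimately have "d t0 h0 \<le> \<epsilon> * (K - 1)"
    using ineq[OF t0, of h0] by (simp add: K_def sum_distrib_left[symmetric] algebra_simps)
  then show False using time eps by (simp add: algebra_simps)
qed

section \<open>Evolution in the inverse temperature\<close>

text \<open>The bound is uniform in temperature and field; it supplies the bounded drift and the a
  priori bounds required by the maximum principle.\<close>

lemma ising_E_abs_le: "\<bar>ising_E A t h f\<bar> \<le> (\<Sum>\<sigma>\<in>spins. \<bar>f \<sigma>\<bar>)"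
proof -
  have "\<bar>\<Sum>\<sigma>\<in>spins. f \<sigma> * ising_weight A t h \<sigma>\<bar> \<le> (\<Sum>\<sigma>\<in>spins. \<bar>f \<sigma>\<bar> * ising_Z A t h)"
  proof (rule order_trans[OF sum_abs], rule sum_mono)
    fix \<sigma> :: "real^'a" assume "\<sigma> \<in> spins"
    then have "ising_weight A t h \<sigma> \<le> ising_Z A t h"
      unfolding ising_Z_def by (intro member_le_sum) (auto intro: less_imp_le)
    then show "\<bar>f \<sigma> * ising_weight A t h \<sigma>\<bar> \<le> \<bar>f \<sigma>\<bar> * ising_Z A t h"
      by (simp add: abs_mult mult_left_mono less_imp_le)
  qed
  then have "\<bar>\<Sum>\<sigma>\<in>spins. f \<sigma> * ising_weight A t h \<sigma>\<bar> \<le> (\<Sum>\<sigma>\<in>spins. \<bar>f \<sigma>\<bar>) * ising_Z A t h"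
    by (simp add: sum_distrib_right)
  then show ?thesis
    unfolding ising_E_def using ising_Z_pos[of A t h] by (simp add: abs_of_pos divide_le_eq)
qed

lemma continuous_on_ising_E:
  assumes "continuous_on S f" "continuous_on S k"
  shows "continuous_on S (\<lambda>x. ising_E A (f x) (k x) F)"
proof -
  have "ising_Z A (f x) (k x) \<noteq> 0" for x using ising_Z_pos[of A "f x" "k x"] by linarith
  moreover have "continuous_on S (\<lambda>x. ising_weight A (f x) (k x) \<sigma>)" for \<sigma>
    unfolding ising_weight_def by (intro continuous_intros assms) auto
  ultimately show ?thesis unfolding ising_E_def ising_Z_def
    by (intro continuous_on_divide continuous_on_sum continuous_on_mult continuous_on_const) auto
qed

lemma quotient_derivative_rearranged:
  fixes z :: real
  assumes "z \<noteq> 0"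
  shows "(a' * z - a * z') / (z * z) = a' / z - a / z * (z' / z)"
  using assms by (simp add: field_simps)

lemma ising_E_field_deriv:
  "((\<lambda>s. ising_E A t (h + s *\<^sub>R v) f) has_real_derivative ising_cov A t h f (\<lambda>\<sigma>. v \<bullet> \<sigma>)) (at 0)"
proof -
  have w: "((\<lambda>s. ising_weight A t (h + s *\<^sub>R v) \<sigma>) has_real_derivative (v \<bullet> \<sigma>) * ising_weight A t h \<sigma>) (at 0)" for \<sigma>
    unfolding ising_weight_def inner_add_left inner_scaleR_left
    by (auto intro!: derivative_eq_intros)
  have N: "((\<lambda>s. \<Sum>\<sigma>\<in>spins. f \<sigma> * ising_weight A t (h + s *\<^sub>R v) \<sigma>) has_real_derivative
      (\<Sum>\<sigma>\<in>spins. f \<sigma> * ((v \<bullet> \<sigma>) * ising_weight A t h \<sigma>))) (at 0)" for f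
    by (intro DERIV_sum DERIV_cmult w)
  have Z: "((\<lambda>s. ising_Z A t (h + s *\<^sub>R v)) has_real_derivative (\<Sum>\<sigma>\<in>spins. (v \<bullet> \<sigma>) * ising_weight A t h \<sigma>)) (at 0)"
    unfolding ising_Z_def using N[of "\<lambda>_. 1"] by simp
  have nz: "ising_Z A t (h + 0 *\<^sub>R v) \<noteq> 0" using less_imp_neq[OF ising_Z_pos, of A t "h + 0 *\<^sub>R v"] by (rule not_sym)
  show ?thesis
    unfolding ising_cov_def ising_E_def
    by (rule DERIV_cong[OF DERIV_divide[OF N[of f] Z nz]])
      (use quotient_derivative_rearranged[OF nz] in \<open>simp add: mult.assoc\<close>)
qed

lemma ising_E_time_deriv:
  "((\<lambda>s. ising_E A s h f) has_real_derivative - ising_cov A t h f (\<lambda>\<sigma>. \<sigma> \<bullet> (A *v \<sigma>)) / 2) (at t within S)"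
proof -
  let ?q = "\<lambda>\<sigma>. - (\<sigma> \<bullet> (A *v \<sigma>)) / 2"
  have w: "((\<lambda>s. ising_weight A s h \<sigma>) has_real_derivative ?q \<sigma> * ising_weight A t h \<sigma>) (at t within S)" for \<sigma>
    unfolding ising_weight_def by (auto intro!: derivative_eq_intros)
  have N: "((\<lambda>s. \<Sum>\<sigma>\<in>spins. f \<sigma> * ising_weight A s h \<sigma>) has_real_derivative
      (\<Sum>\<sigma>\<in>spins. f \<sigma> * (?q \<sigma> * ising_weight A t h \<sigma>))) (at t within S)" for f
    by (intro DERIV_sum DERIV_cmult w)
  have Z: "((\<lambda>s. ising_Z A s h) has_real_derivative (\<Sum>\<sigma>\<in>spins. ?q \<sigma> * ising_weight A t h \<sigma>)) (at t within S)"
    unfolding ising_Z_def using N[of "\<lambda>_. 1"] by simp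
  have nz: "ising_Z A t h \<noteq> 0" using ising_Z_pos[of A t h] by linarith
  have "((\<lambda>s. ising_E A s h f) has_real_derivative ising_cov A t h f ?q) (at t within S)"
    unfolding ising_cov_def ising_E_def
    by (rule DERIV_cong[OF DERIV_divide[OF N[of f] Z nz]])
      (use quotient_derivative_rearranged[OF nz] in \<open>simp add: mult.assoc\<close>)
  moreover have "ising_cov A t h f ?q = - ising_cov A t h f (\<lambda>\<sigma>. \<sigma> \<bullet> (A *v \<sigma>)) / 2"
  proof -
    have "ising_E A t h ?q = - (1 / 2) * ising_E A t h (\<lambda>\<sigma>. \<sigma> \<bullet> (A *v \<sigma>))"
      "ising_E A t h (\<lambda>\<sigma>. f \<sigma> * ?q \<sigma>) = - (1 / 2) * ising_E A t h (\<lambda>\<sigma>. f \<sigma> * (\<sigma> \<bullet> (A *v \<sigma>)))"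
      unfolding ising_E_cmult[symmetric] by (simp_all add: ising_E_def)
    then show ?thesis by (simp add: ising_cov_def algebra_simps)
  qed
  ultimately show ?thesis by simp
qed

lemma product_rule_rearranged:
  "(a / 2 + b + p) * w' + (a' / 2 + b' + p') * w
    = (a * w' + a' * w + 2 * c) / 2 + (b * w' + b' * w) + (w * p' + p * w' - c)"
  for a b p w :: real
  by (simp add: field_simps)

lemma chain_rule_rearranged:
  "y * (a / 2 + b + p) = (z * c + y * a) / 2 + y * b + (y * p - z / 2 * c)" for a b p y :: real
  by (simp add: field_simps)

lemma ising_cov_cong:
  assumes "\<And>\<sigma>. \<sigma> \<in> spins \<Longrightarrow> g \<sigma> = g' \<sigma>"
  shows "ising_cov A t h f g = ising_cov A t h f g'"
proof -
  have "ising_E A t h g = ising_E A t h g'" "ising_E A t h (\<lambda>\<sigma>. f \<sigma> * g \<sigma>) = ising_E A t h (\<lambda>\<sigma>. f \<sigma> * g' \<sigma>)"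
    using assms by (auto intro: ising_E_cong)
  then show ?thesis by (simp add: ising_cov_def)
qed

lemma ising_cov_const_minus: "ising_cov A t h f (\<lambda>\<sigma>. c - g \<sigma>) = - ising_cov A t h f g"
proof -
  have "ising_E A t h (\<lambda>\<sigma>. f \<sigma> * (c - g \<sigma>)) = ising_E A t h (\<lambda>\<sigma>. c * f \<sigma> - f \<sigma> * g \<sigma>)"
    by (simp add: right_diff_distrib mult.commute)
  also have "\<dots> = c * ising_E A t h f - ising_E A t h (\<lambda>\<sigma>. f \<sigma> * g \<sigma>)"
    by (simp only: ising_E_diff ising_E_cmult)
  finally show ?thesis
    unfolding ising_cov_def ising_E_diff ising_E_const by (simp add: algebra_simps)
qed

section \<open>A calculus of solutions of the evolution equation\<close>

locale covariance_flow =
  fixes A :: "real^'n^'n::finite" and b :: "'n \<Rightarrow> real^'n" and T :: real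
  assumes squares: "\<And>u. (\<Sum>k\<in>UNIV. (b k \<bullet> u)\<^sup>2) = u \<bullet> u - u \<bullet> (A *v u)"
begin

abbreviation proj :: "'n \<Rightarrow> real^'n \<Rightarrow> real" where "proj k \<equiv> \<lambda>\<sigma>. b k \<bullet> \<sigma>"

abbreviation "generator g e t h \<equiv> (\<Sum>k\<in>UNIV. e k t h) / 2 + (\<Sum>k\<in>UNIV. ising_E A t h (proj k) * g k t h)"

text \<open>\<open>evolves w p g\<close> says that \<open>\<partial>\<^sub>t w = L w + p\<close> with \<open>L = 1/2 * (\<Sum>k. \<partial>\<^sub>k\<^sup>2) + (\<Sum>k. E(proj k) * \<partial>\<^sub>k)\<close>,
  where \<open>\<partial>\<^sub>k\<close> is the derivative in the field along \<open>b k\<close> and \<open>g k = \<partial>\<^sub>k w\<close>.\<close>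

definition evolves_with :: "(real \<Rightarrow> real^'n \<Rightarrow> real) \<Rightarrow> (real \<Rightarrow> real^'n \<Rightarrow> real) \<Rightarrow> ('n \<Rightarrow> real \<Rightarrow> real^'n \<Rightarrow> real)
    \<Rightarrow> ('n \<Rightarrow> real \<Rightarrow> real^'n \<Rightarrow> real) \<Rightarrow> bool" where
  "evolves_with w p g e \<longleftrightarrow> continuous_on ({0..T} \<times> UNIV) (\<lambda>(t, h). w t h)
     \<and> (\<forall>k t h. ((\<lambda>s. w t (h + s *\<^sub>R b k)) has_real_derivative g k t h) (at 0))
     \<and> (\<forall>k t h. ((\<lambda>s. g k t (h + s *\<^sub>R b k)) has_real_derivative e k t h) (at 0))
     \<and> (\<forall>t\<in>{0..T}. \<forall>h. ((\<lambda>s. w s h) has_real_derivative generator g e t h + p t h) (at t within {0..T}))"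

text \<open>The second derivatives \<open>e\<close> are hidden, since sources never refer to them.
  The first derivatives \<open>g\<close> stay visible because products and compositions turn them
  into sources.\<close>

definition evolves :: "(real \<Rightarrow> real^'n \<Rightarrow> real) \<Rightarrow> (real \<Rightarrow> real^'n \<Rightarrow> real) \<Rightarrow> ('n \<Rightarrow> real \<Rightarrow> real^'n \<Rightarrow> real) \<Rightarrow> bool" where
  "evolves w p g \<longleftrightarrow> (\<exists>e. evolves_with w p g e)"

lemma evolvesI:
  assumes "continuous_on ({0..T} \<times> UNIV) (\<lambda>(t, h). w t h)"
    "\<And>k t h. ((\<lambda>s. w t (h + s *\<^sub>R b k)) has_real_derivative g k t h) (at 0)"
    "\<And>k t h. ((\<lambda>s. g k t (h + s *\<^sub>R b k)) has_real_derivative e k t h) (at 0)"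
    "\<And>t h. t \<in> {0..T} \<Longrightarrow> ((\<lambda>s. w s h) has_real_derivative generator g e t h + p t h) (at t within {0..T})"
  shows "evolves w p g"
  unfolding evolves_def evolves_with_def using assms by blast

lemma evolves_withD:
  assumes "evolves_with w p g e"
  shows "continuous_on ({0..T} \<times> UNIV) (\<lambda>(t, h). w t h)"
    and "((\<lambda>s. w t (h + s *\<^sub>R b k)) has_real_derivative g k t h) (at 0)"
    and "((\<lambda>s. g k t (h + s *\<^sub>R b k)) has_real_derivative e k t h) (at 0)"
    and "t \<in> {0..T} \<Longrightarrow> ((\<lambda>s. w s h) has_real_derivative generator g e t h + p t h) (at t within {0..T})"
  using assms unfolding evolves_with_def by simp_all

lemma evolves_maximum_principle:
  assumes w: "evolves w p g"
    and p: "\<And>t h. t \<in> {0..T} \<Longrightarrow> p t h \<le> 0"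
    and bdd: "\<And>t h. t \<in> {0..T} \<Longrightarrow> w t h \<le> M"
    and init: "\<And>h. w 0 h \<le> 0" and t: "t \<in> {0..T}"
  shows "w t h \<le> 0"
proof -
  obtain e where ev: "evolves_with w p g e" using w unfolding evolves_def ..
  note c = evolves_withD(1)[OF ev] and d = evolves_withD(2)[OF ev] and e = evolves_withD(3,4)[OF ev]
  show ?thesis
  proof (rule parabolic_maximum_principle[where b = b and c = "\<lambda>k t h. ising_E A t h (proj k)"
        and C = "\<Sum>k\<in>UNIV. \<Sum>\<sigma>\<in>spins. \<bar>b k \<bullet> \<sigma>\<bar>", OF c bdd init d e _ _ t])
    fix t h assume "t \<in> {0..T}"
    then show "generator g e t h + p t h
        \<le> generator g e t h"
      using p by simp
  next
    fix k t h
    have "\<bar>ising_E A t h (proj k)\<bar> \<le> (\<Sum>\<sigma>\<in>spins. \<bar>b k \<bullet> \<sigma>\<bar>)" by (rule ising_E_abs_le)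
    also have "\<dots> \<le> (\<Sum>k\<in>UNIV. \<Sum>\<sigma>\<in>spins. \<bar>b k \<bullet> \<sigma>\<bar>)"
      by (rule member_le_sum[of k UNIV "\<lambda>k. \<Sum>\<sigma>\<in>spins. \<bar>b k \<bullet> \<sigma>\<bar>"]) (auto intro: sum_nonneg)
    finally show "\<bar>ising_E A t h (proj k)\<bar> \<le> (\<Sum>k\<in>UNIV. \<Sum>\<sigma>\<in>spins. \<bar>b k \<bullet> \<sigma>\<bar>)" .
  qed
qed

lemma evolves_cmult:
  assumes "evolves w p g"
  shows "evolves (\<lambda>t h. a * w t h) (\<lambda>t h. a * p t h) (\<lambda>k t h. a * g k t h)"
proof -
  obtain e where ev: "evolves_with w p g e" using assms unfolding evolves_def ..
  note c = evolves_withD(1)[OF ev] and d = evolves_withD(2)[OF ev] and e = evolves_withD(3,4)[OF ev]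
  show ?thesis
  proof (rule evolvesI[where e = "\<lambda>k t h. a * e k t h"])
    show "continuous_on ({0..T} \<times> UNIV) (\<lambda>(t, h). a * w t h)"
      using c unfolding case_prod_beta by (intro continuous_intros)
    show "((\<lambda>s. a * w s h) has_real_derivative (\<Sum>k\<in>UNIV. a * e k t h) / 2 + (\<Sum>k\<in>UNIV. ising_E A t h (proj k) * (a * g k t h)) + a * p t h) (at t within {0..T})"
      if "t \<in> {0..T}" for t h
      by (rule DERIV_cong[OF DERIV_cmult[OF e(2)[OF that]]])
        (simp add: sum_distrib_left[symmetric] algebra_simps)
  qed (intro DERIV_cmult d e)+
qed

lemma evolves_add:
  assumes "evolves w p g" "evolves w' p' g'"
  shows "evolves (\<lambda>t h. w t h + w' t h) (\<lambda>t h. p t h + p' t h) (\<lambda>k t h. g k t h + g' k t h)"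
proof -
  obtain e where ev: "evolves_with w p g e" using assms(1) unfolding evolves_def ..
  note c = evolves_withD(1)[OF ev] and d = evolves_withD(2)[OF ev] and e = evolves_withD(3,4)[OF ev]
  obtain e' where ev': "evolves_with w' p' g' e'" using assms(2) unfolding evolves_def ..
  note c' = evolves_withD(1)[OF ev'] and d' = evolves_withD(2)[OF ev'] and e' = evolves_withD(3,4)[OF ev']
  show ?thesis
  proof (rule evolvesI[where e = "\<lambda>k t h. e k t h + e' k t h"])
    show "continuous_on ({0..T} \<times> UNIV) (\<lambda>(t, h). w t h + w' t h)"
      using c c' unfolding case_prod_beta by (intro continuous_intros)
    show "((\<lambda>s. w s h + w' s h) has_real_derivative (\<Sum>k\<in>UNIV. e k t h + e' k t h) / 2 + (\<Sum>k\<in>UNIV. ising_E A t h (proj k) * (g k t h + g' k t h)) + (p t h + p' t h)) (at t within {0..T})"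
      if "t \<in> {0..T}" for t h
      by (rule DERIV_cong[OF DERIV_add[OF e(2)[OF that] e'(2)[OF that]]])
        (simp add: sum.distrib algebra_simps add_divide_distrib)
  qed (intro DERIV_add d d' e e')+
qed

text \<open>The second-order part of \<open>L\<close> violates the Leibniz rule by the sum of
  \<open>g k * g' k\<close>; this excess in \<open>L (w * w')\<close> is subtracted in the
  source.\<close>

lemma evolves_mult:
  assumes "evolves w p g" "evolves w' p' g'"
  shows "evolves (\<lambda>t h. w t h * w' t h) (\<lambda>t h. w t h * p' t h + p t h * w' t h - (\<Sum>k\<in>UNIV. g k t h * g' k t h))
     (\<lambda>k t h. g k t h * w' t h + g' k t h * w t h)"
proof -
  obtain e where ev: "evolves_with w p g e" using assms(1) unfolding evolves_def ..
  note c = evolves_withD(1)[OF ev] and d = evolves_withD(2)[OF ev] and e = evolves_withD(3,4)[OF ev]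
  obtain e' where ev': "evolves_with w' p' g' e'" using assms(2) unfolding evolves_def ..
  note c' = evolves_withD(1)[OF ev'] and d' = evolves_withD(2)[OF ev'] and e' = evolves_withD(3,4)[OF ev']
  have gw: "((\<lambda>s. w t (h + s *\<^sub>R b k) * w' t (h + s *\<^sub>R b k)) has_real_derivative g k t h * w' t h + g' k t h * w t h) (at 0)" for k t h
    using DERIV_mult[OF d[of t h k] d'[of t h k]] by simp
  have egw: "((\<lambda>s. g k t (h + s *\<^sub>R b k) * w' t (h + s *\<^sub>R b k) + g' k t (h + s *\<^sub>R b k) * w t (h + s *\<^sub>R b k))
       has_real_derivative (e k t h * w' t h + g' k t h * g k t h) + (e' k t h * w t h + g k t h * g' k t h)) (at 0)" for k t h
    using DERIV_add[OF DERIV_mult[OF e(1)[of k t h] d'[of t h k]] DERIV_mult[OF e'(1)[of k t h] d[of t h k]]] by simp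
  show ?thesis
  proof (rule evolvesI[where e = "\<lambda>k t h. (e k t h * w' t h + g' k t h * g k t h) + (e' k t h * w t h + g k t h * g' k t h)"])
    show "continuous_on ({0..T} \<times> UNIV) (\<lambda>(t, h). w t h * w' t h)"
      using c c' unfolding case_prod_beta by (intro continuous_intros)
    show "((\<lambda>s. w s h * w' s h) has_real_derivative
        (\<Sum>k\<in>UNIV. (e k t h * w' t h + g' k t h * g k t h) + (e' k t h * w t h + g k t h * g' k t h)) / 2
        + (\<Sum>k\<in>UNIV. ising_E A t h (proj k) * (g k t h * w' t h + g' k t h * w t h))
        + (w t h * p' t h + p t h * w' t h - (\<Sum>k\<in>UNIV. g k t h * g' k t h))) (at t within {0..T})"
      if "t \<in> {0..T}" for t h
    proof (rule DERIV_cong[OF DERIV_mult[OF e(2)[OF that] e'(2)[OF that]]])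
      have 1: "(\<Sum>k\<in>UNIV. (e k t h * w' t h + g' k t h * g k t h) + (e' k t h * w t h + g k t h * g' k t h))
         = (\<Sum>k\<in>UNIV. e k t h) * w' t h + (\<Sum>k\<in>UNIV. e' k t h) * w t h + 2 * (\<Sum>k\<in>UNIV. g k t h * g' k t h)"
        by (simp add: sum.distrib sum_distrib_left sum_distrib_right mult_ac)
      have 2: "(\<Sum>k\<in>UNIV. ising_E A t h (proj k) * (g k t h * w' t h + g' k t h * w t h))
         = (\<Sum>k\<in>UNIV. ising_E A t h (proj k) * g k t h) * w' t h + (\<Sum>k\<in>UNIV. ising_E A t h (proj k) * g' k t h) * w t h"
        by (simp add: sum.distrib sum_distrib_left sum_distrib_right distrib_left mult_ac)
      show "(generator g e t h + p t h) * w' t h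
         + (generator g' e' t h + p' t h) * w t h
         = (\<Sum>k\<in>UNIV. (e k t h * w' t h + g' k t h * g k t h) + (e' k t h * w t h + g k t h * g' k t h)) / 2
        + (\<Sum>k\<in>UNIV. ising_E A t h (proj k) * (g k t h * w' t h + g' k t h * w t h))
        + (w t h * p' t h + p t h * w' t h - (\<Sum>k\<in>UNIV. g k t h * g' k t h))"
        unfolding 1 2 by (rule product_rule_rearranged)
    qed
  qed (rule gw egw)+
qed

text \<open>The second-order chain rule adds half of \<open>f''\<close> times the squared gradient
  to \<open>L (f w)\<close>. Applied to \<open>Phi\<close> and the mean, this correction produces
  the source of the entropy.\<close>

lemma evolves_compose:
  fixes f f' f'' :: "real \<Rightarrow> real"
  assumes w: "evolves w p g" and pos: "\<And>t h. 0 < w t h"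
    and f1: "\<And>x. 0 < x \<Longrightarrow> (f has_real_derivative f' x) (at x)"
    and f2: "\<And>x. 0 < x \<Longrightarrow> (f' has_real_derivative f'' x) (at x)"
  shows "evolves (\<lambda>t h. f (w t h)) (\<lambda>t h. f' (w t h) * p t h - f'' (w t h) / 2 * (\<Sum>k\<in>UNIV. (g k t h)\<^sup>2))
     (\<lambda>k t h. f' (w t h) * g k t h)"
proof -
  obtain e where ev: "evolves_with w p g e" using w unfolding evolves_def ..
  note c = evolves_withD(1)[OF ev] and d = evolves_withD(2)[OF ev] and e = evolves_withD(3,4)[OF ev]
  have fw: "((\<lambda>s. f (w t (h + s *\<^sub>R b k))) has_real_derivative f' (w t h) * g k t h) (at 0)" for k t h
    by (rule DERIV_chain2[where f = f, OF _ d]) (simp add: f1 pos)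
  have f'w: "((\<lambda>s. f' (w t (h + s *\<^sub>R b k))) has_real_derivative f'' (w t h) * g k t h) (at 0)" for k t h
    by (rule DERIV_chain2[where f = f', OF _ d]) (simp add: f2 pos)
  have ef'w: "((\<lambda>s. f' (w t (h + s *\<^sub>R b k)) * g k t (h + s *\<^sub>R b k)) has_real_derivative f'' (w t h) * g k t h * g k t h + e k t h * f' (w t h)) (at 0)" for k t h
    using DERIV_mult[OF f'w[of t h k] e(1)[of k t h]] by simp
  have fwt: "((\<lambda>s. f (w s h)) has_real_derivative
        (\<Sum>k\<in>UNIV. f'' (w t h) * g k t h * g k t h + e k t h * f' (w t h)) / 2
        + (\<Sum>k\<in>UNIV. ising_E A t h (proj k) * (f' (w t h) * g k t h))
        + (f' (w t h) * p t h - f'' (w t h) / 2 * (\<Sum>k\<in>UNIV. (g k t h)\<^sup>2))) (at t within {0..T})"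
      if "t \<in> {0..T}" for t h
  proof -
    have "((\<lambda>s. f (w s h)) has_real_derivative f' (w t h) * (generator g e t h + p t h)) (at t within {0..T})"
      by (rule DERIV_chain2[where f = f and g = "\<lambda>s. w s h", OF f1[OF pos[of t h]] e(2)[OF that, of h]])
    then show ?thesis
    proof (rule DERIV_cong)
      have 1: "(\<Sum>k\<in>UNIV. f'' (w t h) * g k t h * g k t h + e k t h * f' (w t h))
         = f'' (w t h) * (\<Sum>k\<in>UNIV. (g k t h)\<^sup>2) + f' (w t h) * (\<Sum>k\<in>UNIV. e k t h)"
        by (simp add: sum.distrib sum_distrib_left power2_eq_square mult_ac)
      have 2: "(\<Sum>k\<in>UNIV. ising_E A t h (proj k) * (f' (w t h) * g k t h)) = f' (w t h) * (\<Sum>k\<in>UNIV. ising_E A t h (proj k) * g k t h)"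
        by (simp add: sum_distrib_left mult.left_commute)
      show "f' (w t h) * (generator g e t h + p t h) =
         (\<Sum>k\<in>UNIV. f'' (w t h) * g k t h * g k t h + e k t h * f' (w t h)) / 2
        + (\<Sum>k\<in>UNIV. ising_E A t h (proj k) * (f' (w t h) * g k t h))
        + (f' (w t h) * p t h - f'' (w t h) / 2 * (\<Sum>k\<in>UNIV. (g k t h)\<^sup>2))"
        unfolding 1 2 by (rule chain_rule_rearranged)
    qed
  qed
  have "continuous_on {0<..} f"
    by (rule continuous_at_imp_continuous_on) (use DERIV_isCont[OF f1] in simp)
  then have fc: "continuous_on ({0..T} \<times> UNIV) (\<lambda>(t, h). f (w t h))"
    unfolding case_prod_beta
  proof (rule continuous_on_compose2[of _ f])
    show "continuous_on ({0..T} \<times> UNIV) (\<lambda>x. w (fst x) (snd x))" using c by (simp add: case_prod_beta)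
  qed (simp add: image_subset_iff pos)
  show ?thesis
    by (rule evolvesI[where w = "\<lambda>t h. f (w t h)" and g = "\<lambda>k t h. f' (w t h) * g k t h"
          and p = "\<lambda>t h. f' (w t h) * p t h - f'' (w t h) / 2 * (\<Sum>k\<in>UNIV. (g k t h)\<^sup>2)"
          and e = "\<lambda>k t h. f'' (w t h) * g k t h * g k t h + e k t h * f' (w t h)", OF fc fw ef'w fwt])
qed

lemma evolves_time:
  assumes "\<And>t. t \<in> {0..T} \<Longrightarrow> (f has_real_derivative f' t) (at t within {0..T})"
  shows "evolves (\<lambda>t h. f t) (\<lambda>t h. f' t) (\<lambda>k t h. 0)"
proof (rule evolvesI[where e = "\<lambda>k t h. 0"])
  have "continuous_on {0..T} f"
    unfolding continuous_on_eq_continuous_within by (intro ballI DERIV_continuous[OF assms])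
  then show "continuous_on ({0..T} \<times> UNIV) (\<lambda>(t, h). f t)"
    unfolding case_prod_beta by (rule continuous_on_compose2[of "{0..T}" f]) (intro continuous_intros, force)
qed (use assms in auto)

lemma evolves_sum:
  assumes "finite I" "\<And>i. i \<in> I \<Longrightarrow> evolves (w i) (p i) (g i)"
  shows "evolves (\<lambda>t h. \<Sum>i\<in>I. w i t h) (\<lambda>t h. \<Sum>i\<in>I. p i t h) (\<lambda>k t h. \<Sum>i\<in>I. g i k t h)"
  using assms
proof (induction I rule: finite_induct)
  case empty
  then show ?case using evolves_time[of "\<lambda>_. 0" "\<lambda>_. 0"] by simp
next
  case (insert i I)
  then show ?case using evolves_add[of "w i" "p i" "g i"] by simp
qed

text \<open>The drift in \<open>L\<close> cancels the terms with \<open>E(proj k)\<close> from the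
  second field derivative and leaves half the covariance of \<open>f\<close> with the sum of the
  \<open>(proj k)\<^sup>2\<close>. On spins that sum is a constant minus
  \<open>\<sigma> \<bullet> (A *v \<sigma>)\<close>, and the covariance with the latter is what the
  time derivative yields.\<close>

lemma evolves_ising_E:
  "evolves (\<lambda>t h. ising_E A t h f) (\<lambda>t h. 0) (\<lambda>k t h. ising_cov A t h f (proj k))"
proof (rule evolvesI[where e = "\<lambda>k t h. ising_cov A t h (\<lambda>\<sigma>. f \<sigma> * proj k \<sigma>) (proj k)
     - (ising_cov A t h f (proj k) * ising_E A t h (proj k) + ising_cov A t h (proj k) (proj k) * ising_E A t h f)"])
  show "continuous_on ({0..T} \<times> UNIV) (\<lambda>(t, h). ising_E A t h f)"
    unfolding case_prod_beta by (intro continuous_on_ising_E continuous_intros)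
next
  fix k t h
  show "((\<lambda>s. ising_E A t (h + s *\<^sub>R b k) f) has_real_derivative ising_cov A t h f (proj k)) (at 0)"
    by (rule ising_E_field_deriv)
  show "((\<lambda>s. ising_cov A t (h + s *\<^sub>R b k) f (proj k)) has_real_derivative
     ising_cov A t h (\<lambda>\<sigma>. f \<sigma> * proj k \<sigma>) (proj k)
     - (ising_cov A t h f (proj k) * ising_E A t h (proj k) + ising_cov A t h (proj k) (proj k) * ising_E A t h f)) (at 0)"
    unfolding ising_cov_def[of A t "h + _ *\<^sub>R b k"]
    using DERIV_diff[OF ising_E_field_deriv[of A t h "b k" "\<lambda>\<sigma>. f \<sigma> * proj k \<sigma>"]
        DERIV_mult[OF ising_E_field_deriv[of A t h "b k" f] ising_E_field_deriv[of A t h "b k" "proj k"]]] by simp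
next
  fix t h assume "t \<in> {0..T}"
  let ?E = "ising_E A t h"
  have "(\<Sum>k\<in>UNIV. ising_cov A t h (\<lambda>\<sigma>. f \<sigma> * proj k \<sigma>) (proj k)
     - (ising_cov A t h f (proj k) * ?E (proj k) + ising_cov A t h (proj k) (proj k) * ?E f)) / 2
     + (\<Sum>k\<in>UNIV. ?E (proj k) * ising_cov A t h f (proj k))
     = (\<Sum>k\<in>UNIV. ising_cov A t h f (\<lambda>\<sigma>. (proj k \<sigma>)\<^sup>2)) / 2"
    unfolding sum_divide_distrib sum.distrib[symmetric]
    by (intro sum.cong) (simp_all add: ising_cov_def power2_eq_square field_simps)
  also have "(\<Sum>k\<in>UNIV. ising_cov A t h f (\<lambda>\<sigma>. (proj k \<sigma>)\<^sup>2)) = ising_cov A t h f (\<lambda>\<sigma>. \<Sum>k\<in>UNIV. (proj k \<sigma>)\<^sup>2)"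
    by (simp add: ising_cov_def sum_distrib_left ising_E_sum sum_subtractf)
  also have "\<dots> = ising_cov A t h f (\<lambda>\<sigma>. real CARD('n) - \<sigma> \<bullet> (A *v \<sigma>))"
  proof (rule ising_cov_cong)
    fix \<sigma> :: "real^'n" assume "\<sigma> \<in> spins"
    then have "\<sigma> \<bullet> \<sigma> = real CARD('n)" by (simp add: inner_vec_def spins_nth)
    then show "(\<Sum>k\<in>UNIV. (proj k \<sigma>)\<^sup>2) = real CARD('n) - \<sigma> \<bullet> (A *v \<sigma>)" by (simp only: squares)
  qed
  also have "\<dots> = - ising_cov A t h f (\<lambda>\<sigma>. \<sigma> \<bullet> (A *v \<sigma>))"
    by (rule ising_cov_const_minus)
  finally show "((\<lambda>s. ising_E A s h f) has_real_derivative
     (\<Sum>k\<in>UNIV. ising_cov A t h (\<lambda>\<sigma>. f \<sigma> * proj k \<sigma>) (proj k)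
     - (ising_cov A t h f (proj k) * ?E (proj k) + ising_cov A t h (proj k) (proj k) * ?E f)) / 2
     + (\<Sum>k\<in>UNIV. ?E (proj k) * ising_cov A t h f (proj k)) + 0) (at t within {0..T})"
    using ising_E_time_deriv[of A h f t "{0..T}"] by simp
qed

end

section \<open>Propagation of the gradient and entropy bounds\<close>

lemma ising_cov_commute: "ising_cov A t h f g = ising_cov A t h g f"
  by (simp add: ising_cov_def mult.commute)

lemma ising_cov_sum_right:
  "ising_cov A t h f (\<lambda>\<sigma>. \<Sum>i\<in>I. a i * g i \<sigma>) = (\<Sum>i\<in>I. a i * ising_cov A t h f (g i))"
proof -
  have "ising_E A t h (\<lambda>\<sigma>. f \<sigma> * (\<Sum>i\<in>I. a i * g i \<sigma>)) = ising_E A t h (\<lambda>\<sigma>. \<Sum>i\<in>I. a i * (f \<sigma> * g i \<sigma>))"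
    by (simp add: sum_distrib_left mult.left_commute)
  also have "\<dots> = (\<Sum>i\<in>I. a i * ising_E A t h (\<lambda>\<sigma>. f \<sigma> * g i \<sigma>))"
    by (simp only: ising_E_sum ising_E_cmult)
  finally show ?thesis
    unfolding ising_cov_def ising_E_sum ising_E_cmult
    by (simp add: sum_distrib_left right_diff_distrib sum_subtractf mult.left_commute)
qed

lemma ising_cov_inner:
  "ising_cov A t h f (\<lambda>\<sigma>. v \<bullet> \<sigma>) = v \<bullet> (\<chi> x. ising_cov A t h f (\<lambda>\<sigma>. \<sigma> $ x))"
  unfolding inner_vec_def inner_real_def ising_cov_sum_right by simp

lemma dirichlet_nonneg: "0 \<le> dirichlet A t h f"
proof -
  have "0 \<le> ising_E A t h (\<lambda>\<sigma>. (f \<sigma> - f (flip x \<sigma>))\<^sup>2)" for x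
    using ising_E_mono[of "\<lambda>_. 0" "\<lambda>\<sigma>. (f \<sigma> - f (flip x \<sigma>))\<^sup>2" A t h] by simp
  then show ?thesis by (simp add: dirichlet_def sum_nonneg)
qed

lemma continuous_on_Max:
  fixes f :: "'i \<Rightarrow> 'a::topological_space \<Rightarrow> real"
  assumes "finite I" "I \<noteq> {}" "\<And>i. i \<in> I \<Longrightarrow> continuous_on S (f i)"
  shows "continuous_on S (\<lambda>x. Max ((\<lambda>i. f i x) ` I))"
  using assms
proof (induction I rule: finite_ne_induct)
  case (insert i I)
  have "(\<lambda>x. Max ((\<lambda>i. f i x) ` insert i I)) = (\<lambda>x. max (f i x) (Max ((\<lambda>i. f i x) ` I)))"
    using insert.hyps by simp
  then show ?case using insert by (auto intro!: continuous_on_max)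
qed simp

lemma continuous_on_susceptibility: "continuous_on S (susceptibility A)"
  unfolding susceptibility_def
  by (intro continuous_on_Max continuous_on_sum continuous_on_ising_E continuous_intros) auto

lemma (in ferromagnet) susceptibility_nonneg: "0 \<le> t \<Longrightarrow> 0 \<le> susceptibility A t"
  unfolding susceptibility_def
  by (subst Max_ge_iff) (auto intro!: sum_nonneg order_trans[OF ising_cov_bounds(1,2)[of t 0]])

text \<open>The left side is the source of the squared gradient divided by the mean. The terms with
  second derivatives \<open>G\<close> complete to minus a sum of squares of
  \<open>G j k - r j * r k / m\<close>, divided by \<open>m\<close>; only the quadratic form in
  \<open>H\<close> remains.\<close>

lemma quotient_source_le:
  fixes r :: "'k::finite \<Rightarrow> real" and H G :: "'k \<Rightarrow> 'k \<Rightarrow> real"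
  assumes m: "0 < m" and H: "(\<Sum>j\<in>UNIV. r j * (\<Sum>k\<in>UNIV. r k * H j k)) \<le> X * (\<Sum>j\<in>UNIV. (r j)\<^sup>2)"
  shows "(\<Sum>j\<in>UNIV. r j * r j) * (- (1 / m ^ 3) * (\<Sum>k\<in>UNIV. (r k)\<^sup>2))
     + (\<Sum>j\<in>UNIV. r j * (\<Sum>k\<in>UNIV. r k * H j k) + (\<Sum>k\<in>UNIV. r k * H j k) * r j - (\<Sum>k\<in>UNIV. G j k * G j k)) * (1 / m)
     - (\<Sum>k\<in>UNIV. (\<Sum>j\<in>UNIV. G j k * r j + G j k * r j) * (- (1 / m\<^sup>2) * r k))
     \<le> 2 * X * ((\<Sum>j\<in>UNIV. (r j)\<^sup>2) / m)"
proof -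
  define R where "R = (\<Sum>j\<in>UNIV. (r j)\<^sup>2)"
  define P where "P = (\<Sum>j\<in>UNIV. r j * (\<Sum>k\<in>UNIV. r k * H j k))"
  define G2 where "G2 = (\<Sum>j\<in>UNIV. \<Sum>k\<in>UNIV. (G j k)\<^sup>2)"
  define GR where "GR = (\<Sum>j\<in>UNIV. \<Sum>k\<in>UNIV. G j k * r j * r k)"
  have "0 \<le> (\<Sum>j\<in>UNIV. \<Sum>k\<in>UNIV. (G j k - r j * r k / m)\<^sup>2)" by (intro sum_nonneg) simp
  also have "\<dots> = (\<Sum>j\<in>UNIV. \<Sum>k\<in>UNIV. (G j k)\<^sup>2 - (2 / m) * (G j k * r j * r k) + (1 / m\<^sup>2) * ((r j)\<^sup>2 * (r k)\<^sup>2))"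
    by (intro sum.cong refl) (simp add: power2_diff power_mult_distrib power_divide)
  also have "\<dots> = G2 - (2 / m) * GR + (1 / m\<^sup>2) * (R * R)"
  proof -
    have "R * R = (\<Sum>j\<in>UNIV. \<Sum>k\<in>UNIV. (r j)\<^sup>2 * (r k)\<^sup>2)" by (simp add: R_def sum_product)
    then show ?thesis by (simp only: G2_def GR_def sum_distrib_left sum.distrib sum_subtractf)
  qed
  finally have sq: "0 \<le> G2 - (2 / m) * GR + (1 / m\<^sup>2) * (R * R)" .
  have 1: "(\<Sum>j\<in>UNIV. r j * (\<Sum>k\<in>UNIV. r k * H j k) + (\<Sum>k\<in>UNIV. r k * H j k) * r j - (\<Sum>k\<in>UNIV. G j k * G j k)) = 2 * P - G2"
    unfolding P_def G2_def sum_subtractf sum.distrib power2_eq_square by (simp add: mult.commute)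
  have 2: "(\<Sum>k\<in>UNIV. (\<Sum>j\<in>UNIV. G j k * r j + G j k * r j) * (- (1 / m\<^sup>2) * r k)) = - (2 / m\<^sup>2) * GR"
  proof -
    have "(\<Sum>k\<in>UNIV. (\<Sum>j\<in>UNIV. G j k * r j + G j k * r j) * (- (1 / m\<^sup>2) * r k))
      = (\<Sum>k\<in>UNIV. \<Sum>j\<in>UNIV. - (2 / m\<^sup>2) * (G j k * r j * r k))"
      unfolding sum_distrib_right by (intro sum.cong refl) (simp add: field_simps)
    also have "\<dots> = (\<Sum>j\<in>UNIV. \<Sum>k\<in>UNIV. - (2 / m\<^sup>2) * (G j k * r j * r k))" by (rule sum.swap)
    finally show ?thesis by (simp only: GR_def sum_distrib_left)
  qed
  have 3: "(\<Sum>j\<in>UNIV. r j * r j) = R" by (simp add: R_def power2_eq_square)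
  have "R * (- (1 / m ^ 3) * R) + (2 * P - G2) * (1 / m) - (- (2 / m\<^sup>2) * GR)
     = (2 * P - (G2 - (2 / m) * GR + (1 / m\<^sup>2) * (R * R))) / m"
    using m by (simp add: field_simps power2_eq_square power3_eq_cube)
  also have "\<dots> \<le> (2 * (X * R)) / m"
    using m sq H by (intro divide_right_mono) (auto simp: P_def R_def)
  finally show ?thesis unfolding 1 2 3 R_def[symmetric] by simp
qed

locale ising_flow = covariance_flow A b T + ferromagnet A
  for A :: "real^'n^'n::finite" and b T +
  fixes F :: "real^'n \<Rightarrow> real"
  assumes psd: "\<And>u. 0 \<le> u \<bullet> (A *v u)" and F_pos: "\<And>\<sigma>. 0 < F \<sigma>"
begin

abbreviation "mean t h \<equiv> ising_E A t h F"
abbreviation "grad j t h \<equiv> ising_cov A t h F (proj j)"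
abbreviation "hess j k t h \<equiv> ising_cov A t h (\<lambda>\<sigma>. F \<sigma> * proj j \<sigma>) (proj k)
  + - 1 * (grad k t h * ising_E A t h (proj j) + ising_cov A t h (proj j) (proj k) * mean t h)"

text \<open>The squared gradient of \<open>sqrt (mean t h)\<close> in the field along the
  \<open>b k\<close>; the factor 4 comes from differentiating the root.\<close>

definition "fisher t h = (\<Sum>j\<in>UNIV. (grad j t h)\<^sup>2) / mean t h / 4"

definition "growth t = exp (2 * integral {0..t} (susceptibility A))"

lemma mean_pos: "0 < mean t h"
proof -
  have "0 < (\<Sum>\<sigma>\<in>spins. F \<sigma> * ising_weight A t h \<sigma>)" by (intro sum_pos) (auto simp: F_pos)
  then show ?thesis by (simp add: ising_E_def)
qed

text \<open>The two expectations and the mean in the covariance have no source; all of the source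
  comes from the Leibniz defect of their product. Sums with factor \<open>- 1\<close> mirror the
  shape delivered by \<open>evolves_add\<close> and \<open>evolves_cmult\<close>.\<close>

lemma evolves_grad:
  "evolves (grad j) (\<lambda>t h. \<Sum>k\<in>UNIV. grad k t h * ising_cov A t h (proj j) (proj k)) (\<lambda>k. hess j k)"
proof -
  have "(\<lambda>t h. ising_E A t h (\<lambda>\<sigma>. F \<sigma> * proj j \<sigma>) + - 1 * (mean t h * ising_E A t h (proj j))) = grad j"
    by (simp add: ising_cov_def)
  with evolves_add[OF evolves_ising_E[of "\<lambda>\<sigma>. F \<sigma> * proj j \<sigma>"]
      evolves_cmult[OF evolves_mult[OF evolves_ising_E[of F] evolves_ising_E[of "proj j"]], of "- 1"]]
  show ?thesis by simp
qed

text \<open>The form is the variance of \<open>v \<bullet> \<sigma>\<close> with \<open>v\<close>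
  the combination of the \<open>b j\<close> with coefficients \<open>r j\<close>. That
  \<open>v \<bullet> v\<close> is at most the sum of the \<open>(r j)\<^sup>2\<close> is dual to
  \<open>squares\<close> with positive \<open>A\<close>: write \<open>v \<bullet> v\<close> as the
  sum of \<open>r j * (b j \<bullet> v)\<close> and apply Cauchy-Schwarz.\<close>

lemma quadratic_covariance_le:
  assumes t: "0 \<le> t"
  shows "(\<Sum>j\<in>UNIV. r j * (\<Sum>k\<in>UNIV. r k * ising_cov A t h (proj j) (proj k))) \<le> susceptibility A t * (\<Sum>j\<in>UNIV. (r j)\<^sup>2)"
proof -
  define v where "v = (\<Sum>j\<in>UNIV. r j *\<^sub>R b j)"
  have v: "(\<lambda>\<sigma>. v \<bullet> \<sigma>) = (\<lambda>\<sigma>. \<Sum>j\<in>UNIV. r j * proj j \<sigma>)"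
    by (simp add: v_def inner_sum_left)
  have "(\<Sum>j\<in>UNIV. r j * (\<Sum>k\<in>UNIV. r k * ising_cov A t h (proj j) (proj k))) = ising_cov A t h (\<lambda>\<sigma>. v \<bullet> \<sigma>) (\<lambda>\<sigma>. v \<bullet> \<sigma>)"
    unfolding v ising_cov_sum_right ising_cov_commute[of A t h "\<lambda>\<sigma>. \<Sum>j\<in>UNIV. r j * proj j \<sigma>"] ..
  also have "\<dots> \<le> susceptibility A t * (v \<bullet> v)" by (rule ising_variance_le[OF t])
  also have "v \<bullet> v \<le> (\<Sum>j\<in>UNIV. (r j)\<^sup>2)"
  proof -
    have "(v \<bullet> v)\<^sup>2 = (\<Sum>j\<in>UNIV. r j * (b j \<bullet> v))\<^sup>2" using fun_cong[OF v, of v] by simp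
    also have "\<dots> \<le> (\<Sum>j\<in>UNIV. (r j)\<^sup>2) * (\<Sum>j\<in>UNIV. (b j \<bullet> v)\<^sup>2)" by (rule Cauchy_Schwarz_ineq_sum)
    also have "\<dots> \<le> (\<Sum>j\<in>UNIV. (r j)\<^sup>2) * (v \<bullet> v)"
      unfolding squares using psd[of v] by (intro mult_left_mono) (auto intro: sum_nonneg)
    finally have "(v \<bullet> v) * (v \<bullet> v) \<le> (\<Sum>j\<in>UNIV. (r j)\<^sup>2) * (v \<bullet> v)" by (simp add: power2_eq_square)
    then show ?thesis
      by (cases "v = 0") (auto simp: sum_nonneg)
  qed
  then have "susceptibility A t * (v \<bullet> v) \<le> susceptibility A t * (\<Sum>j\<in>UNIV. (r j)\<^sup>2)"
    by (rule mult_left_mono[OF _ susceptibility_nonneg[OF t]])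
  finally show ?thesis .
qed

lemma evolves_fisher:
  obtains p g where "evolves fisher p g" "\<And>t h. t \<in> {0..T} \<Longrightarrow> p t h \<le> 2 * susceptibility A t * fisher t h"
proof -
  have inv: "((\<lambda>x. 1 / x) has_real_derivative - (1 / x\<^sup>2)) (at x)" "((\<lambda>x. - (1 / x\<^sup>2)) has_real_derivative 2 / x ^ 3) (at x)" if "0 < x" for x :: real
    using that by (auto intro!: derivative_eq_intros simp: power2_eq_square power3_eq_cube divide_simps)
  have sq: "evolves (\<lambda>t h. \<Sum>i\<in>UNIV. grad i t h * grad i t h)
      (\<lambda>t h. \<Sum>i\<in>UNIV. grad i t h * (\<Sum>k\<in>UNIV. grad k t h * ising_cov A t h (proj i) (proj k))
          + (\<Sum>k\<in>UNIV. grad k t h * ising_cov A t h (proj i) (proj k)) * grad i t h - (\<Sum>k\<in>UNIV. hess i k t h * hess i k t h))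
      (\<lambda>k t h. \<Sum>i\<in>UNIV. hess i k t h * grad i t h + hess i k t h * grad i t h)"
    by (intro evolves_sum evolves_mult evolves_grad) simp
  have inv_mean: "evolves (\<lambda>t h. 1 / mean t h)
      (\<lambda>t h. - (1 / (mean t h)\<^sup>2) * 0 - 2 / mean t h ^ 3 / 2 * (\<Sum>k\<in>UNIV. (grad k t h)\<^sup>2))
      (\<lambda>k t h. - (1 / (mean t h)\<^sup>2) * grad k t h)"
    using evolves_compose[OF evolves_ising_E[of F] mean_pos inv] by simp
  note ev = evolves_cmult[OF evolves_mult[OF sq inv_mean], of "1 / 4"]
  have w: "(\<lambda>t h. 1 / 4 * ((\<Sum>i\<in>UNIV. grad i t h * grad i t h) * (1 / mean t h))) = fisher"
    by (simp add: fisher_def power2_eq_square fun_eq_iff)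
  show thesis
  proof (rule that[OF ev[unfolded w]])
    fix t h assume "t \<in> {0..T}"
    then have "0 \<le> t" by simp
    from quotient_source_le[OF mean_pos[of t h] quadratic_covariance_le[OF this, of "\<lambda>j. grad j t h" h], of "\<lambda>j k. hess j k t h"]
    show "1 / 4 * ((\<Sum>i\<in>UNIV. grad i t h * grad i t h) * (- (1 / (mean t h)\<^sup>2) * 0 - 2 / mean t h ^ 3 / 2 * (\<Sum>k\<in>UNIV. (grad k t h)\<^sup>2))
       + (\<Sum>i\<in>UNIV. grad i t h * (\<Sum>k\<in>UNIV. grad k t h * ising_cov A t h (proj i) (proj k))
          + (\<Sum>k\<in>UNIV. grad k t h * ising_cov A t h (proj i) (proj k)) * grad i t h - (\<Sum>k\<in>UNIV. hess i k t h * hess i k t h)) * (1 / mean t h)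
       - (\<Sum>k\<in>UNIV. (\<Sum>i\<in>UNIV. hess i k t h * grad i t h + hess i k t h * grad i t h) * (- (1 / (mean t h)\<^sup>2) * grad k t h)))
       \<le> 2 * susceptibility A t * fisher t h"
      unfolding fisher_def by simp
  qed
qed

abbreviation "energy t h \<equiv> dirichlet A t h (\<lambda>\<sigma>. sqrt (F \<sigma>))"

lemma evolves_energy: "\<exists>g. evolves energy (\<lambda>t h. 0) g"
proof -
  have "evolves (\<lambda>t h. \<Sum>x\<in>UNIV. ising_E A t h (\<lambda>\<sigma>. (sqrt (F \<sigma>) - sqrt (F (flip x \<sigma>)))\<^sup>2)) (\<lambda>t h. \<Sum>x\<in>(UNIV :: 'n set). 0)
     (\<lambda>k t h. \<Sum>x\<in>UNIV. ising_cov A t h (\<lambda>\<sigma>. (sqrt (F \<sigma>) - sqrt (F (flip x \<sigma>)))\<^sup>2) (proj k))"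
    by (intro evolves_sum evolves_ising_E) simp
  from evolves_cmult[OF this, of "1 / 2"] show ?thesis
    unfolding dirichlet_def by auto
qed

lemma integral_susceptibility_deriv:
  assumes "t \<in> {0..T}"
  shows "((\<lambda>t. integral {0..t} (susceptibility A)) has_real_derivative susceptibility A t) (at t within {0..T})"
  by (rule integral_has_real_derivative[OF continuous_on_susceptibility assms])

lemma growth_deriv:
  assumes "t \<in> {0..T}"
  shows "(growth has_real_derivative 2 * susceptibility A t * growth t) (at t within {0..T})"
    and "((\<lambda>t. 1 / growth t) has_real_derivative - 2 * susceptibility A t * (1 / growth t)) (at t within {0..T})"
proof -
  show d: "(growth has_real_derivative 2 * susceptibility A t * growth t) (at t within {0..T})"
    unfolding growth_def[abs_def]
    by (rule DERIV_cong[OF DERIV_chain2[OF DERIV_exp DERIV_cmult[OF integral_susceptibility_deriv[OF assms], of 2]]]) simp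
  have "growth t \<noteq> 0" by (simp add: growth_def)
  from DERIV_divide[OF DERIV_const d this, of 1]
  show "((\<lambda>t. 1 / growth t) has_real_derivative - 2 * susceptibility A t * (1 / growth t)) (at t within {0..T})"
    using \<open>growth t \<noteq> 0\<close> by (simp add: mult_ac)
qed

lemma growth_ge_1: "0 \<le> t \<Longrightarrow> 1 \<le> growth t"
  unfolding growth_def
  by (simp, intro integral_nonneg integrable_continuous_real continuous_on_susceptibility)
    (auto intro: susceptibility_nonneg)

lemma continuous_on_growth: "continuous_on {0..T} growth"
  unfolding continuous_on_eq_continuous_within by (intro ballI DERIV_continuous[OF growth_deriv(1)])

lemma integral_growth_nonneg: "0 \<le> integral {0..T} growth"
  by (intro integral_nonneg integrable_continuous_real continuous_on_growth) (simp add: growth_def)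

text \<open>Since \<open>I - A\<close> is at most the identity, the derivatives along the
  \<open>b j\<close> are dominated by the covariances with single spins, to which the product bound
  applies site by site.\<close>

lemma fisher_initial: "fisher 0 h \<le> energy 0 h / 2"
proof -
  define v where "v = (\<chi> x. ising_cov A 0 h F (\<lambda>\<sigma>. \<sigma> $ x))"
  have "(\<Sum>j\<in>UNIV. (grad j 0 h)\<^sup>2) = (\<Sum>j\<in>UNIV. (b j \<bullet> v)\<^sup>2)" by (simp add: ising_cov_inner v_def)
  also have "\<dots> \<le> v \<bullet> v" unfolding squares using psd[of v] by simp
  also have "\<dots> = (\<Sum>x\<in>UNIV. (ising_cov A 0 h F (\<lambda>\<sigma>. \<sigma> $ x))\<^sup>2)"
    by (simp add: inner_vec_def v_def power2_eq_square)
  also have "\<dots> \<le> (\<Sum>x\<in>UNIV. mean 0 h * ising_E A 0 h (\<lambda>\<sigma>. (sqrt (F \<sigma>) - sqrt (F (flip x \<sigma>)))\<^sup>2))"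
    by (intro sum_mono product_gradient_bound less_imp_le[OF F_pos])
  also have "\<dots> = 2 * mean 0 h * energy 0 h" by (simp add: dirichlet_def sum_distrib_left)
  finally show ?thesis
    using mean_pos[of 0 h] by (simp add: fisher_def divide_le_eq mult_ac)
qed

text \<open>An a priori bound for the maximum principle: the mean is at least the minimum of
  \<open>F\<close> over the finitely many configurations, uniformly in time and field.\<close>

lemma fisher_bounded: "\<exists>M. \<forall>t h. fisher t h \<le> M"
proof -
  define a where "a = Min (F ` spins)"
  have a: "0 < a" unfolding a_def by (subst Min_gr_iff) (auto simp: F_pos)
  have m: "a \<le> mean t h" for t h
    using ising_E_mono[of "\<lambda>_. a" F A t h] by (simp add: a_def)
  define K where "K = (\<lambda>j. (\<Sum>\<sigma>\<in>spins. \<bar>F \<sigma> * proj j \<sigma>\<bar>) + (\<Sum>\<sigma>\<in>spins. \<bar>F \<sigma>\<bar>) * (\<Sum>\<sigma>\<in>spins. \<bar>proj j \<sigma>\<bar>))"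
  have "\<bar>grad j t h\<bar> \<le> K j" for j t h
  proof -
    have "\<bar>grad j t h\<bar> \<le> \<bar>ising_E A t h (\<lambda>\<sigma>. F \<sigma> * proj j \<sigma>)\<bar> + \<bar>mean t h\<bar> * \<bar>ising_E A t h (proj j)\<bar>"
      unfolding ising_cov_def abs_mult[symmetric] by (rule abs_triangle_ineq4)
    also have "\<dots> \<le> K j"
      unfolding K_def by (intro add_mono mult_mono ising_E_abs_le) (auto intro: sum_nonneg)
    finally show ?thesis .
  qed
  then have "(grad j t h)\<^sup>2 \<le> (K j)\<^sup>2" for j t h
    by (metis abs_ge_zero power2_abs power_mono)
  then have "(\<Sum>j\<in>UNIV. (grad j t h)\<^sup>2) \<le> (\<Sum>j\<in>UNIV. (K j)\<^sup>2)" for t h by (intro sum_mono)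
  then have "fisher t h \<le> (\<Sum>j\<in>UNIV. (K j)\<^sup>2) / a / 4" for t h
    unfolding fisher_def using m[of t h] a by (intro divide_right_mono frac_le) (auto intro: sum_nonneg)
  then show ?thesis by blast
qed

lemma fisher_le_energy:
  assumes t: "t \<in> {0..T}"
  shows "fisher t h \<le> growth t * energy t h / 2"
proof -
  obtain p g where f: "evolves fisher p g" "\<And>t h. t \<in> {0..T} \<Longrightarrow> p t h \<le> 2 * susceptibility A t * fisher t h"
    by (rule evolves_fisher) (rule that)
  obtain g' where e: "evolves energy (\<lambda>t h. 0) g'" using evolves_energy by (elim exE)
  obtain M where M: "\<And>t h. fisher t h \<le> M" using fisher_bounded by blast
  \<comment> \<open>The logarithmic derivative of \<open>growth\<close> is twice the susceptibility,
    so dividing \<open>fisher\<close> by \<open>growth\<close> cancels its source bound.\<close>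
  have "evolves (\<lambda>t h. 1 / growth t) (\<lambda>t h. - 2 * susceptibility A t * (1 / growth t)) (\<lambda>k t h. 0)"
    by (rule evolves_time[OF growth_deriv(2)])
  note ev = evolves_add[OF evolves_mult[OF this f(1)] evolves_cmult[OF e, of "- (1 / 2)"]]
  have "1 / growth t * fisher t h + - (1 / 2) * energy t h \<le> 0"
  proof (rule evolves_maximum_principle[OF ev _ _ _ t])
    fix t h assume t: "t \<in> {0..T}"
    have gr: "1 \<le> growth t" using growth_ge_1 t by simp
    have "1 / growth t * p t h \<le> 1 / growth t * (2 * susceptibility A t * fisher t h)"
      using gr by (intro mult_left_mono f(2)[OF t]) simp
    then show "1 / growth t * p t h + - 2 * susceptibility A t * (1 / growth t) * fisher t h - (\<Sum>k\<in>UNIV. 0 * g k t h) + - (1 / 2) * 0 \<le> 0"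
      by (simp add: mult_ac)
    have "0 \<le> fisher t h" using mean_pos[of t h] by (simp add: fisher_def sum_nonneg)
    then have "1 / growth t * fisher t h \<le> 1 * M"
      using gr by (intro mult_mono M) (auto simp: divide_le_eq)
    then show "1 / growth t * fisher t h + - (1 / 2) * energy t h \<le> M"
      using dirichlet_nonneg[of A t h "\<lambda>\<sigma>. sqrt (F \<sigma>)"] by simp
  next
    fix h show "1 / growth 0 * fisher 0 h + - (1 / 2) * energy 0 h \<le> 0"
      using fisher_initial[of h] by (simp add: growth_def)
  qed
  moreover have "0 < growth t" by (simp add: growth_def)
  ultimately show ?thesis by (simp add: field_simps)
qed

lemma Phi_ge_minus_1: "0 < x \<Longrightarrow> - 1 \<le> Phi x"
  using Phi_ge_tangent[of x 1] by (simp add: Phi_def)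

text \<open>In the difference of the two sides the entropy contributes the source
  \<open>2 * fisher\<close>, and the energy with its time-dependent factor contributes
  \<open>- growth * energy\<close>. The bound \<open>fisher_le_energy\<close> says exactly that the
  sum is nonpositive; at time 0 the comparison is \<open>product_lsi\<close>.\<close>

lemma entropy_le_energy:
  assumes T: "0 \<le> T"
  shows "entropy A T h F \<le> (1 + integral {0..T} growth) * energy T h"
proof -
  have Phi': "(Phi has_real_derivative ln x + 1) (at x)" "((\<lambda>x. ln x + 1) has_real_derivative 1 / x) (at x)" if "0 < x" for x :: real
    unfolding Phi_def[abs_def] using that by (auto intro!: derivative_eq_intros)
  have Y: "evolves (\<lambda>t h. 1 + integral {0..t} growth) (\<lambda>t h. growth t) (\<lambda>k t h. 0)"
  proof (rule evolves_time)
    fix t assume t: "t \<in> {0..T}"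
    show "((\<lambda>t. 1 + integral {0..t} growth) has_real_derivative growth t) (at t within {0..T})"
      using DERIV_add[OF DERIV_const integral_has_real_derivative[OF continuous_on_growth t], of 1] by simp
  qed
  have Y_pos: "0 \<le> 1 + integral {0..t} growth" if "t \<in> {0..T}" for t
  proof -
    have "continuous_on {0..t} growth" by (rule continuous_on_subset[OF continuous_on_growth]) (use that in auto)
    then have "0 \<le> integral {0..t} growth"
      by (intro integral_nonneg integrable_continuous_real) (simp_all add: growth_def)
    then show ?thesis by simp
  qed
  have top_time: "T \<in> {0..T}" using T by simp
  obtain g' where e: "evolves energy (\<lambda>t h. 0) g'" using evolves_energy by (elim exE)
  note ev = evolves_add[OF evolves_add[OF evolves_ising_E[of "\<lambda>\<sigma>. Phi (F \<sigma>)"]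
        evolves_cmult[OF evolves_compose[OF evolves_ising_E[of F] mean_pos Phi'], of "- 1"]]
      evolves_cmult[OF evolves_mult[OF Y e], of "- 1"]]
  have "ising_E A T h (\<lambda>\<sigma>. Phi (F \<sigma>)) + - 1 * Phi (mean T h) + - 1 * ((1 + integral {0..T} growth) * energy T h) \<le> 0"
  proof (rule evolves_maximum_principle[OF ev _ _ _ top_time])
    fix t h assume t: "t \<in> {0..T}"
    have "(\<Sum>k\<in>UNIV. (grad k t h)\<^sup>2) / mean t h \<le> 2 * (growth t * energy t h)"
      using fisher_le_energy[OF t, of h] by (simp add: fisher_def)
    then show "0 + - 1 * ((ln (mean t h) + 1) * 0 - 1 / mean t h / 2 * (\<Sum>k\<in>UNIV. (grad k t h)\<^sup>2))
       + - 1 * ((1 + integral {0..t} growth) * 0 + growth t * energy t h - (\<Sum>k\<in>UNIV. 0 * g' k t h)) \<le> 0"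
      by simp
    have "ising_E A t h (\<lambda>\<sigma>. Phi (F \<sigma>)) \<le> (\<Sum>\<sigma>\<in>spins. \<bar>Phi (F \<sigma>)\<bar>)"
      using ising_E_abs_le[of A t h "\<lambda>\<sigma>. Phi (F \<sigma>)"] by simp
    moreover have "0 \<le> (1 + integral {0..t} growth) * energy t h"
      using Y_pos[OF t] by (intro mult_nonneg_nonneg dirichlet_nonneg)
    ultimately show "ising_E A t h (\<lambda>\<sigma>. Phi (F \<sigma>)) + - 1 * Phi (mean t h) + - 1 * ((1 + integral {0..t} growth) * energy t h)
        \<le> (\<Sum>\<sigma>\<in>spins. \<bar>Phi (F \<sigma>)\<bar>) + 1"
      using Phi_ge_minus_1[OF mean_pos[of t h]] by simp
  next
    fix h show "ising_E A 0 h (\<lambda>\<sigma>. Phi (F \<sigma>)) + - 1 * Phi (mean 0 h) + - 1 * ((1 + integral {0..0} growth) * energy 0 h) \<le> 0"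
      using product_lsi[of F A h] F_pos by (simp add: entropy_def less_imp_le)
  qed
  then show ?thesis by (simp add: entropy_def)
qed

end

section \<open>The log-Sobolev constant\<close>

text \<open>Completing the square in one variable at a time; \<open>X\<close> contains the rows not
  yet eliminated. A vanishing pivot forces its whole row to vanish.\<close>

lemma psd_sum_of_squares:
  fixes B :: "real^'n^'n::finite"
  assumes "finite X" "transpose B = B" "\<And>u. 0 \<le> u \<bullet> (B *v u)" "\<And>i j. i \<notin> X \<Longrightarrow> B $ i $ j = 0"
  shows "\<exists>b :: 'n \<Rightarrow> real^'n. \<forall>u. u \<bullet> (B *v u) = (\<Sum>k\<in>X. (b k \<bullet> u)\<^sup>2)"
  using assms
proof (induction X arbitrary: B rule: finite_induct)
  case empty
  then have "B = 0" by (simp add: vec_eq_iff)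
  then show ?case by simp
next
  case (insert x X)
  have sym: "u \<bullet> (B *v v) = v \<bullet> (B *v u)" for u v
    by (metis dot_lmul_matrix inner_commute insert.prems(1) transpose_matrix_vector)
  define r where "r = row x B"
  have r: "axis x 1 \<bullet> (B *v u) = r \<bullet> u" for u
    unfolding inner_axis' by (simp add: r_def matrix_vector_mult_def row_def inner_vec_def)
  have rx: "r $ x = B $ x $ x" by (simp add: r_def row_def)
  have Bsym: "B $ i $ j = B $ j $ i" for i j
    using insert.prems(1) by (metis transpose_def vec_lambda_beta)
  have expand: "(u - s *\<^sub>R axis x 1) \<bullet> (B *v (u - s *\<^sub>R axis x 1)) = u \<bullet> (B *v u) - 2 * s * (r \<bullet> u) + s\<^sup>2 * r $ x" for u s
  proof -
    have "axis x 1 \<bullet> (B *v axis x 1) = r $ x" by (simp add: r inner_axis)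
    moreover have "u \<bullet> (B *v axis x 1) = r \<bullet> u" using sym[of u "axis x 1"] r by simp
    ultimately show ?thesis
      by (simp add: matrix_vector_mult_diff_distrib matrix_vector_mult_scaleR inner_diff r power2_eq_square algebra_simps)
  qed
  show ?case
  proof (cases "r $ x = 0")
    case True
    have "r \<bullet> u = 0" for u
    proof (rule ccontr)
      assume n: "r \<bullet> u \<noteq> 0"
      have "0 \<le> u \<bullet> (B *v u) - 2 * s * (r \<bullet> u)" for s
        using insert.prems(2)[of "u - s *\<^sub>R axis x 1"] unfolding expand True by simp
      \<comment> \<open>For this \<open>s\<close> the form would equal minus
        \<open>u \<bullet> (B *v u) + 2\<close>, which is negative.\<close>
      from this[of "(u \<bullet> (B *v u) + 1) / (r \<bullet> u)"] show False
        using n insert.prems(2)[of u] by simp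
    qed
    then have "r \<bullet> r = 0" .
    then have "r = 0" by simp
    then have "B $ x $ j = 0" for j by (simp add: r_def row_def vec_eq_iff)
    then have "B $ i $ j = 0" if "i \<notin> X" for i j using insert.prems(3) that by (cases "i = x") auto
    then obtain b where b: "\<And>u. u \<bullet> (B *v u) = (\<Sum>k\<in>X. (b k \<bullet> u)\<^sup>2)"
      using insert.IH[OF insert.prems(1,2)] by blast
    have "u \<bullet> (B *v u) = (\<Sum>k\<in>insert x X. ((b(x := 0)) k \<bullet> u)\<^sup>2)" for u
    proof -
      have "(\<Sum>k\<in>X. ((b(x := 0)) k \<bullet> u)\<^sup>2) = (\<Sum>k\<in>X. (b k \<bullet> u)\<^sup>2)" using insert.hyps by (intro sum.cong) auto
      then show ?thesis using insert.hyps b by simp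
    qed
    then show ?thesis by blast
  next
    case False
    have "0 \<le> r $ x" using insert.prems(2)[of "axis x 1"] r[of "axis x 1"] by (simp add: inner_axis)
    then have rpos: "0 < r $ x" using False by simp
    define B' :: "real^'n^'n" where "B' = (\<chi> i j. B $ i $ j - r $ i * r $ j / r $ x)"
    have form: "u \<bullet> (B' *v u) = u \<bullet> (B *v u) - (r \<bullet> u)\<^sup>2 / r $ x" for u
    proof -
      have "u \<bullet> (B' *v u) = (\<Sum>i\<in>UNIV. \<Sum>j\<in>UNIV. u $ i * (B $ i $ j * u $ j)) - (\<Sum>i\<in>UNIV. \<Sum>j\<in>UNIV. (r $ i * u $ i) * (r $ j * u $ j)) / r $ x"
        by (simp add: inner_vec_def matrix_vector_mult_def B'_def left_diff_distrib right_diff_distrib sum_subtractf sum_distrib_left sum_divide_distrib mult_ac)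
      also have "(\<Sum>i\<in>UNIV. \<Sum>j\<in>UNIV. (r $ i * u $ i) * (r $ j * u $ j)) = (r \<bullet> u)\<^sup>2"
        by (simp add: inner_vec_def power2_eq_square sum_product)
      also have "(\<Sum>i\<in>UNIV. \<Sum>j\<in>UNIV. u $ i * (B $ i $ j * u $ j)) = u \<bullet> (B *v u)"
        by (simp add: inner_vec_def matrix_vector_mult_def sum_distrib_left)
      finally show ?thesis .
    qed
    have 1: "transpose B' = B'" by (simp add: B'_def transpose_def vec_eq_iff Bsym mult.commute)
    have 2: "0 \<le> u \<bullet> (B' *v u)" for u
    proof -
      \<comment> \<open>The reduced form is the minimum of the form of \<open>B\<close> along the
        line through \<open>u\<close> in the direction \<open>axis x 1\<close>.\<close>
      have "u \<bullet> (B' *v u) = (u - (r \<bullet> u / r $ x) *\<^sub>R axis x 1) \<bullet> (B *v (u - (r \<bullet> u / r $ x) *\<^sub>R axis x 1))"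
        unfolding expand form using rpos by (simp add: power2_eq_square)
      then show ?thesis using insert.prems(2) by simp
    qed
    have 3: "B' $ i $ j = 0" if "i \<notin> X" for i j
    proof (cases "i = x")
      case True then show ?thesis using rpos by (simp add: B'_def) (simp add: r_def row_def)
    next
      case False
      then have "B $ i $ j = 0" "r $ i = 0" using insert.prems(3) that Bsym[of x i] by (auto simp: r_def row_def)
      then show ?thesis by (simp add: B'_def)
    qed
    obtain b where b: "\<And>u. u \<bullet> (B' *v u) = (\<Sum>k\<in>X. (b k \<bullet> u)\<^sup>2)"
      using insert.IH[OF 1 2 3] by blast
    define bx where "bx = (1 / sqrt (r $ x)) *\<^sub>R r"
    have "u \<bullet> (B *v u) = (\<Sum>k\<in>insert x X. ((b(x := bx)) k \<bullet> u)\<^sup>2)" for u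
    proof -
      have "(\<Sum>k\<in>X. ((b(x := bx)) k \<bullet> u)\<^sup>2) = (\<Sum>k\<in>X. (b k \<bullet> u)\<^sup>2)" using insert.hyps by (intro sum.cong) auto
      moreover have "(bx \<bullet> u)\<^sup>2 = (r \<bullet> u)\<^sup>2 / r $ x" using rpos by (simp add: bx_def power_mult_distrib power_divide)
      ultimately show ?thesis using insert.hyps b[of u] form[of u] by simp
    qed
    then show ?thesis by blast
  qed
qed

section \<open>Nonnegative functions and the supremum\<close>

lemma ising_E_pos:
  assumes "\<And>\<sigma>. \<sigma> \<in> spins \<Longrightarrow> 0 \<le> f \<sigma>" "\<tau> \<in> spins" "0 < f \<tau>"
  shows "0 < ising_E A t h f"
proof -
  have "0 < (\<Sum>\<sigma>\<in>spins. f \<sigma> * ising_weight A t h \<sigma>)"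
    using assms by (intro sum_pos2[of spins \<tau>]) (auto simp: less_imp_le)
  then show ?thesis by (simp add: ising_E_def)
qed

lemma tendsto_ising_E:
  assumes "\<And>\<sigma>. ((\<lambda>e. f e \<sigma>) \<longlongrightarrow> g \<sigma>) net"
  shows "((\<lambda>e. ising_E A t h (f e)) \<longlongrightarrow> ising_E A t h g) net"
  unfolding ising_E_def using less_imp_neq[OF ising_Z_pos, of A t h]
  by (intro tendsto_intros assms) auto

lemma Phi_right_continuous:
  assumes "0 \<le> a"
  shows "((\<lambda>e. Phi (a + e)) \<longlongrightarrow> Phi a) (at_right 0)"
proof (cases "a = 0")
  case True
  have "((\<lambda>e::real. e * ln e) \<longlongrightarrow> 0) (at_right 0)" by real_asymp
  then show ?thesis by (simp add: True Phi_def)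
next
  case False
  have "((\<lambda>e. a + e) \<longlongrightarrow> a + 0) (at_right 0)" by (intro tendsto_intros)
  then have "((\<lambda>e. a + e) \<longlongrightarrow> a) (at_right 0)" by simp
  with False show ?thesis unfolding Phi_def by (intro tendsto_mult tendsto_ln)
qed

text \<open>Shifting \<open>F\<close> by a small positive constant makes it strictly positive, as
  the flow requires; the limit uses continuity of \<open>Phi\<close> from the right, including at
  0.\<close>

lemma entropy_le_by_approximation:
  assumes pos: "\<And>F. (\<And>\<sigma>. 0 < F \<sigma>) \<Longrightarrow> entropy A t h F \<le> K * dirichlet A t h (\<lambda>\<sigma>. sqrt (F \<sigma>))"
    and F: "\<And>\<sigma>. 0 \<le> F \<sigma>"
  shows "entropy A t h F \<le> K * dirichlet A t h (\<lambda>\<sigma>. sqrt (F \<sigma>))"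
proof (rule tendsto_le[OF trivial_limit_at_right_real])
  have m: "0 \<le> ising_E A t h F" using ising_E_mono[of "\<lambda>_. 0" F A t h] F by simp
  have "((\<lambda>e. ising_E A t h (\<lambda>\<sigma>. Phi (F \<sigma> + e)) - Phi (ising_E A t h F + e)) \<longlongrightarrow> entropy A t h F) (at_right 0)"
    unfolding entropy_def by (intro tendsto_diff tendsto_ising_E Phi_right_continuous F m)
  then show "((\<lambda>e. entropy A t h (\<lambda>\<sigma>. F \<sigma> + e)) \<longlongrightarrow> entropy A t h F) (at_right 0)"
    by (simp add: entropy_def ising_E_add)
  have e0: "((\<lambda>e. a + e) \<longlongrightarrow> a) (at_right 0)" for a :: real
    using tendsto_add[OF tendsto_const tendsto_ident_at, of a 0 "{0<..}"] by simp
  show "((\<lambda>e. K * dirichlet A t h (\<lambda>\<sigma>. sqrt (F \<sigma> + e))) \<longlongrightarrow> K * dirichlet A t h (\<lambda>\<sigma>. sqrt (F \<sigma>))) (at_right 0)"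
    unfolding dirichlet_def by (intro tendsto_intros tendsto_ising_E e0)
  have "\<forall>\<^sub>F e in at_right (0::real). 0 < e" by (rule eventually_at_right_less)
  then show "\<forall>\<^sub>F e in at_right 0. entropy A t h (\<lambda>\<sigma>. F \<sigma> + e) \<le> K * dirichlet A t h (\<lambda>\<sigma>. sqrt (F \<sigma> + e))"
  proof (rule eventually_mono)
    fix e :: real assume "0 < e"
    with F show "entropy A t h (\<lambda>\<sigma>. F \<sigma> + e) \<le> K * dirichlet A t h (\<lambda>\<sigma>. sqrt (F \<sigma> + e))"
      by (intro pos) (simp add: add_nonneg_pos)
  qed
qed

text \<open>Boundedness makes \<open>Sup\<close> an upper bound of the admissible constants. The
  indicator of one configuration has positive entropy, because there is a second configuration, and
  its inequality bounds every such constant.\<close>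

lemma bdd_above_log_sobolev:
  "bdd_above {\<gamma>. \<gamma> > 0 \<and> (\<forall>F. (\<forall>\<sigma>. F \<sigma> \<ge> 0) \<longrightarrow>
     entropy A t h F \<le> 2 / \<gamma> * dirichlet A t h (\<lambda>\<sigma>. sqrt (F \<sigma>)))}"
proof -
  obtain \<sigma>0 :: "real^'a" where s0: "\<sigma>0 \<in> spins" using spins_nonempty by blast
  \<comment> \<open>\<open>undefined\<close> merely names some site; every type has one.\<close>
  define \<tau> where "\<tau> = flip undefined \<sigma>0"
  have "\<tau> $ undefined \<noteq> \<sigma>0 $ undefined"
    using spins_nth(1)[OF s0, of undefined] by (auto simp: \<tau>_def flip_nth)
  then have \<tau>: "\<tau> \<in> spins" "\<tau> \<noteq> \<sigma>0" using s0 by (auto simp: \<tau>_def flip_in_spins)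
  define G :: "real^'a \<Rightarrow> real" where "G = (\<lambda>\<sigma>. if \<sigma> = \<sigma>0 then 1 else 0)"
  have p: "0 < ising_E A t h G" by (rule ising_E_pos[OF _ s0]) (auto simp: G_def)
  have "0 < ising_E A t h (\<lambda>\<sigma>. 1 - G \<sigma>)" by (rule ising_E_pos[OF _ \<tau>(1)]) (use \<tau> in \<open>auto simp: G_def\<close>)
  then have "ising_E A t h G < 1" by (simp add: ising_E_diff)
  then have "Phi (ising_E A t h G) < 0" using p by (simp add: Phi_def mult_pos_neg)
  moreover have "(\<lambda>\<sigma>. Phi (G \<sigma>)) = (\<lambda>_. 0)" by (auto simp: Phi_def G_def)
  ultimately have ent: "0 < entropy A t h G" by (simp add: entropy_def)
  show ?thesis
  proof (rule bdd_aboveI)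
    fix \<gamma> assume "\<gamma> \<in> {\<gamma>. \<gamma> > 0 \<and> (\<forall>F. (\<forall>\<sigma>. F \<sigma> \<ge> 0) \<longrightarrow>
       entropy A t h F \<le> 2 / \<gamma> * dirichlet A t h (\<lambda>\<sigma>. sqrt (F \<sigma>)))}"
    moreover have "\<forall>\<sigma>. G \<sigma> \<ge> 0" by (simp add: G_def)
    ultimately have "0 < \<gamma>" "entropy A t h G \<le> 2 / \<gamma> * dirichlet A t h (\<lambda>\<sigma>. sqrt (G \<sigma>))" by auto
    then show "\<gamma> \<le> 2 * dirichlet A t h (\<lambda>\<sigma>. sqrt (G \<sigma>)) / entropy A t h G"
      using ent by (simp add: field_simps)
  qed
qed

theorem theorem1p1:
  fixes A :: "real^'n^'n::finite" and \<beta> :: real and h :: "real^'n"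
  assumes sym: "transpose A = A"
    and posdef: "\<And>v. v \<noteq> 0 \<Longrightarrow> v \<bullet> (A *v v) > 0"
    and offdiag: "\<And>x y. x \<noteq> y \<Longrightarrow> A$x$y \<le> 0"
    and norm_le: "onorm (\<lambda>v. A *v v) \<le> 1"
    and beta: "\<beta> \<ge> 0"
  shows "1 / log_sobolev_const A \<beta> h
           \<le> 1/2 + integral {0..\<beta>} (\<lambda>t. exp (2 * integral {0..t} (\<lambda>s. susceptibility A s)))"
proof -
  have psd: "0 \<le> u \<bullet> (A *v u)" for u
    using posdef[of u] by (cases "u = 0") (auto simp: less_imp_le)
  have B: "u \<bullet> ((mat 1 - A) *v u) = u \<bullet> u - u \<bullet> (A *v u)" for u
    by (simp add: matrix_vector_mult_diff_rdistrib inner_diff_right)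
  \<comment> \<open>The norm bound enters here: it makes \<open>mat 1 - A\<close> positive
    semidefinite.\<close>
  have "u \<bullet> (A *v u) \<le> u \<bullet> u" for u
  proof -
    have "norm (A *v u) \<le> onorm ((*v) A) * norm u" by (rule onorm[OF matrix_vector_mul_bounded_linear])
    also have "\<dots> \<le> 1 * norm u" using norm_le by (intro mult_right_mono) auto
    finally have "norm u * norm (A *v u) \<le> norm u * norm u" by (intro mult_left_mono) auto
    then show ?thesis
      using norm_cauchy_schwarz[of u "A *v u"] by (simp add: dot_square_norm power2_eq_square)
  qed
  moreover have "transpose (mat 1 - A) = mat 1 - A"
    using sym by (simp add: transpose_def mat_def vec_eq_iff)
  ultimately have "\<exists>b :: 'n \<Rightarrow> real^'n. \<forall>u. u \<bullet> u - u \<bullet> (A *v u) = (\<Sum>k\<in>UNIV. (b k \<bullet> u)\<^sup>2)"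
    using psd_sum_of_squares[where B = "mat 1 - A" and X = UNIV] unfolding B by simp
  then obtain b :: "'n \<Rightarrow> real^'n" where b: "\<forall>u. u \<bullet> u - u \<bullet> (A *v u) = (\<Sum>k\<in>UNIV. (b k \<bullet> u)\<^sup>2)" ..
  have squares: "(\<Sum>k\<in>UNIV. (b k \<bullet> u)\<^sup>2) = u \<bullet> u - u \<bullet> (A *v u)" for u
    by (rule b[rule_format, symmetric])
  have flow: "ising_flow A b F" if "\<And>\<sigma>. 0 < F \<sigma>" for F
    by (intro ising_flow.intro covariance_flow.intro ferromagnet.intro ising_flow_axioms.intro squares sym offdiag psd that)
  define I where "I = integral {0..\<beta>} (\<lambda>t. exp (2 * integral {0..t} (\<lambda>s. susceptibility A s)))"
  \<comment> \<open>\<open>growth\<close> does not depend on \<open>F\<close>; the instance for the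
    constant 1 gives access to it before any \<open>F\<close> is chosen.\<close>
  interpret one: ising_flow A b \<beta> "\<lambda>_. 1" by (rule flow) simp
  have I: "integral {0..\<beta>} one.growth = I" by (simp add: I_def one.growth_def[abs_def])
  then have I0: "0 \<le> I" using one.integral_growth_nonneg by simp
  have lsi: "entropy A \<beta> h F \<le> (1 + I) * dirichlet A \<beta> h (\<lambda>\<sigma>. sqrt (F \<sigma>))" if "\<And>\<sigma>. 0 < F \<sigma>" for F
  proof -
    interpret f: ising_flow A b \<beta> F by (rule flow[OF that])
    show ?thesis using f.entropy_le_energy[OF beta, of h] I by simp
  qed
  \<comment> \<open>For this constant \<open>2 / \<gamma>\<close> equals
    \<open>1 + 2 * I\<close>.\<close>
  have "1 / (1 / 2 + I) \<in> {\<gamma>. \<gamma> > 0 \<and> (\<forall>F. (\<forall>\<sigma>. F \<sigma> \<ge> 0) \<longrightarrow>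
       entropy A \<beta> h F \<le> 2 / \<gamma> * dirichlet A \<beta> h (\<lambda>\<sigma>. sqrt (F \<sigma>)))}"
  proof (intro CollectI conjI allI impI)
    fix F :: "real^'n \<Rightarrow> real" assume F: "\<forall>\<sigma>. F \<sigma> \<ge> 0"
    have "entropy A \<beta> h F \<le> (1 + I) * dirichlet A \<beta> h (\<lambda>\<sigma>. sqrt (F \<sigma>))"
      by (rule entropy_le_by_approximation[OF lsi]) (use F in auto)
    \<comment> \<open>The flow gave the factor \<open>1 + I\<close>, which is at most
      \<open>1 + 2 * I\<close> because \<open>I\<close> is nonnegative.\<close>
    also have "\<dots> \<le> 2 / (1 / (1 / 2 + I)) * dirichlet A \<beta> h (\<lambda>\<sigma>. sqrt (F \<sigma>))"
      using I0 by (intro mult_right_mono dirichlet_nonneg) simp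
    finally show "entropy A \<beta> h F \<le> 2 / (1 / (1 / 2 + I)) * dirichlet A \<beta> h (\<lambda>\<sigma>. sqrt (F \<sigma>))" .
  qed (use I0 in simp)
  then have "1 / (1 / 2 + I) \<le> log_sobolev_const A \<beta> h"
    unfolding log_sobolev_const_def by (rule cSup_upper[OF _ bdd_above_log_sobolev])
  moreover have "0 < 1 / (1 / 2 + I)" using I0 by simp
  ultimately have "1 / log_sobolev_const A \<beta> h \<le> 1 / (1 / (1 / 2 + I))"
    by (intro frac_le) simp_all
  then show ?thesis by (simp add: I_def)
qed

end
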